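(* Let $n\ge 1$, $r\ge 0$, and let $\mathcal{O}$ be an $n$-symplectic oscillating tableau of length $r$ (of arbitrary shape). Then $\mathcal{M}(\mathrm{ev}\,\mathcal{O})$ is the reversal of $\mathcal{M}(\mathcal{O})$, and $\mathcal{M}_T(\mathrm{ev}\,\mathcal{O})$ is the Schützenberger evacuation of $\mathcal{M}_T(\mathcal{O})$.
   Context: **Oscillating tableaux.** An $n$-symplectic oscillating tableau of length $r$ and shape $\mu$ is a sequence of partitions $\mathcal{O}=(\emptyset=\omega^0,\omega^1,\dots,\omega^r=\mu)$ such that the Ferrers diagrams of consecutive partitions differ by exactly one cell and each $\omega^i$ has at most $n$ nonzero parts. Partitions with at most $n$ parts are regarded as vectors in $\mathbb{Z}^n$ (padded with zeros). **Evacuation.** Oscillating tableaux correspond to highest weight words in the $r$-th tensor power of the crystal of the vector representation of $\mathrm{Sp}(2n)$ (the $i$-th letter has weight $\omega^i-\omega^{i-1}$), and evacuation $\mathrm{ev}$ is the action of the generator $s_{1,r}$ of the cactus group on these words. Explicitly (this may be taken as the definition): for $v\in\mathbb{Z}^n$ let $\mathrm{dom}(v)$ be the vector obtained by sorting the absolute values of the entries of $v$ into weakly decreasing order. Define $T_{k,j}$ for $0\le k\le j\le r$ by $T_{0,j}=\omega^j$, $T_{k,k}=\emptyset$, and $T_{k+1,j}=\mathrm{dom}(T_{k+1,j-1}+T_{k,j}-T_{k,j-1})$ for $j\ge k+2$. Then $\mathrm{ev}\,\mathcal{O}=(T_{r,r},T_{r-1,r},\dots,T_{1,r},T_{0,r})$,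 i.e. the $i$-th partition of $\mathrm{ev}\,\mathcal O$ is $T_{r-i,r}$. **Backward rule of growth diagrams.** Consider a square cell whose corners top-left, top-right, bottom-right are labelled with partitions $\kappa$, $\mu$, $\nu$, where $\mu$ equals or is obtained by adding one cell from each of $\kappa$, $\nu$. If $\kappa=\nu$ and $\mu=\kappa+e_1$ (a cell added to the first row), then the cell contains a cross and the bottom-left corner gets the label $\lambda=\kappa$. Otherwise the cell is empty and the bottom-left label $\lambda$ is determined by $\lambda'=\mathrm{sort}(\kappa'+\nu'-\mu')$, where $'$ denotes conjugation of partitions and $\mathrm{sort}$ sorts a vector into weakly decreasing order. **Sundaram's map (in Roby's form).** Consider corners $(a,b)$ with integers $0\le a\le b\le r$, where $a$ is the horizontal coordinate (increasing to the right) and $b$ the vertical coordinate (increasing downwards). The cell in column $i$ and row $j$ ($1\le i<j\le r$) has corners $(i-1,j-1),(i,j-1),(i-1,j),(i,j)$. Label $(i,i)$ with $\omega^i$ for $0\le i\le r$, and label $(i-1,i)$ with the smaller of $\omega^{i-1},\omega^i$ for $1\le i\le r$. Apply the backward rule successively to determine all remaining labels and all crosses. Then $\mathcal{M}(\mathcal{O})$ is the set of pairs $\{i,j\}$ such that the cell in column $i$ and row $j$ contains a cross; it is a perfect matching of a subset of $\{1,\dots,r\}$. $\mathcal{M}_T(\mathcal{O})$ is the partial standard Young tableau of shape $\mu$ corresponding to the sequence of labels of $(0,r),(1,r),\dots,(r,r)$: the entry $i$ is in the cell by which the labels of $(i-1,r)$ and $(i,r)$ differ, if they differ. (A partial standard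 Young tableau is a filling of a Ferrers diagram with distinct integers, strictly increasing along rows and columns.) Its entries are the elements of $\{1,\dots,r\}$ not matched by $\mathcal{M}(\mathcal{O})$. **Reversal.** The reversal of a perfect matching of a subset of $\{1,\dots,r\}$ replaces each pair $(i,j)$ by $(r+1-j,r+1-i)$. **Schützenberger evacuation** of a partial standard Young tableau $T$ with entries in $\{1,\dots,r\}$: rotate $T$ by $180^\circ$, replace each entry $x$ by $r+1-x$, and rectify the resulting skew tableau by jeu de taquin. *)

theory Defs
  imports Main
begin

section \<open>Partitions\<close>

text \<open>A partition is the function listing its parts, indexed from 0 and padded with zeros;
  the same functions serve as vectors in \<open>\<int>\<^sup>n\<close>. Cells are pairs (row, column), indexed from 0,
  with rows growing downwards (English convention).\<close>

type_synonym parts = "nat \<Rightarrow> nat"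
type_synonym cell = "nat \<times> nat"

definition is_partition :: "parts \<Rightarrow> bool" where
  "is_partition p \<longleftrightarrow> antimono p \<and> finite {i. p i \<noteq> 0}"

definition num_parts :: "parts \<Rightarrow> nat" where
  "num_parts p = card {i. p i \<noteq> 0}"

definition empty_partition :: parts where
  "empty_partition = (\<lambda>_. 0)"

definition ferrers :: "parts \<Rightarrow> cell set" where
  "ferrers p = {(i, j). j < p i}"

definition conjugate :: "parts \<Rightarrow> parts" where
  "conjugate p = (\<lambda>j. card {i. j < p i})"

text \<open>Weakly decreasing rearrangement of \<open>(v 0, \<dots>, v (N - 1))\<close>, padded with zeros.\<close>

definition sort_desc :: "nat \<Rightarrow> (nat \<Rightarrow> int) \<Rightarrow> nat \<Rightarrow> int" where
  "sort_desc N v = (\<lambda>i. if i < N then rev (sort (map v [0..<N])) ! i else 0)"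


section \<open>Oscillating tableaux and evacuation\<close>

text \<open>A sequence \<open>\<omega>\<^sup>0, \<dots>, \<omega>\<^sup>r\<close> is a function on \<open>nat\<close>; its values beyond \<open>r\<close> are irrelevant.\<close>

definition oscillating_tableau :: "nat \<Rightarrow> nat \<Rightarrow> (nat \<Rightarrow> parts) \<Rightarrow> bool" where
  "oscillating_tableau n r \<omega> \<longleftrightarrow>
     \<omega> 0 = empty_partition \<and>
     (\<forall>i\<le>r. is_partition (\<omega> i) \<and> num_parts (\<omega> i) \<le> n) \<and>
     (\<forall>i<r. \<exists>c. (c \<notin> ferrers (\<omega> i) \<and> ferrers (\<omega> (Suc i)) = insert c (ferrers (\<omega> i))) \<or>
                (c \<notin> ferrers (\<omega> (Suc i)) \<and> ferrers (\<omega> i) = insert c (ferrers (\<omega> (Suc i)))))"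

definition dominant :: "nat \<Rightarrow> (nat \<Rightarrow> int) \<Rightarrow> parts" where
  "dominant n v = (\<lambda>i. nat (sort_desc n (\<lambda>k. \<bar>v k\<bar>) i))"

text \<open>\<open>evac_label n \<omega> k j\<close> is \<open>T\<^bsub>k,j\<^esub>\<close>; it is meaningful for \<open>k \<le> j\<close> only.\<close>

fun evac_label :: "nat \<Rightarrow> (nat \<Rightarrow> parts) \<Rightarrow> nat \<Rightarrow> nat \<Rightarrow> parts" where
  "evac_label n \<omega> 0 j = \<omega> j"
| "evac_label n \<omega> (Suc k) j =
     (if j \<le> Suc k then empty_partition
      else dominant n (\<lambda>i. int (evac_label n \<omega> (Suc k) (j - 1) i)
                           + int (evac_label n \<omega> k j i)
                           - int (evac_label n \<omega> k (j - 1) i)))"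

definition evacuation :: "nat \<Rightarrow> nat \<Rightarrow> (nat \<Rightarrow> parts) \<Rightarrow> (nat \<Rightarrow> parts)" where
  "evacuation n r \<omega> = (\<lambda>i. evac_label n \<omega> (r - i) r)"


section \<open>Sundaram's map via growth diagrams\<close>

text \<open>The arguments \<open>\<kappa>\<close>, \<open>\<mu>\<close>, \<open>\<nu>\<close> are the labels of the top-left, top-right and bottom-right corners.\<close>

definition has_cross :: "parts \<Rightarrow> parts \<Rightarrow> parts \<Rightarrow> bool" where
  "has_cross \<kappa> \<mu> \<nu> \<longleftrightarrow> \<kappa> = \<nu> \<and> \<mu> = \<kappa>(0 := \<kappa> 0 + 1)"

text \<open>The diagrams of \<open>\<kappa>\<close> and \<open>\<nu>\<close> lie in that of \<open>\<mu>\<close>, so their conjugates have at most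
  \<open>\<mu> 0\<close> nonzero entries; for a cell without a cross, the sorted vector has no negative entries.\<close>

definition backward_rule :: "parts \<Rightarrow> parts \<Rightarrow> parts \<Rightarrow> parts" where
  "backward_rule \<kappa> \<mu> \<nu> =
     (if has_cross \<kappa> \<mu> \<nu> then \<kappa>
      else conjugate (\<lambda>j. nat (sort_desc (\<mu> 0)
             (\<lambda>k. int (conjugate \<kappa> k) + int (conjugate \<nu> k) - int (conjugate \<mu> k)) j)))"

definition smaller :: "parts \<Rightarrow> parts \<Rightarrow> parts" where
  "smaller p q = (if ferrers p \<subseteq> ferrers q then p else q)"

text \<open>\<open>growth_label \<omega> a b\<close> is the label of the corner \<open>(a, b)\<close>; it is meaningful for \<open>a \<le> b\<close> only.\<close>

function growth_label :: "(nat \<Rightarrow> parts) \<Rightarrow> nat \<Rightarrow> nat \<Rightarrow> parts" where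
  "growth_label \<omega> a b =
     (if b \<le> a then \<omega> a
      else if b = Suc a then smaller (\<omega> a) (\<omega> b)
      else backward_rule (growth_label \<omega> a (b - 1))
                         (growth_label \<omega> (Suc a) (b - 1))
                         (growth_label \<omega> (Suc a) b))"
  by pat_completeness auto
termination
  by (relation "measure (\<lambda>(\<omega>, a, b). b - a)") auto

declare growth_label.simps [simp del]

definition sundaram_matching :: "nat \<Rightarrow> (nat \<Rightarrow> parts) \<Rightarrow> nat set set" where
  "sundaram_matching r \<omega> =
     {{i, j} | i j. 1 \<le> i \<and> i < j \<and> j \<le> r \<and>
        has_cross (growth_label \<omega> (i - 1) (j - 1)) (growth_label \<omega> i (j - 1)) (growth_label \<omega> i j)}"

text \<open>Fillings of finite sets of cells are partial maps from cells to entries.\<close>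

type_synonym filling = "cell \<rightharpoonup> nat"

definition sundaram_tableau :: "nat \<Rightarrow> (nat \<Rightarrow> parts) \<Rightarrow> filling" where
  "sundaram_tableau r \<omega> = (\<lambda>c.
     let P = (\<lambda>i. 1 \<le> i \<and> i \<le> r \<and>
                  c \<in> sym_diff (ferrers (growth_label \<omega> (i - 1) r)) (ferrers (growth_label \<omega> i r)))
     in if \<exists>i. P i then Some (THE i. P i) else None)"


section \<open>Reversal of matchings and Schuetzenberger evacuation\<close>

definition reversal :: "nat \<Rightarrow> nat set set \<Rightarrow> nat set set" where
  "reversal r m = (\<lambda>p. (\<lambda>i. r + 1 - i) ` p) ` m"

definition is_ferrers :: "cell set \<Rightarrow> bool" where
  "is_ferrers D \<longleftrightarrow> (\<exists>p. is_partition p \<and> D = ferrers p)"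

text \<open>Rotation by 180 degrees of a filling of a Ferrers diagram within its bounding rectangle,
  together with the complementation \<open>x \<mapsto> r + 1 - x\<close> of its entries in \<open>{1, \<dots>, r}\<close>.\<close>

definition rotate_complement :: "nat \<Rightarrow> filling \<Rightarrow> filling" where
  "rotate_complement r T =
     (let a = card (fst ` dom T); b = card (snd ` dom T)
      in (\<lambda>(i, j). if i < a \<and> j < b
                   then map_option (\<lambda>x. r + 1 - x) (T (a - 1 - i, b - 1 - j))
                   else None))"

text \<open>Inner corners of a filling of skew shape: corners of \<open>R\<close>, for a presentation of the shape
  as \<open>L - R\<close> with Ferrers diagrams \<open>R \<subseteq> L\<close>.\<close>

definition inner_corner :: "filling \<Rightarrow> cell \<Rightarrow> bool" where
  "inner_corner S c \<longleftrightarrow>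
     (\<exists>L R. is_ferrers L \<and> is_ferrers R \<and> R \<subseteq> L \<and> dom S = L - R \<and>
            c \<in> R \<and> is_ferrers (R - {c}))"

text \<open>\<open>slide c S S'\<close>: moving the hole \<open>c\<close> of \<open>S\<close> to the outer boundary, by repeatedly exchanging it
  with the smaller of its right and lower neighbours, results in \<open>S'\<close>.\<close>

inductive slide :: "cell \<Rightarrow> filling \<Rightarrow> filling \<Rightarrow> bool" where
  stop: "S (i, Suc j) = None \<Longrightarrow> S (Suc i, j) = None \<Longrightarrow> slide (i, j) S S"
| right: "S (i, Suc j) = Some x \<Longrightarrow> (\<forall>y. S (Suc i, j) = Some y \<longrightarrow> x < y) \<Longrightarrow>
          slide (i, Suc j) (S((i, j) := Some x, (i, Suc j) := None)) S' \<Longrightarrow> slide (i, j) S S'"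
| down: "S (Suc i, j) = Some y \<Longrightarrow> (\<forall>x. S (i, Suc j) = Some x \<longrightarrow> y < x) \<Longrightarrow>
         slide (Suc i, j) (S((i, j) := Some y, (Suc i, j) := None)) S' \<Longrightarrow> slide (i, j) S S'"

definition jdt_step :: "filling \<Rightarrow> filling \<Rightarrow> bool" where
  "jdt_step S S' \<longleftrightarrow> (\<exists>c. inner_corner S c \<and> slide c S S')"

text \<open>The result does not depend on the order of the slides (Schuetzenberger), so for a skew
  tableau the description below determines a unique filling.\<close>

definition rectification :: "filling \<Rightarrow> filling" where
  "rectification S = (THE U. jdt_step\<^sup>*\<^sup>* S U \<and> is_ferrers (dom U))"

definition schuetzenberger_evacuation :: "nat \<Rightarrow> filling \<Rightarrow> filling" where
  "schuetzenberger_evacuation r T = rectification (rotate_complement r T)"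

end

theory Submission
  imports Defs "HOL-Library.Multiset"
begin

text \<open>
The local rule of evacuation does not depend on \<open>n\<close> and \<open>\<omega>\<close> may be extended by a descending path to an
oscillating tableau of empty shape and length \<open>N\<close>, which corresponds to a perfect matching of \<open>N\<close> points
on a circle. Two disjoint arcs select the chords between them, a partial permutation, and hence a
shape (that of Robinson and Schensted). All data of the theorem are such shapes:
the labels of Sundaram's growth diagram belong to the arcs \<open>(0, a]\<close> and \<open>(b, N]\<close>, the label \<open>T\<^bsub>k,j\<^esub>\<close> of
evacuation to \<open>(k, j]\<close> and its complement, and the labels of the growth diagram of the evacuated tableau to
\<open>(r - a, r]\<close> and \<open>(r, N + r - b]\<close>. Indeed, moving two of the four endpoints of the arcs by one step gives a
square that satisfies Fomin's growth rule, its transpose or the jeu de taquin rule, depending on the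
endpoints, and each of the rules in the statement is one of these. All six kinds of squares follow from
the growth rule in one direction by a single lemma on cubes together with reflections of the matrix.

The tableaux are \<open>(0, q] \<mapsto>\<close> shape and \<open>(r - q, r] \<mapsto>\<close> shape for the fixed second arc \<open>(r, N]\<close>. They are
related by Schuetzenberger's evacuation, because rectification can be read off the reading word
of a skew tableau: the shapes of the reading word are those of the tableau if the tableau is straight, do
not change under slides, and rotating the tableau rotates the permutation matrix of the word.
\<close>

section \<open>Squares of growth diagrams\<close>

declare split_paired_All [simp del] split_paired_Ex [simp del]

text \<open>The descending extension makes the labels on the left and bottom sides of Sundaram's
  diagram empty, so that the crosses alone determine it. In a step of evacuation one point leaves an
  arc and another one enters it. A moving point deletes a column of a window and adds a row or vice
  versa, two changes where an elementary square has room for one. However, a point has at most one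
  chord: depending on the arc in which it ends, either the column or the row is empty. Only a chord
  joining both moving points escapes this, and it is exactly the case in which the absolute value in
  \<open>dominant\<close> acts. Shapes are defined by growth from one corner of a window, so only
  moves away from that corner are understood at first; the cubes describe a new column on the
  opposite side, which amounts to saying that reflection of the matrix transposes shapes. No
  increasing subsequences are involved. Invariance under slides uses the same windows: after the
  inner shape is filled with a standard tableau, a slide is the deletion of the entry 1 from a
  straight tableau, that is, a window that starts one column later.\<close>

definition dset :: "cell set \<Rightarrow> bool" where
  "dset D \<longleftrightarrow> finite D \<and> (\<forall>i j i' j'. (i, j) \<in> D \<longrightarrow> i' \<le> i \<longrightarrow> j' \<le> j \<longrightarrow> (i', j') \<in> D)"

definition le1 :: "cell set \<Rightarrow> cell set \<Rightarrow> bool" where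
  "le1 A B \<longleftrightarrow> A = B \<or> (\<exists>x. x \<notin> A \<and> B = insert x A)"

text \<open>A square of a growth diagram, with smallest corner \<open>A\<close>, largest corner \<open>D\<close> and \<open>c\<close> telling whether
  it contains a cross; \<open>rel x y\<close> restricts the position of the second cell \<open>y\<close> if both middle
  corners add the same cell \<open>x\<close>, and \<open>init y\<close> that of the cell created by a cross. Sundaram's backward
  rule is \<open>rowface\<close>, its transpose is \<open>colface\<close>, and \<open>jdtface\<close> is the rule of jeu de taquin.\<close>

definition face :: "bool \<Rightarrow> (cell \<Rightarrow> cell \<Rightarrow> bool) \<Rightarrow> (cell \<Rightarrow> bool) \<Rightarrow>
    cell set \<Rightarrow> cell set \<Rightarrow> cell set \<Rightarrow> cell set \<Rightarrow> bool" where
  "face c rel init A B C D \<longleftrightarrow> dset A \<and> dset B \<and> dset C \<and> dset D \<and> le1 A B \<and> le1 A C \<and>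
     (if c then B = A \<and> C = A \<and> (\<exists>y. y \<notin> A \<and> D = insert y A \<and> init y)
      else (A = B \<inter> C \<and> D = B \<union> C) \<or>
           (B = C \<and> (\<exists>x y. x \<notin> A \<and> B = insert x A \<and> y \<notin> B \<and> D = insert y B \<and> rel x y)))"

definition adjacent :: "cell \<Rightarrow> cell \<Rightarrow> bool" where
  "adjacent x y \<longleftrightarrow> y = (fst x, Suc (snd x)) \<or> y = (Suc (fst x), snd x)"

abbreviation "colface c \<equiv> face c (\<lambda>x y. snd y = Suc (snd x)) (\<lambda>y. snd y = 0)"
abbreviation "rowface c \<equiv> face c (\<lambda>x y. fst y = Suc (fst x)) (\<lambda>y. fst y = 0)"
abbreviation "jdtface \<equiv> face False adjacent (\<lambda>y. False)"

section \<open>Order ideals of cells and their addable cells\<close>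

lemma dset_empty [simp]: "dset {}" by (simp add: dset_def)

lemma dsetD: "dset D \<Longrightarrow> (i, j) \<in> D \<Longrightarrow> i' \<le> i \<Longrightarrow> j' \<le> j \<Longrightarrow> (i', j') \<in> D"
  unfolding dset_def by blast

lemma dset_finite: "dset D \<Longrightarrow> finite D" unfolding dset_def by blast

lemma dset_Un: "dset A \<Longrightarrow> dset B \<Longrightarrow> dset (A \<union> B)"
  unfolding dset_def by blast

lemma dset_Int: "dset A \<Longrightarrow> dset B \<Longrightarrow> dset (A \<inter> B)"
  unfolding dset_def by blast

lemma le1_refl [simp]: "le1 A A" by (simp add: le1_def)

lemma le1_insert [simp]: "le1 A (insert x A)"
  by (cases "x \<in> A") (auto simp: le1_def)

lemma le1_subset: "le1 A B \<Longrightarrow> A \<subseteq> B" by (auto simp: le1_def)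

lemma insert_cell_dset:
  assumes "dset D" "dset (insert (i, j) D)" "(i, j) \<notin> D"
  shows "i' < i \<Longrightarrow> j' \<le> j \<Longrightarrow> (i', j') \<in> D" "j' < j \<Longrightarrow> i' \<le> i \<Longrightarrow> (i', j') \<in> D"
    "i \<le> i' \<Longrightarrow> j \<le> j' \<Longrightarrow> (i', j') \<notin> D"
proof -
  show "i' < i \<Longrightarrow> j' \<le> j \<Longrightarrow> (i', j') \<in> D"
    using dsetD[OF assms(2), of i j i' j'] by auto
  show "j' < j \<Longrightarrow> i' \<le> i \<Longrightarrow> (i', j') \<in> D"
    using dsetD[OF assms(2), of i j i' j'] by auto
  show "i \<le> i' \<Longrightarrow> j \<le> j' \<Longrightarrow> (i', j') \<notin> D"
    using dsetD[OF assms(1), of i' j' i j] assms(3) by auto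
qed

text \<open>Of two candidates in one row or column the smaller would already have to be present for
  the larger to be addable. This is why the growth rules need to name only a row or a column of the
  new cell.\<close>

lemma insert_cell_unique:
  assumes "dset D" "dset (insert y D)" "dset (insert z D)" "y \<notin> D" "z \<notin> D"
    "fst y = fst z \<or> snd y = snd z"
  shows "y = z"
proof -
  obtain i j i' j' where yz: "y = (i, j)" "z = (i', j')" by fastforce
  have "(i', j') \<notin> D" "(i, j) \<notin> D" using assms yz by auto
  then show ?thesis
    using insert_cell_dset[of D i j] insert_cell_dset[of D i' j'] assms yz
    by (metis fst_conv snd_conv le_refl linorder_neqE_nat)
qed

lemma face_le1:
  assumes "face c rel init A B C D" shows "le1 B D" "le1 C D"
  using assms unfolding face_def le1_def by (auto split: if_splits; blast)+

lemma face_dset: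
  assumes "face c rel init A B C D" shows "dset A" "dset B" "dset C" "dset D" "le1 A B" "le1 A C"
  using assms unfolding face_def by auto

lemma face_commute: "face c rel init A B C D \<longleftrightarrow> face c rel init A C B D"
  unfolding face_def by (auto split: if_splits)

lemma face_trivial:
  assumes "dset A" "dset B" "le1 A B"
  shows "face False rel init A A B B" "face False rel init A B A B"
  using assms le1_subset[of A B] unfolding face_def by auto

lemma face_cases:
  assumes "face False rel init A B C D"
  obtains (left) "A = B" "C = D" | (right) "A = C" "B = D"
  | (union) x y where "x \<noteq> y" "x \<notin> A" "y \<notin> A" "B = insert x A" "C = insert y A" "D = insert x (insert y A)"
  | (chain) x y where "x \<notin> A" "B = insert x A" "C = B" "y \<notin> B" "D = insert y B" "rel x y"
proof -
  have le: "le1 A B" "le1 A C" using assms unfolding face_def by auto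
  consider "A = B \<inter> C" "D = B \<union> C" | "B = C" "\<exists>x y. x \<notin> A \<and> B = insert x A \<and> y \<notin> B \<and> D = insert y B \<and> rel x y"
    using assms unfolding face_def by auto
  then show ?thesis
  proof cases
    case 1
    show ?thesis
    proof (cases "A = B \<or> A = C")
      case True then show ?thesis using 1 left right by blast
    next
      case False
      then obtain x y where xy: "x \<notin> A" "B = insert x A" "y \<notin> A" "C = insert y A" using le by (auto simp: le1_def)
      have "x \<noteq> y" using 1 xy by auto
      then show ?thesis using xy 1 union by (metis Un_insert_left Un_insert_right sup.idem)
    qed
  next
    case 2
    then show ?thesis using chain by blast
  qed
qed

text \<open>Trivial edges propagate across squares without a cross. This makes empty rows and
  columns of the matrix visible in the shapes, and later it traces the lines of a growth diagram
  between a cross and the diagonal.\<close>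

lemma face_degenerate:
  assumes "face False rel init A B C D" shows "A = B \<longleftrightarrow> C = D" "A = C \<longleftrightarrow> B = D"
proof -
  have "(A = B \<longleftrightarrow> C = D) \<and> (A = C \<longleftrightarrow> B = D)"
    using assms
  proof (cases rule: face_cases)
    case (union x y)
    then have "x \<in> B" "y \<in> C" "x \<notin> C" "y \<notin> B" "x \<in> D" "y \<in> D" by auto
    with union(2,3) show ?thesis by blast
  next
    case (chain x y)
    then have "x \<in> B" "y \<in> D" by auto
    with chain show ?thesis by blast
  qed simp_all
  then show "A = B \<longleftrightarrow> C = D" "A = C \<longleftrightarrow> B = D" by auto
qed

lemma face_FalseI:
  assumes "dset A" "dset B" "dset C" "dset D" "le1 A B" "le1 A C"
    "A = B \<inter> C \<and> D = B \<union> C \<or>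
      B = C \<and> (\<exists>x y. x \<notin> A \<and> B = insert x A \<and> y \<notin> B \<and> D = insert y B \<and> rel x y)"
  shows "face False rel init A B C D"
  unfolding face_def if_False by (intro conjI assms)

lemma face_unionI:
  assumes "dset A" "dset B" "dset C" "x \<noteq> y" "x \<notin> A" "y \<notin> A" "B = insert x A" "C = insert y A"
    "D = insert x (insert y A)"
  shows "face False rel init A B C D"
proof -
  have D: "D = B \<union> C" using assms by auto
  moreover have "A = B \<inter> C" unfolding assms(7,8) using assms(4,5,6) by auto
  moreover have "dset D" unfolding D using dset_Un assms by blast
  moreover have "le1 A B" "le1 A C" unfolding assms(7,8) by simp_all
  ultimately show ?thesis by (intro face_FalseI disjI1 conjI assms)
qed

lemma face_chainI:
  assumes "dset A" "dset B" "dset D" "x \<notin> A" "y \<notin> B" "rel x y" "B = insert x A" "C = B" "D = insert y B"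
  shows "face False rel init A B C D"
proof -
  have "\<exists>x y. x \<notin> A \<and> B = insert x A \<and> y \<notin> B \<and> D = insert y B \<and> rel x y"
    by (intro exI[of _ x] exI[of _ y] conjI) (fact assms)+
  moreover have "le1 A B" unfolding assms(7) by simp
  ultimately show ?thesis unfolding assms(8) by (intro face_FalseI disjI2 conjI assms refl)
qed

lemma face_cross:
  assumes "dset A" "dset (insert y A)" "y \<notin> A" "init y"
  shows "face True rel init A A A (insert y A)"
  using assms unfolding face_def by auto

section \<open>The fourth corner of a square\<close>

lemma colface_unique:
  assumes "colface c A B C D" "colface c A B C D'" shows "D = D'"
proof (cases c)
  case True
  then obtain y y' where "y \<notin> A" "D = insert y A" "snd y = 0" "y' \<notin> A" "D' = insert y' A" "snd y' = 0"
    "dset A" "dset D" "dset D'"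
    using assms unfolding face_def by auto
  then show ?thesis using insert_cell_unique[of A y y'] by auto
next
  case False
  then have f: "colface False A B C D" "colface False A B C D'" using assms by simp_all
  from f(1) show ?thesis
  proof (cases rule: face_cases)
    case left show ?thesis using face_degenerate(1)[OF f(2)] left by simp
  next
    case right show ?thesis using face_degenerate(2)[OF f(2)] right by simp
  next
    case union show ?thesis using f(2) by (cases rule: face_cases) (use union in auto)
  next
    case (chain x y)
    from f(2) show ?thesis
    proof (cases rule: face_cases)
      case (chain x' y')
      have "x = x'" using \<open>x \<notin> A\<close> \<open>B = insert x A\<close> chain by auto
      then have "y = y'" using insert_cell_unique[of B y y'] chain \<open>y \<notin> B\<close> \<open>D = insert y B\<close>
          \<open>snd y = Suc (snd x)\<close> f[THEN face_dset(4)] face_dset(2)[OF f(1)] by auto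
      then show ?thesis using chain \<open>D = insert y B\<close> by simp
    qed (use chain in auto)
  qed
qed

lemma adjacent_not_addable:
  assumes "dset (insert y A)" "x \<notin> A" "adjacent x y" shows False
proof -
  have "x \<noteq> y" using assms(3) unfolding adjacent_def by (metis fst_conv snd_conv n_not_Suc_n)
  moreover have "x \<in> insert y A" using assms dsetD[of "insert y A" "fst y" "snd y" "fst x" "snd x"]
    by (auto simp: adjacent_def)
  ultimately show False using assms by auto
qed

text \<open>Adjacent cells can be added in one order only, so the union case and the chain case
  exclude each other.\<close>

lemma jdtface_unique:
  assumes "jdtface A B C D" "jdtface A B C' D" shows "C = C'"
proof -
  note f = assms
  have d: "dset C" "dset C'" using face_dset(3)[OF f(1)] face_dset(3)[OF f(2)] by auto
  from f(1) show ?thesis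
  proof (cases rule: face_cases)
    case left show ?thesis using face_degenerate(1)[OF f(2)] left by simp
  next
    case right show ?thesis using face_degenerate(2)[OF f(2)] right by simp
  next
    case (union x y)
    from f(2) show ?thesis
    proof (cases rule: face_cases)
      case (chain x' y')
      have "x = x'" "y = y'" using union chain by auto
      then show ?thesis using adjacent_not_addable[of y A x] d union chain by auto
    qed (use union in auto)
  next
    case (chain x y)
    from f(2) show ?thesis
    proof (cases rule: face_cases)
      case (union x' y')
      have "x = x'" "y = y'" using union chain by auto
      then show ?thesis using adjacent_not_addable[of y A x] d union chain by auto
    qed (use chain in auto)
  qed
qed

text \<open>Cells that are not adjacent can be added in the other order. Otherwise the first would
  lie weakly above and to the left of the second, and its right or lower neighbour would already be
  in \<open>A\<close>, and with it the first cell itself.\<close>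

lemma jdtface_exists:
  assumes "dset A" "dset B" "dset D" "le1 A B" "le1 B D"
  shows "\<exists>C. jdtface A B C D"
proof (cases "A = B \<or> B = D")
  case True then show ?thesis using face_trivial assms by blast
next
  case False
  then obtain x y where xy: "x \<notin> A" "B = insert x A" "y \<notin> B" "D = insert y B" using assms by (auto simp: le1_def)
  show ?thesis
  proof (cases "adjacent x y")
    case True
    have "jdtface A B B D" by (rule face_chainI[of _ _ _ x y]) (use True assms xy in simp_all)
    then show ?thesis by blast
  next
    case False
    obtain i j where y: "y = (i, j)" by fastforce
    obtain k l where x: "x = (k, l)" by fastforce
    have dD: "dset (insert (i, j) B)" using assms xy y by auto
    have dC: "dset (insert y A)" unfolding dset_def
    proof (intro conjI allI impI)
      show "finite (insert y A)" using assms dset_finite by auto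
      fix i1 j1 i' j' assume a: "(i1, j1) \<in> insert y A" "i' \<le> i1" "j' \<le> j1"
      show "(i', j') \<in> insert y A"
      proof (cases "(i1, j1) \<in> A")
        case True then show ?thesis using a assms(1) dsetD by blast
      next
        case F: False
        then have 1: "i1 = i" "j1 = j" using a y by auto
        then have "(i', j') \<in> insert y B" using dsetD[OF dD, of i j i' j'] a y by auto
        moreover have "(i', j') \<noteq> x"
        proof
          assume "(i', j') = x"
          then have kl: "k \<le> i" "l \<le> j" "(k, l) \<noteq> (i, j)" using a 1 x xy y by auto
          show False
          proof (cases "k < i")
            case True
            then have "(Suc k, l) = y \<or> (Suc k, l) \<in> B" using dsetD[OF dD, of i j "Suc k" l] kl y by auto
            then have "(Suc k, l) \<in> A" using False x xy by (auto simp: adjacent_def)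
            then show False using dsetD[OF assms(1), of "Suc k" l k l] x xy by auto
          next
            case F2: False
            then have "l < j" using kl by auto
            then have "(k, Suc l) = y \<or> (k, Suc l) \<in> B" using dsetD[OF dD, of i j k "Suc l"] kl y by auto
            then have "(k, Suc l) \<in> A" using False x xy by (auto simp: adjacent_def)
            then show False using dsetD[OF assms(1), of k "Suc l" k l] x xy by auto
          qed
        qed
        ultimately show ?thesis using xy by auto
      qed
    qed
    have "jdtface A B (insert y A) D"
      by (rule face_unionI[of _ _ _ x y]) (use dC assms xy in auto)
    then show ?thesis by blast
  qed
qed

section \<open>Cubes of growth diagrams\<close>

text \<open>The column right of \<open>z\<close> ends exactly in the row of \<open>x\<close>: it
  reaches that row because \<open>z\<close> lies strictly to the left of \<open>x\<close>, and it
  stops there because a further cell would have required \<open>z\<close> to be in \<open>A\<close>.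
  The situation arises when the row rule and the column rule act on the same cube.\<close>

lemma next_row_col_addable:
  assumes A: "dset A" and x: "x \<notin> A" and z: "z \<notin> A" "dset (insert z A)"
    and xz: "dset (insert z (insert x A))" "z \<noteq> x" "fst z = Suc (fst x)"
    and w: "w \<notin> insert z (insert x A)" "dset (insert w (insert z (insert x A)))" "snd w = Suc (snd z)"
  shows "w = (fst z, Suc (snd z))"
proof -
  obtain i c where xi: "x = (i, c)" by fastforce
  obtain c' where zi: "z = (Suc i, c')" using xz xi by (cases z) auto
  let ?E = "insert z (insert x A)"
  have "(i, c') \<in> A" using dsetD[OF z(2), of "Suc i" c' i c'] zi by auto
  then have "c' < c" using dsetD[OF A, of i c' i c] x xi not_le by auto
  then have "(i, Suc c') \<in> ?E" using dsetD[OF xz(1), of i c i "Suc c'"] xi by auto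
  obtain k where wk: "w = (k, Suc c')" using w zi by (cases w) auto
  have "k > i" using dsetD[OF xz(1) \<open>(i, Suc c') \<in> ?E\<close>, of k "Suc c'"] w(1) wk by (meson leI le_refl)
  moreover have "k \<le> Suc i"
  proof (rule ccontr)
    assume "\<not> k \<le> Suc i"
    then have "(Suc i, Suc c') \<in> insert w ?E" using dsetD[OF w(2), of k "Suc c'" "Suc i" "Suc c'"] wk by auto
    then have "(Suc i, Suc c') \<in> A" using wk zi xi \<open>\<not> k \<le> Suc i\<close> by auto
    then show False using dsetD[OF A, of "Suc i" "Suc c'" "Suc i" c'] z zi by auto
  qed
  ultimately show ?thesis using wk zi by auto
qed

lemma same_col_below:
  assumes "dset A" "dset (insert x A)" "x \<notin> A" "y \<notin> insert x A" "dset (insert y (insert x A))" "snd y = snd x"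
  shows "y = (Suc (fst x), snd x)"
proof -
  obtain i c where xi: "x = (i, c)" by fastforce
  obtain k where yk: "y = (k, c)" using assms xi by (cases y) auto
  have "k > i" using dsetD[OF assms(2), of i c k c] assms(4) xi yk by (metis insertI1 leI le_refl)
  moreover have "k \<le> Suc i"
  proof (rule ccontr)
    assume k: "\<not> k \<le> Suc i"
    then have "(Suc i, c) \<in> A" using dsetD[OF assms(5), of k c "Suc i" c] xi yk by auto
    then show False using dsetD[OF assms(1), of "Suc i" c i c] assms(3) xi by auto
  qed
  ultimately show ?thesis using xi yk by auto
qed

lemma dset_insert_Un:
  assumes "dset A" "dset (insert x B)" "B \<subseteq> A" shows "dset (insert x A)"
proof -
  have "insert x A = A \<union> insert x B" using assms by auto
  then show ?thesis using dset_Un assms by metis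
qed

lemma face_new_union:
  assumes "face False rel init A B C D" "B = insert x A" "C = insert y A" "x \<notin> A" "y \<notin> A" "x \<noteq> y"
  shows "D = insert x (insert y A)"
proof -
  have "B \<noteq> C" using assms by auto
  then have "D = B \<union> C" using assms(1) by (simp add: face_def)
  then show ?thesis using assms by auto
qed

lemma face_new_chain:
  assumes "face False rel init A B C D" "C = B" "B = insert x A" "x \<notin> A"
  shows "\<exists>u. u \<notin> B \<and> D = insert u B \<and> rel x u"
proof -
  have "B \<noteq> A" using assms by auto
  then obtain x' u where u: "x' \<notin> A" "B = insert x' A" "u \<notin> B" "D = insert u B" "rel x' u"
    using assms(1,2) by (auto simp: face_def)
  have "x \<in> insert x' A" using u(2) assms(3) by auto
  then have "x' = x" using assms(4) by auto
  then show ?thesis using u by blast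
qed

text \<open>Corners of the cube: \<open>A\<close>, \<open>K\<close>, \<open>N\<close>, \<open>M\<close> are the corners with the leftmost column removed and
  \<open>A'\<close>, \<open>K'\<close>, \<open>N'\<close>, \<open>M'\<close> the corresponding corners with that column present.\<close>

lemma cube_generic:
  assumes F: "colface False A K N M" and F': "colface False A' K' N' M'"
    and J: "jdtface A A' N N'" and R: "rowface False A A' K K'"
    and ne: "A \<noteq> A'" "A \<noteq> K" "A \<noteq> N"
  shows "jdtface K K' M M' \<and> rowface False N N' M M'"
proof -
  note d = face_dset[OF F] face_dset[OF F'] face_dset[OF J] face_dset[OF R]
  obtain x y z where c: "x \<notin> A" "A' = insert x A" "y \<notin> A" "K = insert y A" "z \<notin> A" "N = insert z A"
    using d(5,6) d(17) ne unfolding le1_def by metis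
  have sA: "dset A" "dset (insert x A)" "dset (insert y A)" "dset (insert z A)" using d c by auto
  have same: "b = b'" if "dset E" "dset (insert b E)" "dset (insert b' E)" "b \<notin> E" "b' \<notin> E" "fst b = fst b' \<or> snd b = snd b'"
    for b b' E using insert_cell_unique that by blast
  consider (dist) "x \<noteq> y" "x \<noteq> z" "y \<noteq> z" | (xy) "x = y" "x \<noteq> z" | (xz) "x = z" "x \<noteq> y"
    | (yz) "y = z" "x \<noteq> y" | (xyz) "x = y" "x = z" by blast
  then show ?thesis
  proof cases
    case dist
    have M: "M = insert y (insert z A)" using face_new_union[OF F c(4,6,3,5)] dist by simp
    have K': "K' = insert x (insert y A)" using face_new_union[OF R c(2,4,1,3)] dist by simp
    have N': "N' = insert x (insert z A)" using face_new_union[OF J c(2,6,1,5)] dist by simp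
    have M': "M' = insert x (insert y (insert z A))"
      using face_new_union[OF F', of y z] c dist K' N' by auto
    have "jdtface K K' M M'"
      by (rule face_unionI[of _ _ _ x z]) (use c d K' M M' dist in auto)
    moreover have "rowface False N N' M M'"
      by (rule face_unionI[of _ _ _ x y]) (use c d N' M M' dist in auto)
    ultimately show ?thesis by simp
  next
    case xy
    obtain u where u: "u \<notin> A'" "K' = insert u A'" "fst u = Suc (fst x)"
      using face_new_chain[OF R _ c(2,1)] c(4) c(2) xy by auto
    have M: "M = insert x (insert z A)" using face_new_union[OF F c(4,6,3,5)] xy by simp
    have N': "N' = insert x (insert z A)" using face_new_union[OF J c(2,6,1,5)] xy by simp
    have NM: "N' = M" "K = A'" using M N' c xy by auto
    show ?thesis
    proof (cases "u = z")
      case False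
      have e: "N' = insert z A'" "z \<notin> A'" using N' c xy by auto
      have M': "M' = insert u (insert z A')"
        using face_new_union[OF F' u(2) e(1) u(1) e(2) False] .
      have "jdtface K K' M M'"
        by (rule face_unionI[of _ _ _ u z]) (use d NM e M' u False in simp_all)
      moreover have "rowface False N N' M M'"
      proof (rule face_chainI[of _ _ _ x u])
        show "N' = insert x N" "x \<notin> N" "u \<notin> N'" using N' c xy u False by auto
      qed (use d NM e M' u in simp_all)
      ultimately show ?thesis by simp
    next
      case True
      have e: "K' = N'" using N' u True c by auto
      obtain w where w: "w \<notin> K'" "M' = insert w K'" "snd w = Suc (snd z)"
      using face_new_chain[OF F' e[symmetric] u(2,1)] True by auto
      have K'e: "K' = insert z (insert x A)" using u True c by auto
      \<comment> \<open>The row rule has produced the very cell that the other edge adds, so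
        \<open>K'\<close> and \<open>N'\<close> coincide and the column rule creates
        \<open>w\<close>. As the right neighbour of \<open>z\<close> in the row below
        \<open>x\<close>, it fits the jeu de taquin rule for \<open>z\<close> and the row rule for
        \<open>x\<close>.\<close>
      have weq: "w = (fst z, Suc (snd z))"
        by (rule next_row_col_addable[of A x]) (use d c xy u True w K'e in auto)
      have zA: "z \<notin> A'" "K' = insert z A'" using u True by auto
      have "jdtface K K' M M'"
        by (rule face_chainI[of _ _ _ z w]) (use d zA w weq NM e in \<open>simp_all add: adjacent_def\<close>)
      moreover have "rowface False N N' M M'"
      proof (rule face_chainI[of _ _ _ x w])
        show "N' = insert x N" "x \<notin> N" using N' c xy by auto
        show "fst w = Suc (fst x)" using weq u True by simp
      qed (use d NM e w in simp_all)
      ultimately show ?thesis by simp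
    qed
  next
    case xz
    obtain u where u: "u \<notin> A'" "N' = insert u A'" "adjacent x u"
      using face_new_chain[OF J _ c(2,1)] c(2,6) xz by auto
    have M: "M = insert y (insert x A)" using face_new_union[OF F c(4,6,3,5)] xz by simp
    have K': "K' = insert y (insert x A)" using face_new_union[OF R c(2,4,1,3)] xz by auto
    have "y \<noteq> u" using adjacent_not_addable[of y A x] sA c u by auto
    then have M': "M' = insert y (insert u A')"
      using face_new_union[OF F', of y u] c u K' xz by auto
    have "jdtface K K' M M'"
    proof (rule face_chainI[of _ _ _ x u])
      show "K' = insert x K" "x \<notin> K" "M = K'" "u \<notin> K'" "M' = insert u K'" using K' M M' c xz u \<open>y \<noteq> u\<close> by auto
    qed (use d u in simp_all)
    moreover have "rowface False N N' M M'"
    proof (rule face_unionI[of _ _ _ u y])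
      show "y \<notin> N" "N' = insert u N" "u \<notin> N" "M = insert y N" "M' = insert u (insert y N)" using M M' c xz u by auto
    qed (use d \<open>y \<noteq> u\<close> in simp_all)
    ultimately show ?thesis by simp
  next
    case yz
    obtain v where v: "v \<notin> K" "M = insert v K" "snd v = Suc (snd y)"
      using face_new_chain[OF F _ c(4,3)] c(4,6) yz by auto
    have K': "K' = insert x K" using face_new_union[OF R c(2,4,1,3)] c yz by auto
    have N': "N' = insert x K" using face_new_union[OF J c(2,6,1,5)] c yz by auto
    obtain v' where v': "v' \<notin> K'" "M' = insert v' K'" "snd v' = Suc (snd y)"
    proof -
      have "K' = insert y A'" "y \<notin> A'" "K' = N'" using c yz K' N' by auto
      then show thesis using face_new_chain[OF F', of y] that by auto
    qed
    have KN: "K = N" "K' = N'" "x \<notin> K" using c yz K' N' by auto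
    show ?thesis
    proof (cases "v = x")
      case False
      have "v \<notin> K'" using v K' False by auto
      moreover have "dset (insert v K')" by (rule dset_insert_Un[of _ _ K]) (use d v K' in auto)
      ultimately have "v' = v" using same[of K' v' v] d v v' by auto
      then have e: "M' = insert x (insert v K)" using v' K' by auto
      have "face False rel init K K' M M'" for rel init
        by (rule face_unionI[of _ _ _ x v]) (use d v K' KN e False in simp_all)
      then show ?thesis using KN by simp
    next
      case True
      \<comment> \<open>The column rule would give \<open>x\<close>, which the primed layer already
        contains; the next cell of that column lies directly below \<open>x\<close>, a position that
        both remaining rules permit.\<close>
      have "v' = (Suc (fst x), snd x)"
        by (rule same_col_below[of K]) (use d v' v True K' KN in auto)
      then have a: "adjacent x v'" "fst v' = Suc (fst x)" by (auto simp: adjacent_def)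
      have "face False rel init K K' M M'" if "rel x v'" for rel init
        by (rule face_chainI[of _ _ _ x v']) (use d v' v K' KN that True in simp_all)
      then show ?thesis using KN a by simp
    qed
  next
    case xyz
    obtain u where u: "u \<notin> A'" "N' = insert u A'" "adjacent x u"
      using face_new_chain[OF J _ c(2,1)] c(2,6) xyz by auto
    obtain g where g: "g \<notin> A'" "M = insert g A'" "snd g = Suc (snd x)"
      using face_new_chain[OF F _ c(4,3)] c(2,4,6) xyz by auto
    obtain w where w: "w \<notin> A'" "K' = insert w A'" "fst w = Suc (fst x)"
      using face_new_chain[OF R _ c(2,1)] c(2,4) xyz by auto
    have KN: "K = A'" "N = A'" using c xyz by auto
    show ?thesis
    proof (cases "w = u")
      case False
      \<comment> \<open>The only other neighbour of \<open>x\<close> is the one below, and it shares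
        its row with the addable cell \<open>w\<close>.\<close>
      have "u = (fst x, Suc (snd x))"
      proof (rule ccontr)
        assume "u \<noteq> (fst x, Suc (snd x))"
        then have "u = (Suc (fst x), snd x)" using u by (auto simp: adjacent_def)
        then show False using same[of A' u w] d u w False by auto
      qed
      then have "g = u" and fu: "fst u = fst x" using same[of A' u g] d u g by auto
      have M': "M' = insert w (insert u A')"
        using face_new_union[OF F' w(2) u(2) w(1) u(1) False] .
      have "jdtface K K' M M'"
        by (rule face_unionI[of _ _ _ w u]) (use d w u g M' KN \<open>g = u\<close> False in simp_all)
      moreover have "rowface False N N' M M'"
        by (rule face_chainI[of _ _ _ u w]) (use d w u g M' KN \<open>g = u\<close> False fu in simp_all)
      ultimately show ?thesis by simp
    next
      case True
      then have uu: "w = (Suc (fst x), snd x)" using u w by (auto simp: adjacent_def)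
      obtain h where h: "h \<notin> K'" "M' = insert h K'" "snd h = Suc (snd w)"
        using face_new_chain[OF F' _ w(2,1)] w(2) u(2) True by auto
      have gw: "g \<noteq> w" using g uu by auto
      have "dset (insert g K')" by (rule dset_insert_Un[of _ _ A']) (use d g w in auto)
      then have "h = g" using same[of K' g h] d h g uu gw w by auto
      then have M': "M' = insert w (insert g A')" using h w by auto
      have "face False rel init A' K' M M'" for rel init
        by (rule face_unionI[of _ _ _ w g]) (use d w g gw M' in simp_all)
      then show ?thesis using KN True u w by simp
    qed
  qed
qed

lemma face_commuteI: "face c rel init A B C D \<Longrightarrow> face c rel init A C B D"
  by (simp only: face_commute)

text \<open>The edge from \<open>A\<close> to \<open>A'\<close> stands for a new column of the
  matrix on the left, from \<open>A\<close> to \<open>N\<close> for one on the right, and from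
  \<open>A\<close> to \<open>K\<close> for a new row. Both \<open>c\<close> and \<open>d\<close> are
  entries of that row, in different columns, hence at most one is a cross. If an edge at
  \<open>A\<close> is trivial, so are its parallels and the claim reduces to a given face; otherwise
  \<open>cube_generic\<close> applies.\<close>

lemma cube:
  assumes F: "colface c A K N M" and F': "colface c A' K' N' M'"
    and J: "jdtface A A' N N'" and R: "rowface d A A' K K'" and cd: "\<not> (c \<and> d)"
  shows "jdtface K K' M M' \<and> rowface d N N' M M'"
proof -
  note ds = face_dset[OF F] face_dset[OF F'] face_dset[OF J] face_dset[OF R]
    face_le1[OF F] face_le1[OF F'] face_le1[OF J] face_le1[OF R]
  consider (no) "\<not> c" "\<not> d" | (c) c "\<not> d" | (d) "\<not> c" d using cd by blast
  then show ?thesis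
  proof cases
    case no
    then have F: "colface False A K N M" and F': "colface False A' K' N' M'" and R: "rowface False A A' K K'"
      using F F' R by auto
    consider "A = A'" | "A = K" | "A = N" | "A \<noteq> A'" "A \<noteq> K" "A \<noteq> N" by blast
    then show ?thesis
    proof cases
      case 1
      then have e: "K = K'" "N = N'" using face_degenerate(1)[OF J] face_degenerate(1)[OF R] by auto
      then have "M = M'" using colface_unique[OF F, of M'] F' 1 by simp
      then show ?thesis using face_trivial(1)[of K M] face_trivial(1)[of N M] ds e no by simp
    next
      case 2
      then have "A' = K'" using face_degenerate(2)[OF R] by auto
      then have "N = M" "N' = M'" using 2 face_degenerate(1)[OF F] face_degenerate(1)[OF F'] by auto
      then show ?thesis using 2 \<open>A' = K'\<close> J face_trivial(2)[of N N'] ds no by simp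
    next
      case 3
      then have "A' = N'" using face_degenerate(2)[OF J] by auto
      then have "K = M" "K' = M'" using 3 face_degenerate(2)[OF F] face_degenerate(2)[OF F'] by auto
      then show ?thesis using 3 \<open>A' = N'\<close> R face_trivial(2)[of K K'] ds no by simp
    next
      case 4
      then show ?thesis using cube_generic[OF F F' J R] no by simp
    qed
  next
    case c
    obtain y where y: "K = A" "N = A" "y \<notin> A" "M = insert y A" "snd y = 0" using F c by (auto simp: face_def)
    obtain y' where y': "K' = A'" "N' = A'" "y' \<notin> A'" "M' = insert y' A'" "snd y' = 0" using F' c by (auto simp: face_def)
    have dy: "dset (insert y A)" "dset A" and dy': "dset (insert y' A')" "dset A'" and le: "le1 A A'"
      using ds y(4) y'(4) by simp_all
    \<comment> \<open>A cross adds the foot of column 0 to both layers. If \<open>A'\<close> already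
      contains that cell, the next foot lies directly below it, which is allowed by the jeu de
      taquin rule and by the row rule; hence one proof for both.\<close>
    have "face False rel init A A' M M'" if rel: "\<And>x y. y = (Suc (fst x), snd x) \<Longrightarrow> rel x y" for rel init
    proof (cases "A = A'")
      case True
      then have "y = y'"
        using insert_cell_unique[OF dy(2,1), of y'] dy' y(3,5) y'(3,5) by simp
      then have "M = M'" using y(4) y'(4) True by simp
      moreover have "face False rel init A A (insert y A) (insert y A)" by (rule face_trivial) (use dy in simp_all)
      ultimately show ?thesis using True unfolding y(4) by simp
    next
      case False
      then obtain x where x: "x \<notin> A" "A' = insert x A" using le by (auto simp: le1_def)
      show ?thesis
      proof (cases "x = y")
        case True
        have "y' = (Suc (fst x), snd x)"
          using same_col_below[of A x y'] x y(5) y'(3,5) dy dy' True by simp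
        then have "rel x y'" by (rule rel)
        moreover have "M = A'" using y(4) x True by simp
        ultimately show ?thesis
          by (intro face_chainI[of _ _ _ x y']) (use x y'(3,4) dy dy' in simp_all)
      next
        case False
        have "y \<notin> A'" using False x y(3) by simp
        moreover have "dset (insert y A')" by (rule dset_insert_Un[of _ _ A]) (use dy dy' x in auto)
        ultimately have "y' = y" using insert_cell_unique[of A' y y'] dy' y(5) y'(3,5) by simp
        then have "M' = insert x (insert y A)" using y'(4) x(2) by auto
        then show ?thesis by (intro face_unionI[of _ _ _ x y]) (use x y(3,4) dy dy' False in simp_all)
      qed
    qed
    from this[of adjacent "\<lambda>y. False"] this[of "\<lambda>x y. fst y = Suc (fst x)" "\<lambda>y. fst y = 0"]
    have "jdtface A A' M M'" "rowface False A A' M M'" by (simp_all add: adjacent_def)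
    then show ?thesis unfolding y(1,2) y'(1,2) using c(2) by simp
  next
    case d
    then have F: "colface False A K N M" and F': "colface False A' K' N' M'" using F F' by auto
    obtain y where y: "A' = A" "K = A" "y \<notin> A" "K' = insert y A" "fst y = 0" using R d by (auto simp: face_def)
    have e: "N' = N" "M = N" using face_degenerate(1)[OF J] face_degenerate(1)[OF F] y by auto
    have "jdtface A K' N M' \<and> (\<exists>y'. y' \<notin> N \<and> M' = insert y' N \<and> fst y' = 0)"
    proof (cases "N = A")
      case True
      then have "M' = K'" using face_degenerate(2)[OF F'] y e by auto
      moreover have "le1 A K'" unfolding y(4) by simp
      ultimately have "jdtface A K' N M'" using face_trivial(2)[of A K'] ds True by simp
      moreover have "M' = insert y N" using \<open>M' = K'\<close> y True by simp
      ultimately show ?thesis using y(3,5) True by blast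
    next
      case False
      then obtain z where z: "z \<notin> A" "N = insert z A" using face_dset(6)[OF F] by (auto simp: le1_def)
      have N': "N' = insert z A'" using e y z by simp
      show ?thesis
      proof (cases "y = z")
        case False
        have M': "M' = insert y (insert z A')"
          using face_new_union[OF F' _ N', of y] y z False by auto
        have "jdtface A K' N M'" by (rule face_unionI[of _ _ _ y z]) (use face_dset[OF F] face_dset[OF F'] y z M' False in simp_all)
        moreover have "y \<notin> N" "M' = insert y N" using M' y z False by auto
        ultimately show ?thesis using y by blast
      next
        case True
        have "\<exists>u. u \<notin> K' \<and> M' = insert u K' \<and> snd u = Suc (snd y)"
          using face_new_chain[OF F', of y] y z True e by auto
        then obtain u where u: "u \<notin> K'" "M' = insert u K'" "snd u = Suc (snd y)" by blast
        \<comment> \<open>If \<open>u\<close> were lower in its column, the right neighbour of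
          \<open>y\<close> would be in \<open>A\<close>, and therefore \<open>y\<close> too.\<close>
        have "fst u = 0"
        proof (rule ccontr)
          assume "fst u \<noteq> 0"
          have uM: "(fst u, snd u) \<in> M'" unfolding u(2) by simp
          have "(0, Suc (snd y)) \<in> M'" by (rule dsetD[OF face_dset(4)[OF F'] uM]) (use u(3) in simp_all)
          moreover have "(0, Suc (snd y)) \<noteq> u" using \<open>fst u \<noteq> 0\<close> by auto
          moreover have "(0, Suc (snd y)) \<noteq> y" by (metis n_not_Suc_n snd_conv)
          ultimately have "(0, Suc (snd y)) \<in> A" unfolding u(2) y(4) by simp
          then have "(0, snd y) \<in> A" by (rule dsetD[OF face_dset(1)[OF F]]) simp_all
          then show False using y(3) unfolding y(5)[symmetric] by simp
        qed
        then have uu: "u = (fst y, Suc (snd y))" using u(3) y(5) by (simp add: prod_eq_iff)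
        have NK: "N = K'" using z y True by simp
        have "jdtface A K' N M'" by (rule face_chainI[of _ _ _ y u]) (use face_dset[OF F] face_dset[OF F'] y u NK uu in \<open>simp_all add: adjacent_def\<close>)
        then show ?thesis using u NK \<open>fst u = 0\<close> by blast
      qed
    qed
    then obtain y' where "jdtface A K' N M'" "y' \<notin> N" "M' = insert y' N" "fst y' = 0" by blast
    moreover have "rowface True N N N (insert y' N)"
      by (rule face_cross) (use calculation ds in auto)
    ultimately show ?thesis using y(2) e d by simp
  qed
qed

section \<open>Shapes of windows of a permutation matrix\<close>

text \<open>In the chain case the right neighbour of \<open>x\<close> is missing from
  \<open>B\<close>, so the next column ends no lower than the row above \<open>x\<close>; its first
  free cell thus has a left neighbour in \<open>B\<close> and is addable.\<close>

lemma colface_exists: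
  assumes "dset A" "dset B" "dset C" "le1 A B" "le1 A C" "c \<Longrightarrow> B = A \<and> C = A"
  shows "\<exists>D. colface c A B C D"
proof (cases c)
  case True
  define l where "l = (LEAST i. (i, 0::nat) \<notin> A)"
  have "finite (fst ` A)" using assms dset_finite by blast
  then obtain k where k: "k \<notin> fst ` A" using ex_new_if_finite infinite_UNIV_nat by blast
  then have "(k, 0) \<notin> A" by force
  then have l: "(l, 0) \<notin> A" unfolding l_def by (rule LeastI)
  have less: "(i, 0) \<in> A" if "i < l" for i using that not_less_Least unfolding l_def by blast
  have "dset (insert (l, 0) A)"
    unfolding dset_def
  proof (intro conjI allI impI)
    show "finite (insert (l, 0) A)" using assms dset_finite by auto
    fix i j i' j' assume "(i, j) \<in> insert (l, 0) A" "i' \<le> i" "j' \<le> j"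
    then show "(i', j') \<in> insert (l, 0) A"
      using dsetD[OF assms(1)] less by (cases "i' = l") (auto intro: dsetD[OF assms(1)] simp: le_less)
  qed
  then have "colface True A A A (insert (l, 0) A)" by (intro face_cross assms l) auto
  then show ?thesis using assms(6) True by metis
next
  case F: False
  show ?thesis
  proof (cases "B = C \<and> B \<noteq> A")
    case True
    then obtain x where x: "x \<notin> A" "B = insert x A" using assms by (auto simp: le1_def)
    obtain i c where xi: "x = (i, c)" by fastforce
    define l where "l = (LEAST i. (i, Suc c) \<notin> B)"
    have i: "(i, Suc c) \<notin> B" using dsetD[OF assms(1), of i "Suc c" i c] x xi by auto
    then have l: "(l, Suc c) \<notin> B" unfolding l_def by (rule LeastI)
    have less: "(i, Suc c) \<in> B" if "i < l" for i using that not_less_Least unfolding l_def by blast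
    have "l \<le> i" using i unfolding l_def by (rule Least_le)
    have "dset (insert (l, Suc c) B)"
      unfolding dset_def
    proof (intro conjI allI impI)
      show "finite (insert (l, Suc c) B)" using assms dset_finite by auto
      fix a b a' b' assume a: "(a, b) \<in> insert (l, Suc c) B" "a' \<le> a" "b' \<le> b"
      show "(a', b') \<in> insert (l, Suc c) B"
      proof (cases "(a, b) \<in> B")
        case True then show ?thesis using a dsetD[OF assms(2)] by blast
      next
        case False
        then have ab: "a = l" "b = Suc c" using a by auto
        show ?thesis
        proof (cases "b' = Suc c")
          case True then show ?thesis using ab a less by (cases "a' = l") auto
        next
          case False
          then show ?thesis using ab a \<open>l \<le> i\<close> dsetD[OF assms(2), of i c a' b'] x xi by auto
        qed
      qed
    qed
    then have "colface False A B B (insert (l, Suc c) B)"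
      by (intro face_chainI[of _ _ _ x "(l, Suc c)"]) (use assms x xi l in auto)
    then show ?thesis using F True by metis
  next
    case False
    have "colface False A B C (B \<union> C)"
    proof (cases "A = B \<or> A = C")
      case True
      then show ?thesis using face_trivial[of A B] face_trivial[of A C] assms
          le1_subset[OF assms(4)] le1_subset[OF assms(5)] by (auto simp: Un_absorb1 Un_absorb2)
    next
      case F2: False
      then obtain x y where xy: "x \<notin> A" "B = insert x A" "y \<notin> A" "C = insert y A" using assms by (auto simp: le1_def)
      then show ?thesis by (intro face_unionI[of _ _ _ x y]) (use assms False in auto)
    qed
    then show ?thesis using F by auto
  qed
qed

definition colstep :: "bool \<Rightarrow> cell set \<Rightarrow> cell set \<Rightarrow> cell set \<Rightarrow> cell set" where
  "colstep c A B C = (SOME D. colface c A B C D)"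

lemma colface_colstep:
  assumes "dset A" "dset B" "dset C" "le1 A B" "le1 A C" "c \<Longrightarrow> B = A \<and> C = A"
  shows "colface c A B C (colstep c A B C)"
  unfolding colstep_def using colface_exists[OF assms] by (rule someI_ex)

text \<open>\<open>wsh X p s a b\<close> is the shape of the crosses of \<open>X\<close> in the columns \<open>p, \<dots>, p + a - 1\<close> and rows
  \<open>s, \<dots>, s + b - 1\<close>, computed by a growth diagram started at the corner \<open>(p, s)\<close>; \<open>sh X p q s t\<close> below
  is the same for the columns \<open>[p, q)\<close> and rows \<open>[s, t)\<close>.\<close>

fun wsh :: "(nat \<Rightarrow> nat \<Rightarrow> bool) \<Rightarrow> nat \<Rightarrow> nat \<Rightarrow> nat \<Rightarrow> nat \<Rightarrow> cell set" where
  "wsh X p s 0 b = {}"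
| "wsh X p s (Suc a) 0 = {}"
| "wsh X p s (Suc a) (Suc b) =
     colstep (X (p + a) (s + b)) (wsh X p s a b) (wsh X p s a (Suc b)) (wsh X p s (Suc a) b)"

lemma wsh_0 [simp]: "wsh X p s a 0 = {}" by (cases a) auto

definition pperm :: "(nat \<Rightarrow> nat \<Rightarrow> bool) \<Rightarrow> bool" where
  "pperm X \<longleftrightarrow> (\<forall>i i' j. X i j \<longrightarrow> X i' j \<longrightarrow> i = i') \<and> (\<forall>i j j'. X i j \<longrightarrow> X i j' \<longrightarrow> j = j')"

text \<open>A cross is admissible only where both middle corners agree with the lower one. Since a
  row and a column have no second cross, this follows from the invariance of shapes along empty
  stretches, which must therefore be proved together with the well-formedness of the diagram: the
  row statements by induction on \<open>a\<close> for all \<open>b\<close>, the column statements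
  for fixed \<open>a\<close> by induction on \<open>b\<close>.\<close>

lemma wsh_aux:
  assumes X: "pperm X"
  shows "\<forall>b. dset (wsh X p s a b) \<and> le1 (wsh X p s a b) (wsh X p s a (Suc b))
    \<and> ((\<forall>i<a. \<not> X (p + i) (s + b)) \<longrightarrow> wsh X p s a (Suc b) = wsh X p s a b)
    \<and> le1 (wsh X p s a b) (wsh X p s (Suc a) b)
    \<and> ((\<forall>j<b. \<not> X (p + a) (s + j)) \<longrightarrow> wsh X p s (Suc a) b = wsh X p s a b)
    \<and> colface (X (p + a) (s + b)) (wsh X p s a b) (wsh X p s a (Suc b)) (wsh X p s (Suc a) b) (wsh X p s (Suc a) (Suc b))"
proof -
  let ?L = "wsh X p s"
  let ?R = "\<lambda>a b. dset (?L a b) \<and> le1 (?L a b) (?L a (Suc b)) \<and> ((\<forall>i<a. \<not> X (p + i) (s + b)) \<longrightarrow> ?L a (Suc b) = ?L a b)"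
  let ?C = "\<lambda>a b. dset (?L (Suc a) b) \<and> le1 (?L a b) (?L (Suc a) b) \<and> ((\<forall>j<b. \<not> X (p + a) (s + j)) \<longrightarrow> ?L (Suc a) b = ?L a b)"
  let ?F = "\<lambda>a b. colface (X (p + a) (s + b)) (?L a b) (?L a (Suc b)) (?L (Suc a) b) (?L (Suc a) (Suc b))"
  have F: "?F a b" if r: "\<forall>b. ?R a b" and c: "?C a b" for a b
  proof -
    have "X (p + a) (s + b) \<Longrightarrow> ?L a (Suc b) = ?L a b \<and> ?L (Suc a) b = ?L a b"
      using r c X unfolding pperm_def by (metis add_left_cancel less_irrefl)
    then show ?thesis unfolding wsh.simps(3) by (intro colface_colstep) (use r c in auto)
  qed
  have C: "?C a b" if r: "\<forall>b. ?R a b" for a b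
  proof (induction b)
    case 0 then show ?case by simp
  next
    case (Suc b)
    have f: "?F a b" using F[OF r Suc] .
    have "?L (Suc a) (Suc b) = ?L a (Suc b)" if n: "\<forall>j<Suc b. \<not> X (p + a) (s + j)"
    proof -
      have "\<not> X (p + a) (s + b)" "?L (Suc a) b = ?L a b" using n Suc by auto
      then show ?thesis using f face_degenerate(2) by (metis (mono_tags, lifting))
    qed
    then show ?case using face_dset(4)[OF f] face_le1(1)[OF f] by blast
  qed
  have R: "\<forall>b. ?R a b"
  proof (induction a)
    case 0 then show ?case by simp
  next
    case (Suc a)
    show ?case
    proof
      fix b
      have f: "?F a b" using F[OF Suc C[OF Suc]] .
      have "?L (Suc a) (Suc b) = ?L (Suc a) b" if n: "\<forall>i<Suc a. \<not> X (p + i) (s + b)"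
      proof -
        have "\<not> X (p + a) (s + b)" "?L a (Suc b) = ?L a b" using n Suc by auto
        then show ?thesis using f face_degenerate(1) by (metis (mono_tags, lifting))
      qed
      then show "?R (Suc a) b" using face_dset(3)[OF f] face_le1(2)[OF f] by blast
    qed
  qed
  show ?thesis using R C[OF R] F[OF R C[OF R]] by blast
qed

lemma
  assumes "pperm X"
  shows wsh_dset: "dset (wsh X p s a b)"
    and wsh_colface: "colface (X (p + a) (s + b)) (wsh X p s a b) (wsh X p s a (Suc b)) (wsh X p s (Suc a) b) (wsh X p s (Suc a) (Suc b))"
    and wsh_row_empty: "(\<And>i. i < a \<Longrightarrow> \<not> X (p + i) (s + b)) \<Longrightarrow> wsh X p s a (Suc b) = wsh X p s a b"
    and wsh_col_empty: "(\<And>j. j < b \<Longrightarrow> \<not> X (p + a) (s + j)) \<Longrightarrow> wsh X p s (Suc a) b = wsh X p s a b"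
  using wsh_aux[OF assms, of p s a] by blast+

lemma wsh_unique:
  assumes X: "pperm X" and "\<And>b. g 0 b = {}" "\<And>a. g a 0 = {}"
    and f: "\<And>a b. a < m \<Longrightarrow> b < n \<Longrightarrow> colface (X (p + a) (s + b)) (g a b) (g a (Suc b)) (g (Suc a) b) (g (Suc a) (Suc b))"
  shows "a \<le> m \<Longrightarrow> b \<le> n \<Longrightarrow> g a b = wsh X p s a b"
proof (induction a arbitrary: b)
  case 0 then show ?case using assms by simp
next
  case (Suc a)
  from \<open>b \<le> n\<close> show ?case
  proof (induction b)
    case 0 then show ?case using assms by simp
  next
    case (Suc b)
    then show ?case
      using f[of a b] \<open>Suc a \<le> m\<close> Suc.IH Suc.prems \<open>\<And>b. \<lbrakk>a \<le> m; b \<le> n\<rbrakk> \<Longrightarrow> g a b = wsh X p s a b\<close>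
        wsh_colface[OF X, of p a s b] colface_unique by (metis Suc_leD Suc_le_eq)
  qed
qed

text \<open>The diagrams with and without the leftmost column are the two layers of a stack of
  cubes, whose inner faces are propagated from the sides \<open>a = 0\<close> and
  \<open>b = 0\<close>.\<close>

lemma wsh_left:
  assumes X: "pperm X"
  shows "jdtface (wsh X (Suc p) s a b) (wsh X p s (Suc a) b) (wsh X (Suc p) s (Suc a) b) (wsh X p s (Suc (Suc a)) b)
    \<and> rowface (X p (s + b)) (wsh X (Suc p) s a b) (wsh X p s (Suc a) b) (wsh X (Suc p) s a (Suc b)) (wsh X p s (Suc a) (Suc b))"
proof -
  let ?A = "\<lambda>a b. wsh X (Suc p) s a b"
  let ?B = "\<lambda>a b. wsh X p s (Suc a) b"
  let ?J = "\<lambda>a b. jdtface (?A a b) (?B a b) (?A (Suc a) b) (?B (Suc a) b)"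
  let ?R = "\<lambda>a b. rowface (X p (s + b)) (?A a b) (?B a b) (?A a (Suc b)) (?B a (Suc b))"
  \<comment> \<open>Here the new column stands alone; its shape is empty until its cross is met,
    which creates the cell at the origin, in row 0 as well as in column 0.\<close>
  have base: "?R 0 b" for b
  proof (cases "X p (s + b)")
    case True
    have "colface True {} {} (?B 0 b) (?B 0 (Suc b))" using wsh_colface[OF X, of p 0 s b] True by simp
    then obtain y where y: "?B 0 b = {}" "?B 0 (Suc b) = {y}" by (auto simp: face_def simp del: wsh.simps(3))
    have "dset {y}" using wsh_dset[OF X, of p s "Suc 0" "Suc b"] y by simp
    then have "fst y = 0" using dsetD[of "{y}" "fst y" "snd y" 0 0] by auto
    then show ?thesis using y True \<open>dset {y}\<close> by (auto simp: face_def simp del: wsh.simps(3))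
  next
    case False
    have f: "colface False {} {} (?B 0 b) (?B 0 (Suc b))" using wsh_colface[OF X, of p 0 s b] False by simp
    then have "?B 0 (Suc b) = ?B 0 b" using face_degenerate(1) by blast
    then show ?thesis using False face_trivial(2)[of "{}" "?B 0 b"] face_dset[OF f] by (simp del: wsh.simps(3))
  qed
  have step: "?J a (Suc b) \<and> ?R (Suc a) b" if "?J a b" "?R a b" for a b
  proof (rule cube)
    show "colface (X (Suc p + a) (s + b)) (?A a b) (?A a (Suc b)) (?A (Suc a) b) (?A (Suc a) (Suc b))"
      using wsh_colface[OF X] by blast
    show "colface (X (Suc p + a) (s + b)) (?B a b) (?B a (Suc b)) (?B (Suc a) b) (?B (Suc a) (Suc b))"
      using wsh_colface[OF X, of p "Suc a" s b] by simp
    show "\<not> (X (Suc p + a) (s + b) \<and> X p (s + b))"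
      using X unfolding pperm_def by (metis add_Suc less_add_Suc1 less_irrefl)
  qed (use that in blast)+
  have "(\<forall>a. ?J a b) \<and> (\<forall>a. ?R a b)" for b
  proof (induction b)
    case 0
    have J: "?J a 0" for a by (simp add: face_def)
    have "?R a 0" for a by (induction a) (use base step J in blast)+
    then show ?case using J by blast
  next
    case (Suc b)
    have J: "?J a (Suc b)" for a using step Suc by blast
    have "?R a (Suc b)" for a by (induction a) (use base step J in blast)+
    then show ?case using J by blast
  qed
  then show ?thesis by blast
qed

section \<open>Transposition and reflection of the matrix\<close>

definition tr :: "cell set \<Rightarrow> cell set" where
  "tr D = {(i, j). (j, i) \<in> D}"

lemma mem_tr [simp]: "(i, j) \<in> tr D \<longleftrightarrow> (j, i) \<in> D" by (simp add: tr_def)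

lemma mem_tr_swap: "x \<in> tr D \<longleftrightarrow> prod.swap x \<in> D" by (cases x) simp

lemma tr_tr [simp]: "tr (tr D) = D" by (auto simp: tr_def)

lemma tr_empty [simp]: "tr {} = {}" by (auto simp: tr_def)

lemma tr_inject [simp]: "tr D = tr E \<longleftrightarrow> D = E" by (metis tr_tr)

lemma tr_insert: "tr (insert x D) = insert (prod.swap x) (tr D)" by (cases x) (auto simp: tr_def)

lemma dset_tr [simp]: "dset (tr D) \<longleftrightarrow> dset D"
proof -
  have "dset (tr D)" if "dset D" for D
  proof -
    have "tr D = prod.swap ` D" by (auto simp: tr_def image_iff split: prod.splits) force
    then have "finite (tr D)" using dset_finite[OF that] by simp
    then show ?thesis using dsetD[OF that] unfolding dset_def by auto
  qed
  from this this[of "tr D"] show ?thesis by auto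
qed

lemma le1_tr [simp]: "le1 (tr A) (tr B) \<longleftrightarrow> le1 A B"
proof -
  have "le1 (tr A) (tr B)" if "le1 A B" for A B
    using that unfolding le1_def by (metis tr_insert mem_tr_swap swap_swap)
  from this this[of "tr A" "tr B"] show ?thesis by auto
qed

lemma face_tr:
  assumes "face c rel init A B C D"
  shows "face c (\<lambda>x y. rel (prod.swap x) (prod.swap y)) (\<lambda>y. init (prod.swap y)) (tr A) (tr B) (tr C) (tr D)"
proof (cases c)
  case True
  then obtain y where y: "B = A" "C = A" "y \<notin> A" "D = insert y A" "init y" using assms by (auto simp: face_def)
  have "face True (\<lambda>x y. rel (prod.swap x) (prod.swap y)) (\<lambda>y. init (prod.swap y)) (tr A) (tr A) (tr A) (insert (prod.swap y) (tr A))"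
    by (rule face_cross) (use face_dset[OF assms] y in \<open>simp_all add: mem_tr_swap flip: tr_insert\<close>)
  then show ?thesis using y(1,2,4) True by (simp add: tr_insert)
next
  case F: False
  then have f: "face False rel init A B C D" using assms by simp
  note d = face_dset[OF assms] face_le1[OF assms]
  show ?thesis using f
  proof (cases rule: face_cases)
    case left
    then show ?thesis using F face_trivial(1)[of "tr A" "tr C"] d by simp
  next
    case right
    then show ?thesis using F face_trivial(2)[of "tr A" "tr B"] d by simp
  next
    case (union x y)
    have "face False rel init (tr A) (tr B) (tr C) (tr D)" for rel init
    proof (rule face_unionI[of _ _ _ "prod.swap x" "prod.swap y"])
      show "prod.swap x \<notin> tr A" "prod.swap y \<notin> tr A" using union(2,3) by (simp_all add: mem_tr_swap)
      show "tr B = insert (prod.swap x) (tr A)" using union(4) by (simp add: tr_insert)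
      show "tr C = insert (prod.swap y) (tr A)" using union(5) by (simp add: tr_insert)
      show "tr D = insert (prod.swap x) (insert (prod.swap y) (tr A))" using union(6) by (simp add: tr_insert)
      show "prod.swap x \<noteq> prod.swap y" using union(1) by (metis swap_swap)
    qed (use d(1-3) in simp_all)
    then show ?thesis using F by simp
  next
    case (chain x y)
    have "face False (\<lambda>x y. rel (prod.swap x) (prod.swap y)) (\<lambda>y. init (prod.swap y)) (tr A) (tr B) (tr C) (tr D)"
    proof (rule face_chainI[of _ _ _ "prod.swap x" "prod.swap y"])
      show "prod.swap x \<notin> tr A" "prod.swap y \<notin> tr B" using chain by (simp_all add: mem_tr_swap)
      show "tr B = insert (prod.swap x) (tr A)" using chain(2) by (simp add: tr_insert)
      show "tr D = insert (prod.swap y) (tr B)" using chain(5) by (simp add: tr_insert)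
    qed (use d(1,2,4) chain(3,6) in simp_all)
    then show ?thesis using F by simp
  qed
qed

lemma rowface_tr: "rowface c A B C D \<Longrightarrow> colface c (tr A) (tr B) (tr C) (tr D)"
  by (drule face_tr) simp

lemma wsh_transpose:
  assumes "pperm X" shows "wsh X p s a b = wsh (\<lambda>i j. X j i) s p b a"
proof -
  have X': "pperm (\<lambda>i j. X j i)" using assms unfolding pperm_def by blast
  have "wsh (\<lambda>i j. X j i) s p b a = wsh X p s a b"
  proof (rule wsh_unique[OF assms, where m = a and n = b])
    fix a b
    show "colface (X (p + a) (s + b)) (wsh (\<lambda>i j. X j i) s p b a) (wsh (\<lambda>i j. X j i) s p (Suc b) a)
      (wsh (\<lambda>i j. X j i) s p b (Suc a)) (wsh (\<lambda>i j. X j i) s p (Suc b) (Suc a))"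
      using face_commuteI[OF wsh_colface[OF X', where p = s and a = b and s = p and b = a]] .
  qed simp_all
  then show ?thesis by simp
qed

definition mirror :: "nat \<Rightarrow> (nat \<Rightarrow> nat \<Rightarrow> bool) \<Rightarrow> nat \<Rightarrow> nat \<Rightarrow> bool" where
  "mirror m X = (\<lambda>i j. i < m \<and> X (m - Suc i) j)"

lemma pperm_mirror: assumes "pperm X" shows "pperm (mirror m X)"
proof -
  have "i = i'" if "X (m - Suc i) j" "X (m - Suc i') j" "i < m" "i' < m" for i i' j
  proof -
    have "m - Suc i = m - Suc i'" using assms that unfolding pperm_def by blast
    then show ?thesis using that by linarith
  qed
  moreover have "j = j'" if "X i j" "X i j'" for i j j' using assms that unfolding pperm_def by blast
  ultimately show ?thesis unfolding pperm_def mirror_def by blast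
qed

text \<open>Growing the reflected window to the right means growing the original one to the left,
  where the rule is \<open>rowface\<close>. Transposition makes it \<open>colface\<close>, and the
  growth diagram of the reflected matrix is unique.\<close>

lemma wsh_mirror:
  assumes X: "pperm X" and pa: "p + a \<le> m"
  shows "wsh (mirror m X) p s a b = tr (wsh X (m - p - a) s a b)"
proof -
  have "tr (wsh X (m - p - a) s a b) = wsh (mirror m X) p s a b"
  proof (rule wsh_unique[OF pperm_mirror[OF X], where m = "m - p" and n = b])
    fix a b assume a: "a < m - p"
    define p' where "p' = m - p - Suc a"
    have p': "m - p - a = Suc p'" using a unfolding p'_def by simp
    have m: "mirror m X (p + a) (s + b) = X p' (s + b)" using a unfolding mirror_def p'_def
      by (simp add: less_diff_conv add.commute)
    show "colface (mirror m X (p + a) (s + b)) (tr (wsh X (m - p - a) s a b)) (tr (wsh X (m - p - a) s a (Suc b)))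
      (tr (wsh X (m - p - Suc a) s (Suc a) b)) (tr (wsh X (m - p - Suc a) s (Suc a) (Suc b)))"
      unfolding m p' p'_def[symmetric]
      using rowface_tr[OF wsh_left[OF X, of p' s a b, THEN conjunct2]] face_commute by blast
  qed (use pa in auto)
  then show ?thesis by simp
qed

section \<open>Windows with four movable sides\<close>

definition sh :: "(nat \<Rightarrow> nat \<Rightarrow> bool) \<Rightarrow> nat \<Rightarrow> nat \<Rightarrow> nat \<Rightarrow> nat \<Rightarrow> cell set" where
  "sh X p q s t = wsh X p s (q - p) (t - s)"

lemma sh_empty_cols [simp]: "q \<le> p \<Longrightarrow> sh X p q s t = {}" by (simp add: sh_def)
lemma sh_empty_rows [simp]: "t \<le> s \<Longrightarrow> sh X p q s t = {}" by (simp add: sh_def)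

lemma pperm_transpose: "pperm X \<Longrightarrow> pperm (\<lambda>i j. X j i)" unfolding pperm_def by blast

lemma sh_transpose: "pperm X \<Longrightarrow> sh X p q s t = sh (\<lambda>i j. X j i) s t p q"
  unfolding sh_def by (rule wsh_transpose)

lemma sh_mirror:
  assumes "pperm X" "q \<le> m"
  shows "sh (mirror m X) (m - q) (m - p) s t = tr (sh X p q s t)"
proof (cases "p \<le> q")
  case True
  have "m - (m - q) - (q - p) = p" "m - p - (m - q) = q - p" using True assms by auto
  then show ?thesis unfolding sh_def using wsh_mirror[OF assms(1), of "m - q" "q - p" m s "t - s"] assms True by simp
qed auto

context
  fixes X :: "nat \<Rightarrow> nat \<Rightarrow> bool"
  assumes X: "pperm X"
begin

lemma sh_dset [simp]: "dset (sh X p q s t)" unfolding sh_def by (rule wsh_dset[OF X])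

text \<open>The suffixes of this lemma and its companions name the two sides that move; for the
  lower bounds \<open>p\<close> and \<open>s\<close> the larger shape belongs to the smaller
  value.\<close>

lemma sh_col_qt:
  "p \<le> q \<Longrightarrow> s \<le> t \<Longrightarrow>
    colface (X q t) (sh X p q s t) (sh X p q s (Suc t)) (sh X p (Suc q) s t) (sh X p (Suc q) s (Suc t))"
  using wsh_colface[OF X, of p "q - p" s "t - s"] unfolding sh_def by (simp add: Suc_diff_le)

lemma sh_jdt_pq:
  assumes "p < q"
  shows "jdtface (sh X (Suc p) q s t) (sh X p q s t) (sh X (Suc p) (Suc q) s t) (sh X p (Suc q) s t)"
proof -
  obtain a where "q = Suc (p + a)" using assms less_iff_Suc_add by auto
  then show ?thesis using wsh_left[OF X, of p s a "t - s"] unfolding sh_def by (simp add: Suc_diff_le)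
qed

lemma sh_row_pt:
  assumes "p < q" "s \<le> t"
  shows "rowface (X p t) (sh X (Suc p) q s t) (sh X p q s t) (sh X (Suc p) q s (Suc t)) (sh X p q s (Suc t))"
proof -
  obtain a where "q = Suc (p + a)" using assms less_iff_Suc_add by auto
  then show ?thesis using wsh_left[OF X, of p s a "t - s"] assms(2) unfolding sh_def by (simp add: Suc_diff_le)
qed

lemma sh_row_empty_upper:
  "s \<le> t \<Longrightarrow> (\<And>i. p \<le> i \<Longrightarrow> i < q \<Longrightarrow> \<not> X i t) \<Longrightarrow> sh X p q s (Suc t) = sh X p q s t"
  using wsh_row_empty[OF X, of "q - p" p s "t - s"] unfolding sh_def by (simp add: Suc_diff_le)

lemma sh_col_empty_upper:
  "p \<le> q \<Longrightarrow> (\<And>j. s \<le> j \<Longrightarrow> j < t \<Longrightarrow> \<not> X q j) \<Longrightarrow> sh X p (Suc q) s t = sh X p q s t"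
  using wsh_col_empty[OF X, of "t - s" p "q - p" s] unfolding sh_def by (simp add: Suc_diff_le)

end

lemma sh_mirror':
  assumes "pperm X" "q \<le> m"
  shows "sh X p q s t = tr (sh (mirror m X) (m - q) (m - p) s t)"
  using sh_mirror[OF assms] by simp

lemma sh_jdt_st:
  assumes "pperm X" "s < t"
  shows "jdtface (sh X p q (Suc s) t) (sh X p q s t) (sh X p q (Suc s) (Suc t)) (sh X p q s (Suc t))"
  using sh_jdt_pq[OF pperm_transpose[OF assms(1)] assms(2)] unfolding sh_transpose[OF assms(1), symmetric] .

lemma sh_row_qs:
  assumes "pperm X" "s < t" "p \<le> q"
  shows "rowface (X q s) (sh X p q (Suc s) t) (sh X p q s t) (sh X p (Suc q) (Suc s) t) (sh X p (Suc q) s t)"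
  using sh_row_pt[OF pperm_transpose[OF assms(1)] assms(2,3)] unfolding sh_transpose[OF assms(1), symmetric] .

text \<open>Reflection exchanges the roles of \<open>p\<close> and \<open>q\<close>, so this square
  is the transpose of the one in \<open>sh_row_qs\<close>.\<close>

lemma sh_col_ps:
  assumes X: "pperm X" and "s < t" "p < q"
  shows "colface (X p s) (sh X (Suc p) q (Suc s) t) (sh X p q (Suc s) t) (sh X (Suc p) q s t) (sh X p q s t)"
proof -
  let ?Y = "mirror q X"
  have *: "sh X p q s t = tr (sh ?Y 0 (q - p) s t)" for p s
    using sh_mirror'[OF X, of q q p s t] by simp
  have e: "q - p = Suc (q - Suc p)" "?Y (q - Suc p) s = X p s" using assms by (simp_all add: mirror_def)
  have r: "rowface (X p s) (sh ?Y 0 (q - Suc p) (Suc s) t) (sh ?Y 0 (q - Suc p) s t) (sh ?Y 0 (q - p) (Suc s) t) (sh ?Y 0 (q - p) s t)"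
    using sh_row_qs[OF pperm_mirror[OF X] assms(2), of 0 "q - Suc p" q] e by simp
  show ?thesis unfolding * by (rule face_commuteI[OF rowface_tr[OF r]])
qed

lemma sh_col_empty_lower:
  assumes X: "pperm X" and "p < q" "\<And>j. s \<le> j \<Longrightarrow> j < t \<Longrightarrow> \<not> X p j"
  shows "sh X p q s t = sh X (Suc p) q s t"
proof -
  let ?Y = "mirror q X"
  have *: "sh X p q s t = tr (sh ?Y 0 (q - p) s t)" for p
    using sh_mirror'[OF X, of q q p s t] by simp
  have e: "q - p = Suc (q - Suc p)" "\<And>j. ?Y (q - Suc p) j = X p j" using assms by (simp_all add: mirror_def)
  show ?thesis unfolding * e(1)
    using sh_col_empty_upper[OF pperm_mirror[OF X], of 0 "q - Suc p" s t q] assms e(2) by simp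
qed

lemma sh_row_empty_lower:
  assumes X: "pperm X" and "s < t" "\<And>i. p \<le> i \<Longrightarrow> i < q \<Longrightarrow> \<not> X i s"
  shows "sh X p q s t = sh X p q (Suc s) t"
  using sh_col_empty_lower[OF pperm_transpose[OF X] assms(2)] assms(3)
  unfolding sh_transpose[OF X, symmetric] by blast

text \<open>The rotation is composed of a reflection of the columns and one of the rows, whose
  transpositions cancel.\<close>

lemma sh_rotate:
  assumes X: "pperm X" and "q \<le> m" "t \<le> h"
    and Y: "\<And>i j. i < m \<Longrightarrow> j < h \<Longrightarrow> Y i j = X (m - Suc i) (h - Suc j)" "\<And>i j. Y i j \<Longrightarrow> i < m \<and> j < h"
  shows "sh Y (m - q) (m - p) (h - t) (h - s) = sh X p q s t"
proof -
  let ?M = "mirror m X"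
  let ?N = "mirror h (\<lambda>i j. ?M j i)"
  have M: "pperm ?M" by (rule pperm_mirror[OF X])
  have N: "pperm ?N" by (rule pperm_mirror[OF pperm_transpose[OF M]])
  have "Y i j = ?N j i" for i j
    using Y(1)[of i j] Y(2)[of i j] unfolding mirror_def by blast
  then have "Y = (\<lambda>i j. ?N j i)" by blast
  then have "sh Y (m - q) (m - p) (h - t) (h - s) = sh ?N (h - t) (h - s) (m - q) (m - p)"
    using sh_transpose[OF N] by simp
  also have "\<dots> = tr (sh (\<lambda>i j. ?M j i) s t (m - q) (m - p))"
    by (rule sh_mirror[OF pperm_transpose[OF M] assms(3)])
  also have "\<dots> = tr (sh ?M (m - q) (m - p) s t)" by (simp add: sh_transpose[OF M])
  also have "\<dots> = sh X p q s t" by (simp add: sh_mirror[OF X assms(2)])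
  finally show ?thesis .
qed

section \<open>Reading words of tableaux\<close>

definition rl :: "cell set \<Rightarrow> parts" where
  "rl D = (\<lambda>i. card {j. (i, j) \<in> D})"

lemma downset_nat:
  assumes "finite S" "\<And>i j. j \<in> S \<Longrightarrow> i \<le> j \<Longrightarrow> i \<in> S"
  shows "(k::nat) \<in> S \<longleftrightarrow> k < card S"
proof -
  define n where "n = (LEAST n. n \<notin> S)"
  have "\<exists>n. n \<notin> S" using assms(1) ex_new_if_finite infinite_UNIV_nat by blast
  then have n: "n \<notin> S" unfolding n_def by (rule LeastI_ex)
  have "S = {..<n}"
  proof
    show "S \<subseteq> {..<n}" using n assms(2) by (metis lessThan_iff not_le subsetI)
    show "{..<n} \<subseteq> S" using not_less_Least unfolding n_def by blast
  qed
  then show ?thesis by simp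
qed

lemma mem_dset: assumes "dset D" shows "(i, j) \<in> D \<longleftrightarrow> j < rl D i"
proof -
  have "finite {j. (i, j) \<in> D}"
    by (rule finite_subset[of _ "snd ` D"]) (use dset_finite[OF assms] in force)+
  then show ?thesis using downset_nat[of "{j. (i, j) \<in> D}" j] dsetD[OF assms] unfolding rl_def by blast
qed

lemma mem_ferrers: "(i, j) \<in> ferrers p \<longleftrightarrow> j < p i" by (simp add: ferrers_def)

lemma ferrers_rl: "dset D \<Longrightarrow> ferrers (rl D) = D"
  by (auto simp: mem_dset mem_ferrers)

lemma rl_ferrers [simp]: "rl (ferrers p) = p"
  by (auto simp: rl_def mem_ferrers)

lemma is_partition_rl: assumes "dset D" shows "is_partition (rl D)"
proof -
  have "antimono (rl D)"
  proof (rule antimonoI)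
    fix i j :: nat assume "i \<le> j"
    show "rl D j \<le> rl D i"
    proof (rule ccontr)
      assume "\<not> ?thesis"
      then have "(j, rl D i) \<in> D" using mem_dset[OF assms] by simp
      then have "(i, rl D i) \<in> D" using dsetD[OF assms] \<open>i \<le> j\<close> by blast
      then show False using mem_dset[OF assms] by blast
    qed
  qed
  moreover have "{i. rl D i \<noteq> 0} \<subseteq> fst ` D"
    using mem_dset[OF assms] by (force simp: image_iff)
  ultimately show ?thesis unfolding is_partition_def using dset_finite[OF assms] finite_subset by blast
qed

lemma dset_ferrers: assumes "is_partition p" shows "dset (ferrers p)"
  unfolding dset_def
proof (intro conjI allI impI)
  have "ferrers p \<subseteq> (SIGMA i : {i. p i \<noteq> 0}. {..<p i})" by (auto simp: ferrers_def)
  then show "finite (ferrers p)" using assms unfolding is_partition_def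
    by (metis (no_types, lifting) finite_SigmaI finite_lessThan finite_subset)
  fix i j i' j' assume a: "(i, j) \<in> ferrers p" "i' \<le> i" "j' \<le> j"
  then have "p i \<le> p i'" using assms unfolding is_partition_def by (simp add: antimonoD)
  then show "(i', j') \<in> ferrers p" using a by (simp add: mem_ferrers)
qed

lemma is_ferrers_iff: "is_ferrers D \<longleftrightarrow> dset D"
  unfolding is_ferrers_def using dset_ferrers is_partition_rl ferrers_rl by metis

lemma insert_ferrers: "insert (i, f i) (ferrers f) = ferrers (f(i := Suc (f i)))"
  by (auto simp: ferrers_def split: if_splits)

lemma not_mem_ferrers: "(i, f i) \<notin> ferrers f" by (simp add: ferrers_def)

lemma rl_insert:
  assumes "dset D" "dset (insert (i, j) D)" "(i, j) \<notin> D"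
  shows "rl (insert (i, j) D) = (rl D)(i := Suc (rl D i))" "rl D i = j"
proof -
  have "rl D i \<le> j" using assms(1,3) by (simp add: mem_dset)
  moreover have "\<not> rl D i < j"
  proof
    assume "rl D i < j"
    then have "(i, rl D i) \<in> D" using dsetD[OF assms(2), of i j i "rl D i"] by auto
    then show False using mem_dset[OF assms(1)] by blast
  qed
  ultimately show j: "rl D i = j" by simp
  have "insert (i, j) D = ferrers ((rl D)(i := Suc (rl D i)))"
    using insert_ferrers[of i "rl D"] j ferrers_rl[OF assms(1)] by simp
  then show "rl (insert (i, j) D) = (rl D)(i := Suc (rl D i))" by simp
qed

section \<open>Tableaux and their reading words\<close>

definition cells_le :: "filling \<Rightarrow> nat \<Rightarrow> cell set" where
  "cells_le T v = {c. \<exists>x\<le>v. T c = Some x}"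

definition entries_ok :: "filling \<Rightarrow> bool" where
  "entries_ok T \<longleftrightarrow> (\<forall>c c' x. T c = Some x \<longrightarrow> T c' = Some x \<longrightarrow> c = c') \<and> (\<forall>c. T c \<noteq> Some 0)"

definition tableau :: "filling \<Rightarrow> bool" where
  "tableau T \<longleftrightarrow> entries_ok T \<and> (\<forall>v. dset (cells_le T v))"

definition box :: "nat \<Rightarrow> cell set" where "box n = {..<n} \<times> {..<n}"

text \<open>All cells of the box are numbered, filled or not. Thus positions do not depend on the
  filling, and unfilled cells merely give empty rows of the matrix \<open>reading n T\<close>, whose
  columns are the entries minus one.\<close>

definition pos :: "nat \<Rightarrow> cell \<Rightarrow> nat" where
  "pos n c = (n - Suc (snd c)) * n + fst c"

definition reading :: "nat \<Rightarrow> filling \<Rightarrow> nat \<Rightarrow> nat \<Rightarrow> bool" where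
  "reading n T = (\<lambda>k y. \<exists>c. T c = Some (Suc k) \<and> pos n c = y)"

lemma cells_le_0: "entries_ok T \<Longrightarrow> cells_le T 0 = {}" by (auto simp: cells_le_def entries_ok_def)

lemma cells_le_dom: "cells_le T v \<subseteq> dom T" by (auto simp: cells_le_def)

lemma cells_le_Suc: "cells_le T (Suc v) = cells_le T v \<union> {c. T c = Some (Suc v)}"
  by (auto simp: cells_le_def le_Suc_eq)

lemma pos_inv:
  assumes "c \<in> box n" shows "pos n c mod n = fst c" "n - Suc (pos n c div n) = snd c" "pos n c < n * n"
proof -
  obtain i j where c: "c = (i, j)" "i < n" "j < n" using assms by (cases c) (auto simp: box_def)
  show "pos n c mod n = fst c" using c by (simp add: pos_def)
  have "pos n c div n = n - Suc j" using c by (simp add: pos_def)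
  then show "n - Suc (pos n c div n) = snd c" using c by simp
  have "pos n c < Suc (n - Suc j) * n" using c by (simp add: pos_def)
  also have "\<dots> \<le> n * n" using c by (intro mult_right_mono) auto
  finally show "pos n c < n * n" .
qed

lemma pos_inj: "c \<in> box n \<Longrightarrow> c' \<in> box n \<Longrightarrow> pos n c = pos n c' \<Longrightarrow> c = c'"
  using pos_inv(1,2) by (metis prod_eq_iff)

lemma pos_eq_iff:
  assumes "y < n * n" "c \<in> box n"
  shows "pos n c = y \<longleftrightarrow> c = (y mod n, n - Suc (y div n))"
proof
  show "c = (y mod n, n - Suc (y div n))" if "pos n c = y" using pos_inv[OF assms(2)] that by (metis prod.collapse)
  assume c: "c = (y mod n, n - Suc (y div n))"
  have "y div n < n" using assms(1) by (simp add: less_mult_imp_div_less)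
  then show "pos n c = y" using c by (simp add: pos_def)
qed

lemma pperm_reading:
  assumes "entries_ok T" "dom T \<subseteq> box n" shows "pperm (reading n T)"
  unfolding pperm_def reading_def
proof (intro conjI allI impI)
  fix i i' j assume "\<exists>c. T c = Some (Suc i) \<and> pos n c = j" "\<exists>c. T c = Some (Suc i') \<and> pos n c = j"
  then obtain c c' where c: "T c = Some (Suc i)" "pos n c = j" "T c' = Some (Suc i')" "pos n c' = j" by blast
  then have "c \<in> box n" "c' \<in> box n" using assms(2) by auto
  then have "c = c'" using pos_inj[of c n c'] c by simp
  then show "i = i'" using c by simp
next
  fix i j j' assume "\<exists>c. T c = Some (Suc i) \<and> pos n c = j" "\<exists>c. T c = Some (Suc i) \<and> pos n c = j'"
  then show "j = j'" using assms(1) unfolding entries_ok_def by metis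
qed

text \<open>The first \<open>b\<close> cells of the box in reading order (columns from right to left, each from top to
  bottom) are the cells \<open>(i, j)\<close> with \<open>row_start n b i \<le> j\<close>.\<close>

definition row_start :: "nat \<Rightarrow> nat \<Rightarrow> nat \<Rightarrow> nat" where
  "row_start n b i = (if i < b mod n then n - Suc (b div n) else n - b div n)"

lemma row_start_Suc:
  assumes "b < n * n" "i < n"
  shows "row_start n (Suc b) i = (if i = b mod n then n - Suc (b div n) else row_start n b i)"
    "row_start n b (b mod n) = Suc (n - Suc (b div n))"
proof -
  have bn: "b div n < n" using assms(1) by (simp add: less_mult_imp_div_less)
  then show "row_start n b (b mod n) = Suc (n - Suc (b div n))" by (simp add: row_start_def)
  have "0 < n" using assms(2) by simp
  then have m: "b mod n < n" by simp
  show "row_start n (Suc b) i = (if i = b mod n then n - Suc (b div n) else row_start n b i)"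
  proof (cases "Suc (b mod n) = n")
    case True
    then have "Suc b mod n = 0" "Suc b div n = Suc (b div n)"
      by (simp_all add: mod_Suc div_Suc)
    then show ?thesis using assms(2) True by (auto simp: row_start_def)
  next
    case False
    then have "Suc b mod n = Suc (b mod n)" "Suc b div n = b div n"
      using m by (simp_all add: mod_Suc div_Suc)
    then show ?thesis by (auto simp: row_start_def)
  qed
qed

lemma row_start_mono: "i \<le> i' \<Longrightarrow> row_start n b i \<le> row_start n b i'"
  by (auto simp: row_start_def)

text \<open>The whole growth diagram can be written down: its label at \<open>(a, b)\<close> arises
  from the cells with entry at most \<open>a\<close> among the first \<open>b\<close> cells in
  reading order by pushing every row to the left.\<close>

lemma sh_reading_tableau:
  assumes T: "tableau T" and box: "dom T \<subseteq> box n" and h: "n * n \<le> h"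
  shows "sh (reading n T) 0 q 0 h = cells_le T q"
proof -
  let ?X = "reading n T"
  have ok: "entries_ok T" and dU: "\<And>v. dset (cells_le T v)" using T by (auto simp: tableau_def)
  have X: "pperm ?X" by (rule pperm_reading[OF ok box])
  \<comment> \<open>The cells already read are the ends of the rows from column
    \<open>row_start n b i\<close> on, so pushing them to the left subtracts this number; truncated
    subtraction covers the rows that are too short. The result is a partition because
    \<open>row_start\<close> increases with the row.\<close>
  define f where "f a b = (\<lambda>i. rl (cells_le T a) i - row_start n b i)" for a b
  define g where "g a b = ferrers (f a b)" for a b
  have rl0: "rl (cells_le T a) i = 0" if "i \<ge> n" for a i
  proof -
    have "(i, j) \<notin> cells_le T a" for j
    proof
      assume "(i, j) \<in> cells_le T a"
      then have "(i, j) \<in> box n" using cells_le_dom[of T a] box by blast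
      then show False using that by (simp add: box_def)
    qed
    then have "{j. (i, j) \<in> cells_le T a} = {}" by simp
    then show ?thesis unfolding rl_def by (metis card.empty)
  qed
  have rln: "rl (cells_le T a) i \<le> n" for a i
  proof (rule ccontr)
    assume "\<not> ?thesis"
    then have "(i, n) \<in> cells_le T a" using mem_dset[OF dU] by simp
    then show False using cells_le_dom[of T a] box unfolding box_def by auto
  qed
  have part: "is_partition (f a b)" for a b
  proof -
    have p: "is_partition (rl (cells_le T a))" by (rule is_partition_rl[OF dU])
    then have "antimono (f a b)" unfolding f_def is_partition_def monotone_def
      using row_start_mono by (metis diff_le_mono diff_le_mono2 le_trans)
    moreover have "{i. f a b i \<noteq> 0} \<subseteq> {i. rl (cells_le T a) i \<noteq> 0}" unfolding f_def by auto
    ultimately show ?thesis using p unfolding is_partition_def using finite_subset by blast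
  qed
  have dg: "dset (g a b)" for a b unfolding g_def by (rule dset_ferrers[OF part])
  have le: "le1 (ferrers u) (ferrers (u(i := Suc (u i))))" for u i
    unfolding insert_ferrers[symmetric] by simp
  have face: "colface (?X a b) (g a b) (g a (Suc b)) (g (Suc a) b) (g (Suc a) (Suc b))" if b: "b < n * n" for a b
  proof -
    define k where "k = b mod n"
    define m where "m = n - Suc (b div n)"
    have n0: "n > 0" using b by (cases n) auto
    have k: "k < n" using n0 unfolding k_def by simp
    have st: "row_start n (Suc b) i = (if i = k then m else row_start n b i)" if "i < n" for i
      using row_start_Suc(1)[OF b that] unfolding k_def m_def .
    have stk: "row_start n b k = Suc m" using row_start_Suc(2)[OF b k] unfolding k_def m_def .
    have Xab: "?X a b \<longleftrightarrow> T (k, m) = Some (Suc a)"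
    proof -
      have "pos n c = b \<longleftrightarrow> c = (k, m)" if "T c = Some (Suc a)" for c
        using pos_eq_iff[OF b, of c] box that unfolding k_def m_def by auto
      then show ?thesis unfolding reading_def by auto
    qed
    have fb: "f a' (Suc b) = (if (k, m) \<in> cells_le T a' then (f a' b)(k := Suc (f a' b k)) else f a' b)" for a'
    proof
      fix i
      show "f a' (Suc b) i = (if (k, m) \<in> cells_le T a' then (f a' b)(k := Suc (f a' b k)) else f a' b) i"
      proof (cases "i < n")
        case True
        then show ?thesis using st[OF True] stk unfolding f_def by (simp add: mem_dset[OF dU] Suc_diff_Suc)
      next
        case False then show ?thesis using rl0[of i] k unfolding f_def by simp
      qed
    qed
    have nocross: "(k, m) \<in> cells_le T (Suc a) \<longleftrightarrow> (k, m) \<in> cells_le T a" if "\<not> ?X a b"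
      using that Xab unfolding cells_le_Suc by auto
    show ?thesis
    proof (cases "\<exists>z. T z = Some (Suc a)")
      case False
      then have e: "g (Suc a) = g a" unfolding g_def f_def cells_le_Suc by simp
      have "\<not> ?X a b" using False Xab by auto
      moreover have "le1 (g a b) (g a (Suc b))" unfolding g_def fb using le by simp
      ultimately show ?thesis unfolding e using face_trivial(2)[OF dg dg] by simp
    next
      case True
      then obtain zi zj where z: "T (zi, zj) = Some (Suc a)" by auto
      have U: "cells_le T (Suc a) = insert (zi, zj) (cells_le T a)" using z ok unfolding cells_le_Suc entries_ok_def by blast
      have zn: "(zi, zj) \<notin> cells_le T a" using z by (auto simp: cells_le_def)
      have rz: "rl (cells_le T (Suc a)) = (rl (cells_le T a))(zi := Suc (rl (cells_le T a) zi))" "rl (cells_le T a) zi = zj"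
        using rl_insert[OF dU[of a], of zi zj] dU[of "Suc a"] zn unfolding U by auto
      have fa: "f (Suc a) b' = (if row_start n b' zi \<le> zj then (f a b')(zi := Suc (f a b' zi)) else f a b')" for b'
      proof
        fix i
        show "f (Suc a) b' i = (if row_start n b' zi \<le> zj then (f a b')(zi := Suc (f a b' zi)) else f a b') i"
          using rz unfolding f_def by (simp add: Suc_diff_le)
      qed
      have fz: "f a b' zi = zj - row_start n b' zi" for b' using rz unfolding f_def by simp
      show ?thesis
      proof (cases "?X a b")
        case cross: True
        then have zkm: "zi = k" "zj = m" using Xab z ok unfolding entries_ok_def by blast+
        have 1: "f (Suc a) b = f a b" using fa[of b] stk zkm by simp
        have 2: "f a (Suc b) = f a b" using fb zn zkm by simp
        have 3: "f (Suc a) (Suc b) = (f a b)(k := Suc (f a b k))" using fa[of "Suc b"] zkm st[OF k] 2 by simp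
        \<comment> \<open>The cell being read is itself the new one, so nothing to its right in its
          row is filled yet and the cross creates a cell in column 0.\<close>
        have "f a b k = 0" using fz[of b] zkm stk by simp
        then have g4: "g (Suc a) (Suc b) = insert (k, 0) (g a b)" unfolding g_def 3 insert_ferrers[symmetric] by simp
        have "(k, 0) \<notin> g a b" using \<open>f a b k = 0\<close> unfolding g_def by (simp add: mem_ferrers)
        moreover have "dset (insert (k, 0) (g a b))" using dg g4 by metis
        ultimately have "colface True (g a b) (g a b) (g a b) (g (Suc a) (Suc b))"
          unfolding g4 by (intro face_cross dg) auto
        then show ?thesis using cross 1 2 unfolding g_def by simp
      next
        case False
        show ?thesis
        proof (cases "(k, m) \<in> cells_le T a")
          case no: False
          have "f a (Suc b) = f a b" "f (Suc a) (Suc b) = f (Suc a) b" using fb nocross[OF False] no by auto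
          then have "g a (Suc b) = g a b" "g (Suc a) (Suc b) = g (Suc a) b" unfolding g_def by auto
          moreover have "le1 (g a b) (g (Suc a) b)" unfolding g_def fa using le by simp
          ultimately show ?thesis using False face_trivial(1)[OF dg dg] by simp
        next
          case km: True
          have f2: "f a (Suc b) = (f a b)(k := Suc (f a b k))" using fb km by simp
          have f4: "f (Suc a) (Suc b) = (f (Suc a) b)(k := Suc (f (Suc a) b k))" using fb km nocross[OF False] by simp
          show ?thesis
          proof (cases "row_start n b zi \<le> zj")
            case no: False
            then have "f (Suc a) b = f a b" using fa by simp
            then have "g (Suc a) b = g a b" "g (Suc a) (Suc b) = g a (Suc b)" using f2 f4 unfolding g_def by auto
            moreover have "le1 (g a b) (g a (Suc b))" unfolding g_def f2 by (rule le)
            ultimately show ?thesis using False face_trivial(2)[OF dg dg] by simp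
          next
            case True
            have f3: "f (Suc a) b = (f a b)(zi := Suc (f a b zi))" using fa True by simp
            have g2: "g a (Suc b) = insert (k, f a b k) (g a b)" unfolding g_def f2 insert_ferrers ..
            have g3: "g (Suc a) b = insert (zi, f a b zi) (g a b)" unfolding g_def f3 insert_ferrers ..
            have d2: "dset (insert (k, f a b k) (g a b))" using dg[of a "Suc b"] unfolding g2 .
            have d3: "dset (insert (zi, f a b zi) (g a b))" using dg[of "Suc a" b] unfolding g3 .
            show ?thesis
            proof (cases "zi = k")
              case False
              have "g (Suc a) (Suc b) = insert (k, f a b k) (insert (zi, f a b zi) (g a b))"
                unfolding g_def f4 f3 insert_ferrers[symmetric] using False by simp
              then show ?thesis using \<open>\<not> ?X a b\<close> False
                by (simp, intro face_unionI[of _ _ _ "(k, f a b k)" "(zi, f a b zi)"])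
                  (use dg g2 g3 d2 d3 in \<open>simp_all add: g_def not_mem_ferrers\<close>)
            next
              case eq: True
              \<comment> \<open>Both the new entry and the newly read cell lengthen row
                \<open>k\<close>, so the two added cells are neighbours in that row and hence in
                consecutive columns.\<close>
              have e: "g (Suc a) (Suc b) = insert (k, Suc (f a b k)) (g a (Suc b))"
                unfolding g_def f4 f3 f2 eq using insert_ferrers[of k "(f a b)(k := Suc (f a b k))"] by simp
              have n: "(k, Suc (f a b k)) \<notin> g a (Suc b)" unfolding g_def f2 by (simp add: mem_ferrers)
              show ?thesis
              proof -
                have "colface False (g a b) (g a (Suc b)) (g (Suc a) b) (g (Suc a) (Suc b))"
                proof (rule face_chainI[of _ _ _ "(k, f a b k)" "(k, Suc (f a b k))"])
                  show "(k, f a b k) \<notin> g a b" unfolding g_def by (rule not_mem_ferrers)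
                  show "g (Suc a) b = g a (Suc b)" using g2 g3 eq by simp
                qed (fact dg g2 e n | simp)+
                then show ?thesis using \<open>\<not> ?X a b\<close> by simp
              qed
            qed
          qed
        qed
      qed
    qed
  qed
  have "g q (n * n) = wsh ?X 0 0 q (n * n)"
  proof (rule wsh_unique[OF X, where m = q and n = "n * n"])
    fix b show "g 0 b = {}" unfolding g_def f_def cells_le_0[OF ok] rl_def ferrers_def by simp
  next
    fix a show "g a 0 = {}" unfolding g_def f_def ferrers_def row_start_def using rln by (auto simp: not_less)
  qed (use face in auto)
  moreover have "g q (n * n) = cells_le T q"
  proof -
    have "f q (n * n) = rl (cells_le T q)"
    proof
      fix i show "f q (n * n) i = rl (cells_le T q) i" unfolding f_def row_start_def using rl0[of i q] by (cases "n = 0") auto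
    qed
    then show ?thesis unfolding g_def using ferrers_rl[OF dU] by simp
  qed
  moreover have "sh ?X 0 q 0 (n * n + d) = sh ?X 0 q 0 (n * n)" for d
  proof (induction d)
    case (Suc d)
    have "\<not> ?X i (n * n + d)" for i
    proof
      assume "?X i (n * n + d)"
      then obtain c where "T c = Some (Suc i)" "pos n c = n * n + d" unfolding reading_def by auto
      moreover have "c \<in> box n" using calculation box by auto
      ultimately show False using pos_inv(3)[of c n] by simp
    qed
    then show ?case using sh_row_empty_upper[OF X, of 0 "n * n + d" 0 q] Suc by simp
  qed simp
  moreover obtain d where "h = n * n + d" using h le_Suc_ex by blast
  ultimately show ?thesis unfolding sh_def by simp
qed

section \<open>Slides and rectification\<close>

lemma wsh_shift: "(\<And>i j. X (p + i) j \<longleftrightarrow> Y i j) \<Longrightarrow> wsh X p s a b = wsh Y 0 s a b"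
  by (induction X p s a b rule: wsh.induct) simp_all

lemma sh_shift: "(\<And>i j. X (p + i) j \<longleftrightarrow> Y i j) \<Longrightarrow> sh X p (p + q) s t = sh Y 0 q s t"
  unfolding sh_def using wsh_shift[of X p Y] by simp

text \<open>In a jeu de taquin square three labels determine the fourth, so the windows that start
  in column \<open>k\<close> determine those that start later, even for two matrices with different
  rows.\<close>

lemma sh_triangle_unique:
  assumes X: "pperm X" and Y: "pperm Y"
    and row: "\<And>q. q \<le> m \<Longrightarrow> sh X k q s t = sh Y k q s' t'"
  shows "k \<le> p \<Longrightarrow> q \<le> m \<Longrightarrow> sh X p q s t = sh Y p q s' t'"
proof (induction p arbitrary: q rule: dec_induct)
  case base then show ?case using row by simp
next
  case (step p)
  from step.prems show ?case
  proof (induction q)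
    case 0 then show ?case by simp
  next
    case (Suc q)
    show ?case
    proof (cases "p < q")
      case True
      have "jdtface (sh X (Suc p) q s t) (sh X p q s t) (sh X (Suc p) (Suc q) s t) (sh X p (Suc q) s t)"
        by (rule sh_jdt_pq[OF X True])
      moreover have "jdtface (sh Y (Suc p) q s' t') (sh Y p q s' t') (sh Y (Suc p) (Suc q) s' t') (sh Y p (Suc q) s' t')"
        by (rule sh_jdt_pq[OF Y True])
      moreover have "sh X (Suc p) q s t = sh Y (Suc p) q s' t'" using Suc by simp
      moreover have "sh X p q s t = sh Y p q s' t'" "sh X p (Suc q) s t = sh Y p (Suc q) s' t'"
        using step.IH Suc.prems by simp_all
      ultimately show ?thesis using jdtface_unique by metis
    next
      case False then show ?thesis by simp
    qed
  qed
qed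

section \<open>Fillings as chains of shapes\<close>

definition chain_filling :: "nat \<Rightarrow> (nat \<Rightarrow> cell set) \<Rightarrow> filling" where
  "chain_filling r Z = (\<lambda>c.
     let P = (\<lambda>i. 1 \<le> i \<and> i \<le> r \<and> c \<in> sym_diff (Z (i - 1)) (Z i))
     in if \<exists>i. P i then Some (THE i. P i) else None)"

lemma chain_mono:
  assumes "\<And>i. i < r \<Longrightarrow> le1 (Z i) (Z (Suc i))"
  shows "i \<le> j \<Longrightarrow> j \<le> r \<Longrightarrow> Z i \<subseteq> Z j"
proof (induction j rule: dec_induct)
  case (step j)
  then show ?case using le1_subset[OF assms[of j]] by auto
qed simp

context
  fixes r :: nat and Z :: "nat \<Rightarrow> cell set"
  assumes Z0: "Z 0 = {}" and le: "\<And>i. i < r \<Longrightarrow> le1 (Z i) (Z (Suc i))"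
begin

lemma Z_mono: "i \<le> j \<Longrightarrow> j \<le> r \<Longrightarrow> Z i \<subseteq> Z j"
  using chain_mono[of r Z] le by blast

lemma chain_filling_eq_Some:
  "chain_filling r Z c = Some (Suc v) \<longleftrightarrow> v < r \<and> c \<in> Z (Suc v) \<and> c \<notin> Z v"
  "chain_filling r Z c \<noteq> Some 0"
proof -
  define P where "P = (\<lambda>i. 1 \<le> i \<and> i \<le> r \<and> c \<in> sym_diff (Z (i - 1)) (Z i))"
  have cf: "chain_filling r Z c = (if \<exists>i. P i then Some (THE i. P i) else None)"
    unfolding chain_filling_def Let_def P_def ..
  have P: "P i \<longleftrightarrow> 1 \<le> i \<and> i \<le> r \<and> c \<in> Z i \<and> c \<notin> Z (i - 1)" for i
    using Z_mono[of "i - 1" i] unfolding P_def by auto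
  have uniq: "i = j" if "P i" "P j" for i j
  proof -
    have "\<not> i < j" if "P i" "P j" for i j
    proof
      assume "i < j"
      then have "i \<le> j - 1" "j - 1 \<le> r" using that P[of j] by auto
      then have "Z i \<subseteq> Z (j - 1)" using Z_mono by blast
      then show False using that unfolding P by blast
    qed
    then show ?thesis using that by (meson linorder_neqE_nat)
  qed
  have eq: "chain_filling r Z c = Some i \<longleftrightarrow> P i" for i
  proof
    assume "chain_filling r Z c = Some i"
    then have a: "(if \<exists>i. P i then Some (THE i. P i) else None) = Some i" unfolding cf .
    have "\<exists>i. P i"
    proof (rule ccontr)
      assume "\<nexists>i. P i"
      then show False using a by simp
    qed
    moreover from this have "(THE i. P i) = i" using a by simp
    ultimately show "P i" using uniq theI[of P] by blast
  next
    assume i: "P i"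
    then have "(THE i. P i) = i" using uniq by blast
    then show "chain_filling r Z c = Some i" using i unfolding cf by auto
  qed
  show "chain_filling r Z c = Some (Suc v) \<longleftrightarrow> v < r \<and> c \<in> Z (Suc v) \<and> c \<notin> Z v"
    unfolding eq P by auto
  show "chain_filling r Z c \<noteq> Some 0" unfolding eq P_def by simp
qed

lemma cells_le_chain_filling: "v \<le> r \<Longrightarrow> cells_le (chain_filling r Z) v = Z v"
proof (induction v)
  case 0
  have "x \<noteq> 0" if "chain_filling r Z c = Some x" for c x using chain_filling_eq_Some(2)[of c] that by metis
  then show ?case using Z0 by (auto simp: cells_le_def)
next
  case (Suc v)
  then have "{c. chain_filling r Z c = Some (Suc v)} = Z (Suc v) - Z v" by (auto simp: chain_filling_eq_Some)
  then show ?case using Suc le1_subset[OF le, of v] by (auto simp: cells_le_Suc)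
qed

lemma dom_chain_filling: "dom (chain_filling r Z) = Z r"
proof -
  have "c \<in> cells_le (chain_filling r Z) r" if "chain_filling r Z c = Some x" for c x
    using that chain_filling_eq_Some(1)[of c "x - 1"] chain_filling_eq_Some(2)[of c]
    by (cases x) (auto simp: cells_le_def)
  then have "dom (chain_filling r Z) = cells_le (chain_filling r Z) r"
    using cells_le_dom by fast
  then show ?thesis using cells_le_chain_filling by simp
qed

lemma entries_ok_chain_filling: "entries_ok (chain_filling r Z)"
  unfolding entries_ok_def
proof (intro conjI allI impI)
  fix c c' x assume a: "chain_filling r Z c = Some x" "chain_filling r Z c' = Some x"
  then obtain v where "x = Suc v" using chain_filling_eq_Some(2) by (cases x) auto
  then have "v < r" "c \<in> Z (Suc v) - Z v" "c' \<in> Z (Suc v) - Z v" using a chain_filling_eq_Some(1) by auto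
  then show "c = c'" using le[of v] unfolding le1_def by auto
qed (rule chain_filling_eq_Some(2))

lemma tableau_chain_filling:
  assumes d: "\<And>i. i \<le> r \<Longrightarrow> dset (Z i)" shows "tableau (chain_filling r Z)"
proof -
  have "cells_le (chain_filling r Z) v = Z (min v r)" for v
  proof (cases "v \<le> r")
    case False
    then have "cells_le (chain_filling r Z) r \<subseteq> cells_le (chain_filling r Z) v" by (auto simp: cells_le_def)
    then show ?thesis using False cells_le_dom[of "chain_filling r Z" v] dom_chain_filling cells_le_chain_filling[of r] by auto
  qed (simp add: cells_le_chain_filling)
  then show ?thesis unfolding tableau_def using entries_ok_chain_filling d by simp
qed

end

lemma cells_le_mono: "u \<le> v \<Longrightarrow> cells_le T u \<subseteq> cells_le T v"
  by (auto simp: cells_le_def)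

lemma cells_le_eq_Some: "T c = Some (Suc v) \<longleftrightarrow> c \<in> cells_le T (Suc v) \<and> c \<notin> cells_le T v"
  by (cases "T c") (auto simp: cells_le_def)

lemma cells_le_Suc_le1:
  assumes "entries_ok T" shows "cells_le T (Suc v) = cells_le T v \<or> (\<exists>c. T c = Some (Suc v) \<and> cells_le T (Suc v) = insert c (cells_le T v))"
  using assms unfolding cells_le_Suc entries_ok_def by (cases "\<exists>c. T c = Some (Suc v)") blast+

lemma chain_filling_cells_le:
  assumes ok: "entries_ok T" and r: "dom T \<subseteq> cells_le T r"
  shows "T = chain_filling r (cells_le T)"
proof -
  have le: "le1 (cells_le T i) (cells_le T (Suc i))" for i
    using cells_le_Suc_le1[OF ok, of i] by auto
  have "T c = Some x \<longleftrightarrow> chain_filling r (cells_le T) c = Some x" for c x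
  proof (cases x)
    case 0
    then show ?thesis using ok chain_filling_eq_Some(2)[OF cells_le_0[OF ok] le, of r c] unfolding entries_ok_def by metis
  next
    case (Suc v)
    have "v < r" if "T c = Some (Suc v)" using that r by (force simp: cells_le_def)
    then show ?thesis unfolding Suc chain_filling_eq_Some(1)[OF cells_le_0[OF ok] le]
      using cells_le_eq_Some by blast
  qed
  then show ?thesis by (metis ext not_None_eq)
qed

section \<open>Jeu de taquin squares of a single slide\<close>

lemma dset_remove_corner:
  assumes d: "dset (insert h E)" and h: "h \<notin> E" and adj: "\<And>c. adjacent h c \<Longrightarrow> c \<notin> E"
  shows "dset E"
  unfolding dset_def
proof (intro conjI allI impI)
  show "finite E" using dset_finite[OF d] by simp
  fix i j i' j' assume ij: "(i, j) \<in> E" "i' \<le> i" "j' \<le> j"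
  show "(i', j') \<in> E"
  proof (rule ccontr)
    assume n: "(i', j') \<notin> E"
    have "(i', j') \<in> insert h E" using dsetD[OF d _ ij(2,3)] ij(1) by blast
    then have he: "h = (i', j')" using n by simp
    have "(i, j) \<noteq> h" using ij h by auto
    then consider "Suc i' \<le> i" | "Suc j' \<le> j" using ij he by fastforce
    then show False
    proof cases
      case 1
      then have "(Suc i', j') \<in> insert h E" using dsetD[OF d, of i j "Suc i'" j'] ij by auto
      then show False using adj[of "(Suc i', j')"] he by (auto simp: adjacent_def)
    next
      case 2
      then have "(i', Suc j') \<in> insert h E" using dsetD[OF d, of i j i' "Suc j'"] ij by auto
      then show False using adj[of "(i', Suc j')"] he by (auto simp: adjacent_def)
    qed
  qed
qed

lemma dset_adjacent: "dset E \<Longrightarrow> adjacent h c \<Longrightarrow> c \<in> E \<Longrightarrow> h \<in> E"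
  using dsetD[of E "fst c" "snd c" "fst h" "snd h"] by (auto simp: adjacent_def)

text \<open>State of a slide with hole \<open>h\<close> that has passed the entries up to \<open>x0\<close>; the cells of \<open>P\<close>
  are the inner cells that remain after the slide.\<close>

definition slide_state :: "cell set \<Rightarrow> cell \<Rightarrow> filling \<Rightarrow> nat \<Rightarrow> bool" where
  "slide_state P h S x0 \<longleftrightarrow> entries_ok S \<and> h \<notin> P \<and> S h = None \<and> P \<inter> dom S = {} \<and>
     (\<forall>v\<ge>x0. dset (insert h (P \<union> cells_le S v))) \<and> dset (P \<union> cells_le S x0)"

text \<open>A slide is recorded as a ladder of squares between the chain of the resulting filling
  and the chain of the original one, where the hole counts as an inner cell of the latter. The
  squares below \<open>x0\<close> belong to earlier moves of the hole.\<close>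

definition slide_faces :: "cell set \<Rightarrow> cell \<Rightarrow> filling \<Rightarrow> nat \<Rightarrow> filling \<Rightarrow> bool" where
  "slide_faces P h S x0 S' \<longleftrightarrow> entries_ok S' \<and> P \<inter> dom S' = {} \<and> dom S' \<subseteq> insert h (dom S) \<and>
     ran S' = ran S \<and> (\<forall>v\<le>x0. cells_le S' v = cells_le S v) \<and>
     (\<forall>v\<ge>x0. jdtface (P \<union> cells_le S' v) (insert h (P \<union> cells_le S v))
                    (P \<union> cells_le S' (Suc v)) (insert h (P \<union> cells_le S (Suc v))))"

text \<open>As long as no neighbour of the hole has been reached, the hole is a corner of the region
  and can be removed from it.\<close>

lemma slide_quiet:
  assumes st: "slide_state P h S x0" and v: "x0 \<le> v"
    and n: "\<And>c. adjacent h c \<Longrightarrow> c \<notin> cells_le S v"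
  shows "dset (P \<union> cells_le S v)" "h \<notin> P \<union> cells_le S v"
proof -
  show h: "h \<notin> P \<union> cells_le S v" using st unfolding slide_state_def cells_le_def by auto
  show "dset (P \<union> cells_le S v)"
  proof (rule dset_remove_corner[OF _ h])
    show "dset (insert h (P \<union> cells_le S v))" using st v unfolding slide_state_def by blast
    fix c assume c: "adjacent h c"
    have "c \<notin> P"
    proof
      assume "c \<in> P"
      then have "h \<in> P \<union> cells_le S x0" using dset_adjacent[OF _ c] st unfolding slide_state_def by blast
      then show False using st unfolding slide_state_def cells_le_def by auto
    qed
    then show "c \<notin> P \<union> cells_le S v" using n[OF c] by blast
  qed
qed

lemma slide_quiet_face:
  assumes st: "slide_state P h S x0" and v: "x0 \<le> v"
    and n: "\<And>c. adjacent h c \<Longrightarrow> c \<notin> cells_le S (Suc v)"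
  shows "jdtface (P \<union> cells_le S v) (insert h (P \<union> cells_le S v))
                 (P \<union> cells_le S (Suc v)) (insert h (P \<union> cells_le S (Suc v)))"
proof -
  have n': "\<And>c. adjacent h c \<Longrightarrow> c \<notin> cells_le S v" using n cells_le_mono[of v "Suc v" S] by auto
  note q = slide_quiet[OF st v n'] slide_quiet[OF st _ n]
  have d: "dset (insert h (P \<union> cells_le S v))" using st v unfolding slide_state_def by blast
  have ok: "entries_ok S" using st unfolding slide_state_def by blast
  let ?E = "P \<union> cells_le S v"
  consider "cells_le S (Suc v) = cells_le S v" | c where "S c = Some (Suc v)" "cells_le S (Suc v) = insert c (cells_le S v)"
    using cells_le_Suc_le1[OF ok] by blast
  then show ?thesis
  proof cases
    case 1
    then show ?thesis using face_trivial(2)[of ?E "insert h ?E"] q d by simp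
  next
    case 2
    have "c \<notin> cells_le S v" using 2 by (auto simp: cells_le_def)
    moreover have "c \<notin> P" "c \<noteq> h" using 2 st unfolding slide_state_def by auto
    ultimately have c: "c \<notin> ?E" "c \<noteq> h" by auto
    have "dset (insert c ?E)" using q(3) v 2 by simp
    then have "jdtface ?E (insert h ?E) (insert c ?E) (insert h (insert c ?E))"
      by (intro face_unionI[of _ _ _ h c]) (use q d c in simp_all)
    then show ?thesis using 2 by simp
  qed
qed

text \<open>Below \<open>x\<close> the hole stays a removable corner, which gives squares of union
  type. At \<open>x\<close> the cell \<open>h'\<close> is added next to the hole, the chain case of
  \<open>jdtface\<close>. From then on, a hole at \<open>h'\<close> with \<open>x\<close> in
  \<open>h\<close> covers the same region as before the move, so the remaining squares are those of
  the rest of the slide.\<close>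

lemma slide_move:
  assumes st: "slide_state P h S x0" and h': "adjacent h h'" "S h' = Some x"
    and small: "\<And>c y. adjacent h c \<Longrightarrow> c \<noteq> h' \<Longrightarrow> S c = Some y \<Longrightarrow> x < y"
    and S1: "S1 = S(h := Some x, h' := None)"
  shows "slide_state P h' S1 x" "slide_faces P h' S1 x S' \<Longrightarrow> slide_faces P h S x0 S'"
proof -
  have ok: "entries_ok S" and hP: "h \<notin> P" and Sh: "S h = None" and PS: "P \<inter> dom S = {}"
    and d: "\<And>v. x0 \<le> v \<Longrightarrow> dset (insert h (P \<union> cells_le S v))" and d0: "dset (P \<union> cells_le S x0)"
    using st unfolding slide_state_def by blast+
  have hh': "h \<noteq> h'" using Sh h' by auto
  have h'P: "h' \<notin> P" using PS h' by auto
  \<comment> \<open>A neighbour with an entry at most \<open>x0\<close> would lie in an order ideal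
    that lacks the hole.\<close>
  have xx0: "x0 < x"
  proof (rule ccontr)
    assume "\<not> ?thesis"
    then have "h' \<in> P \<union> cells_le S x0" using h' by (auto simp: cells_le_def)
    then have "h \<in> P \<union> cells_le S x0" using dset_adjacent[OF d0 h'(1)] by blast
    then show False using hP Sh by (auto simp: cells_le_def)
  qed
  then obtain w where w: "x = Suc w" "x0 \<le> w" by (cases x) auto
  have U1: "cells_le S1 v = cells_le S v" if "v < x" for v
    using that hh' h' Sh unfolding S1 by (auto simp: cells_le_def)
  have U2: "insert h' (P \<union> cells_le S1 v) = insert h (P \<union> cells_le S v)" if "x \<le> v" for v
    using that hh' h' Sh unfolding S1 by (auto simp: cells_le_def)
  have inj: "c = h'" if "S c = Some x" for c using that ok h' unfolding entries_ok_def by blast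
  have "S1 c = Some x \<longleftrightarrow> c = h \<or> c \<noteq> h' \<and> S c = Some x" for c
    unfolding S1 using hh' by simp
  then have x: "{c. S c = Some (Suc w)} = {h'}" "{c. S1 c = Some (Suc w)} = {h}"
    using h'(2) inj unfolding w(1)[symmetric] by blast+
  have U3: "cells_le S1 x = insert h (cells_le S w)"
    using U1[of w] unfolding w(1) cells_le_Suc x by simp
  have U4: "cells_le S x = insert h' (cells_le S w)"
    unfolding w(1) cells_le_Suc x by simp
  have no: "c \<notin> cells_le S v" if "adjacent h c" "v < x" for c v
  proof
    assume "c \<in> cells_le S v"
    then obtain y where "S c = Some y" "y \<le> v" by (auto simp: cells_le_def)
    then show False using small[of c y] that h' by (cases "c = h'") auto
  qed
  have ok1: "entries_ok S1" using ok h' xx0 unfolding S1 entries_ok_def by auto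
  show "slide_state P h' S1 x" unfolding slide_state_def
  proof (intro conjI allI impI)
    show "S1 h' = None" "entries_ok S1" "h' \<notin> P" by (use ok1 h'P S1 in auto)
    show "P \<inter> dom S1 = {}" using PS hP unfolding S1 by auto
    show "dset (insert h' (P \<union> cells_le S1 v))" if "x \<le> v" for v unfolding U2[OF that] using d that xx0 by simp
    have "P \<union> cells_le S1 x = insert h (P \<union> cells_le S w)" unfolding U3 by auto
    then show "dset (P \<union> cells_le S1 x)" using d w by simp
  qed
  assume f: "slide_faces P h' S1 x S'"
  show "slide_faces P h S x0 S'" unfolding slide_faces_def
  proof (intro conjI allI impI)
    show "entries_ok S'" "P \<inter> dom S' = {}" using f unfolding slide_faces_def by blast+
    have "dom S1 \<subseteq> insert h (dom S)" "h' \<in> dom S" using h' unfolding S1 by auto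
    then show "dom S' \<subseteq> insert h (dom S)" using f unfolding slide_faces_def by blast
    have "ran S1 = ran S"
    proof
      show "ran S1 \<subseteq> ran S" using h' unfolding S1 ran_def by auto
      show "ran S \<subseteq> ran S1"
      proof
        fix y assume "y \<in> ran S"
        then obtain c where c: "S c = Some y" by (auto simp: ran_def)
        show "y \<in> ran S1"
        proof (cases "c = h'")
          case True
          then have "S1 h = Some y" using c h' hh' unfolding S1 by simp
          then show ?thesis by (rule ranI)
        next
          case False
          then have "S1 c = Some y" using c Sh unfolding S1 by auto
          then show ?thesis by (rule ranI)
        qed
      qed
    qed
    then show "ran S' = ran S" using f unfolding slide_faces_def by simp
    show "cells_le S' v = cells_le S v" if "v \<le> x0" for v
      using f that xx0 U1 unfolding slide_faces_def by simp
    fix v assume v: "x0 \<le> v"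
    have eq: "cells_le S' u = cells_le S1 u" if "u \<le> x" for u using f that unfolding slide_faces_def by blast
    consider "Suc v < x" | "Suc v = x" | "x \<le> v" by linarith
    then show "jdtface (P \<union> cells_le S' v) (insert h (P \<union> cells_le S v))
                    (P \<union> cells_le S' (Suc v)) (insert h (P \<union> cells_le S (Suc v)))"
    proof cases
      case 1
      then show ?thesis using slide_quiet_face[OF st v no] eq U1 by simp
    next
      case 2
      then have vw: "v = w" "v < x" using w by auto
      let ?E = "P \<union> cells_le S v"
      note q = slide_quiet[OF st v no[OF _ vw(2)]]
      have e: "P \<union> cells_le S' v = ?E" "P \<union> cells_le S' (Suc v) = insert h ?E"
        "insert h (P \<union> cells_le S (Suc v)) = insert h' (insert h ?E)"
        using eq[of v] eq[of x] U1[of v] U3 U4 2 vw by auto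
      have "h' \<notin> insert h ?E" using hh' h'P no[OF h'(1) vw(2)] by auto
      moreover have "dset (insert h' (insert h ?E))" using d[of x] xx0 e(3) 2 by simp
      ultimately show ?thesis unfolding e
        by (intro face_chainI[of _ _ _ h h']) (use q d[OF v] h' in simp_all)
    next
      case 3
      then have "jdtface (P \<union> cells_le S' v) (insert h' (P \<union> cells_le S1 v))
                    (P \<union> cells_le S' (Suc v)) (insert h' (P \<union> cells_le S1 (Suc v)))"
        using f unfolding slide_faces_def by blast
      then show ?thesis using U2[of v] U2[of "Suc v"] 3 by simp
    qed
  qed
qed

lemma slide_faces:
  "slide h S S' \<Longrightarrow> slide_state P h S x0 \<Longrightarrow> slide_faces P h S x0 S'"
proof (induction arbitrary: x0 rule: slide.induct)
  case (stop S i j)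
  have n: "c \<notin> cells_le S v" if "adjacent (i, j) c" for c v
    using that stop(1,2) unfolding adjacent_def cells_le_def by auto
  show ?case
    using slide_quiet_face[OF stop(3) _ n] stop(3) unfolding slide_faces_def slide_state_def by blast
next
  case (right S i j x S')
  have "adjacent (i, j) (i, Suc j)" by (simp add: adjacent_def)
  moreover have "x < y" if "adjacent (i, j) c" "c \<noteq> (i, Suc j)" "S c = Some y" for c y
    using that right(2) by (auto simp: adjacent_def)
  ultimately show ?case using slide_move[OF right(5) _ right(1) _ refl] right(4) by blast
next
  case (down S i j y S')
  have "adjacent (i, j) (Suc i, j)" by (simp add: adjacent_def)
  moreover have "y < x" if "adjacent (i, j) c" "c \<noteq> (Suc i, j)" "S c = Some x" for c x
    using that down(2) by (auto simp: adjacent_def)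
  ultimately show ?case using slide_move[OF down(5) _ down(1) _ refl] down(4) by blast
qed

section \<open>Invariance of reading shapes under slides\<close>

definition skew_tableau :: "nat \<Rightarrow> nat \<Rightarrow> filling \<Rightarrow> bool" where
  "skew_tableau r n S \<longleftrightarrow> entries_ok S \<and> dom S \<subseteq> box n \<and> ran S \<subseteq> {..r} \<and>
     (\<forall>i j i' j' x y. S (i, j) = Some x \<longrightarrow> S (i', j') = Some y \<longrightarrow> i \<le> i' \<longrightarrow> j \<le> j' \<longrightarrow> x \<le> y)"

definition reading_shape :: "nat \<Rightarrow> filling \<Rightarrow> nat \<Rightarrow> cell set" where
  "reading_shape n S q = sh (reading n S) 0 q 0 (n * n)"

lemma dom_cells_le: assumes "ran T \<subseteq> {..r}" shows "dom T = cells_le T r"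
proof -
  have "y \<le> r" if "T c = Some y" for c y using ranI[of T c y] that assms by auto
  then show ?thesis unfolding cells_le_def by (auto simp: dom_def)
qed

lemma dset_box: "dset (box n)" unfolding dset_def box_def by auto

lemma skew_tableau_dset:
  assumes S: "skew_tableau r n S" and L: "dset L" and R: "dset R" "R \<subseteq> L" and dom: "dom S = L - R"
  shows "dset (R \<union> cells_le S v)"
  unfolding dset_def
proof (intro conjI allI impI)
  show "finite (R \<union> cells_le S v)"
    by (rule finite_subset[OF _ dset_finite[OF L]]) (use R dom cells_le_dom[of S v] in blast)
  fix i j i' j' assume ij: "(i, j) \<in> R \<union> cells_le S v" "i' \<le> i" "j' \<le> j"
  show "(i', j') \<in> R \<union> cells_le S v"
  proof (cases "(i, j) \<in> R")
    case True then show ?thesis using dsetD[OF R(1)] ij by blast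
  next
    case False
    then obtain y where y: "S (i, j) = Some y" "y \<le> v" using ij(1) by (auto simp: cells_le_def)
    then have "(i, j) \<in> L" using dom by blast
    then have "(i', j') \<in> L" using dsetD[OF L] ij by blast
    then consider "(i', j') \<in> R" | x where "S (i', j') = Some x" using dom by blast
    then show ?thesis
    proof cases
      case 2
      then have "x \<le> y" using S y ij unfolding skew_tableau_def by blast
      then show ?thesis using 2 y by (auto simp: cells_le_def)
    qed simp
  qed
qed

lemma skew_tableauI:
  assumes ok: "entries_ok S" and box: "dom S \<subseteq> box n" and ran: "ran S \<subseteq> {..r}"
    and d: "\<And>v. dset (P \<union> cells_le S v)" and P: "P \<inter> dom S = {}"
  shows "skew_tableau r n S"
  unfolding skew_tableau_def
proof (intro conjI allI impI)
  fix i j i' j' x y assume a: "S (i, j) = Some x" "S (i', j') = Some y" "i \<le> i'" "j \<le> j'"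
  then have "(i', j') \<in> P \<union> cells_le S y" by (auto simp: cells_le_def)
  then have "(i, j) \<in> P \<union> cells_le S y" using dsetD[OF d] a by blast
  then show "x \<le> y" using a P by (auto simp: cells_le_def)
qed (use assms in auto)

lemma corner_exists:
  assumes "dset P" "P \<noteq> {}" shows "\<exists>c\<in>P. dset (P - {c})"
proof -
  have fin: "finite P" by (rule dset_finite[OF assms(1)])
  define m where "m = Max ((\<lambda>c. fst c + snd c) ` P)"
  have "m \<in> (\<lambda>c. fst c + snd c) ` P" unfolding m_def using fin assms(2) by (intro Max_in) auto
  then obtain c where c: "c \<in> P" "m = fst c + snd c" by auto
  have max: "fst d + snd d \<le> m" if "d \<in> P" for d unfolding m_def using fin that by (intro Max_ge) auto
  have "dset (P - {c})"
  proof (rule dset_remove_corner[of c])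
    show "dset (insert c (P - {c}))" using assms(1) c by (simp add: insert_absorb)
    fix d assume "adjacent c d"
    then show "d \<notin> P - {c}" using max[of d] c by (auto simp: adjacent_def)
  qed simp
  then show ?thesis using c by blast
qed

text \<open>Any corner of \<open>R\<close> is vacated by removing the entry \<open>1\<close> from a suitable standard tableau of shape \<open>R\<close>
  (given by the chain \<open>\<rho>\<close>) by a jeu de taquin slide.\<close>

lemma chain_pair_exists:
  assumes "dset P" "dset R" "le1 P R" "P \<noteq> R"
  shows "\<exists>m \<rho> \<sigma>. 1 \<le> m \<and> \<rho> 0 = {} \<and> \<rho> m = R \<and> \<sigma> 0 = {} \<and> \<sigma> 1 = {} \<and> \<sigma> m = P \<and> le1 (\<rho> 0) (\<rho> 1) \<and>
    (\<forall>v. 1 \<le> v \<and> v < m \<longrightarrow> jdtface (\<sigma> v) (\<rho> v) (\<sigma> (Suc v)) (\<rho> (Suc v))) \<and> dset (\<rho> m) \<and> dset (\<sigma> m)"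
  using assms
proof (induction "card P" arbitrary: P R)
  case 0
  then have P: "P = {}" using dset_finite by auto
  show ?case
    by (rule exI[of _ 1], rule exI[of _ "\<lambda>v. if v = 0 then {} else R"], rule exI[of _ "\<lambda>v. {}"])
      (use 0 P in auto)
next
  case (Suc k)
  then have "P \<noteq> {}" by auto
  then obtain c where c: "c \<in> P" "dset (P - {c})" using corner_exists[OF Suc.prems(1)] by blast
  let ?P = "P - {c}"
  have "le1 ?P P" using c le1_insert[of ?P c] by (simp add: insert_absorb)
  \<comment> \<open>The last square of the ladder is completed backwards after the removal of a
    corner of \<open>P\<close>; its lower edge is again a nontrivial step, from \<open>?P\<close> to
    \<open>Q\<close>, to which the induction hypothesis applies.\<close>
  then obtain Q where Q: "jdtface ?P P Q R" using jdtface_exists[OF c(2) Suc.prems(1,2)] Suc.prems(3) by blast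
  have Q': "jdtface ?P Q P R" using face_commuteI[OF Q] .
  have "?P \<noteq> Q" using face_degenerate(1)[OF Q'] Suc.prems(4) by blast
  moreover have "card ?P = k" using Suc.hyps(2) c(1) by simp
  ultimately obtain m \<rho> \<sigma> where m: "1 \<le> m" "\<rho> 0 = {}" "\<rho> m = Q" "\<sigma> 0 = {}" "\<sigma> 1 = {}" "\<sigma> m = ?P" "le1 (\<rho> 0) (\<rho> 1)"
    "\<forall>v. 1 \<le> v \<and> v < m \<longrightarrow> jdtface (\<sigma> v) (\<rho> v) (\<sigma> (Suc v)) (\<rho> (Suc v))"
    using Suc.hyps(1)[of ?P Q] face_dset[OF Q'] by blast
  have f: "jdtface ((\<sigma>(Suc m := P)) v) ((\<rho>(Suc m := R)) v) ((\<sigma>(Suc m := P)) (Suc v)) ((\<rho>(Suc m := R)) (Suc v))"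
    if v: "1 \<le> v \<and> v < Suc m" for v
  proof -
    show "jdtface ((\<sigma>(Suc m := P)) v) ((\<rho>(Suc m := R)) v) ((\<sigma>(Suc m := P)) (Suc v)) ((\<rho>(Suc m := R)) (Suc v))"
    proof (cases "v = m")
      case True
      then show ?thesis using Q' m by simp
    next
      case False
      then show ?thesis using v m(8) by simp
    qed
  qed
  have "(\<rho>(Suc m := R)) 0 = {}" "(\<rho>(Suc m := R)) (Suc m) = R" "(\<sigma>(Suc m := P)) 0 = {}" "(\<sigma>(Suc m := P)) 1 = {}"
    "(\<sigma>(Suc m := P)) (Suc m) = P" "le1 ((\<rho>(Suc m := R)) 0) ((\<rho>(Suc m := R)) 1)"
    using m by simp_all
  moreover have "1 \<le> Suc m" by simp
  ultimately show ?case using f Suc.prems(1,2) by (intro exI conjI allI impI) (assumption | simp)+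
qed

text \<open>Filling the inner shapes by the chains \<rho> and \<sigma> extends \<open>S\<close> and
  \<open>S'\<close> to straight tableaux \<open>T\<close> and \<open>T'\<close>. Their reading words
  have the same shapes in all windows that start in column 1, hence in those that start in column
  \<open>m\<close>, where the words of \<open>S\<close> and \<open>S'\<close> begin.\<close>

lemma slide_reading_shape:
  assumes ok: "entries_ok S" "entries_ok S'" and box: "dom S \<subseteq> box n" "dom S' \<subseteq> box n"
    and ran: "ran S \<subseteq> {..r}" "ran S' \<subseteq> {..r}"
    and R: "dset R" "R \<subseteq> box n" "c \<in> R" and P: "dset (R - {c})"
    and disj: "R \<inter> dom S = {}" "(R - {c}) \<inter> dom S' = {}"
    and faces: "\<And>v. jdtface ((R - {c}) \<union> cells_le S' v) (R \<union> cells_le S v)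
                  ((R - {c}) \<union> cells_le S' (Suc v)) (R \<union> cells_le S (Suc v))"
    and q: "q \<le> r"
  shows "reading_shape n S' q = reading_shape n S q"
proof -
  let ?P = "R - {c}"
  have "le1 ?P R" using R(3) le1_insert[of ?P c] by (simp add: insert_absorb)
  moreover have "?P \<noteq> R" using R(3) by auto
  ultimately obtain m \<rho> \<sigma> where m: "1 \<le> m" "\<rho> 0 = {}" "\<rho> m = R" "\<sigma> 0 = {}" "\<sigma> 1 = {}" "\<sigma> m = ?P" "le1 (\<rho> 0) (\<rho> 1)"
    "\<And>v. 1 \<le> v \<Longrightarrow> v < m \<Longrightarrow> jdtface (\<sigma> v) (\<rho> v) (\<sigma> (Suc v)) (\<rho> (Suc v))"
    using chain_pair_exists[OF P R(1)] by metis
  define A where "A v = (if v \<le> m then \<rho> v else R \<union> cells_le S (v - m))" for v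
  define B where "B v = (if v \<le> m then \<sigma> v else ?P \<union> cells_le S' (v - m))" for v
  have Am: "A (m + v) = R \<union> cells_le S v" "B (m + v) = ?P \<union> cells_le S' v" for v
    using m(3,6) cells_le_0[OF ok(1)] cells_le_0[OF ok(2)] unfolding A_def B_def by (cases v; simp)+
  have f: "jdtface (B v) (A v) (B (Suc v)) (A (Suc v))" if "1 \<le> v" for v
  proof (cases "v < m")
    case True
    then show ?thesis using m(8)[OF that] unfolding A_def B_def by simp
  next
    case False
    then obtain w where "v = m + w" using le_Suc_ex not_less by blast
    then show ?thesis using faces[of w] Am[of w] Am[of "Suc w"] by simp
  qed
  have AB0: "A 0 = {}" "B 0 = {}" "B 1 = {}" using m unfolding A_def B_def by auto
  have dA: "dset (A v)" "dset (B v)" for v using f[of v] AB0 face_dset(1,2)[OF f[of v]] by (cases v; simp)+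
  have leA: "le1 (A v) (A (Suc v))" for v
  proof (cases v)
    case 0 then show ?thesis using m(1,7) unfolding A_def by simp
  next
    case (Suc w) then show ?thesis using face_le1(1)[OF f[of v]] by simp
  qed
  have leB: "le1 (B v) (B (Suc v))" for v
  proof (cases v)
    case 0 then show ?thesis using AB0 by simp
  next
    case (Suc w) then show ?thesis using face_dset(6)[OF f[of v]] by simp
  qed
  let ?m = "m + r"
  define T where "T = chain_filling ?m A"
  define T' where "T' = chain_filling ?m B"
  have TA: "tableau T" "tableau T'" unfolding T_def T'_def
    by (intro tableau_chain_filling AB0 leA leB dA)+
  have "A ?m \<subseteq> box n" "B ?m \<subseteq> box n"
    unfolding Am using R(2) box cells_le_dom[of S r] cells_le_dom[of S' r] by auto
  then have boxT: "dom T \<subseteq> box n" "dom T' \<subseteq> box n"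
    unfolding T_def T'_def dom_chain_filling[OF AB0(1) leA] dom_chain_filling[OF AB0(2) leB] by auto
  let ?X = "reading n T" and ?Y = "reading n T'" and ?h = "n * n"
  have X: "pperm ?X" and Y: "pperm ?Y" using pperm_reading boxT TA unfolding tableau_def by blast+
  have shA: "sh ?X 0 v 0 ?h = A v" if "v \<le> ?m" for v
    using sh_reading_tableau[OF TA(1) boxT(1), of ?h v] cells_le_chain_filling[OF AB0(1) leA that] unfolding T_def by simp
  have shB: "sh ?Y 0 v 0 ?h = B v" if "v \<le> ?m" for v
    using sh_reading_tableau[OF TA(2) boxT(2), of ?h v] cells_le_chain_filling[OF AB0(2) leB that] unfolding T'_def by simp
  \<comment> \<open>Moving the left side from 0 to 1 follows the jeu de taquin rule; the ladder of
    squares between \<open>B\<close> and \<open>A\<close> obeys the same rule with the same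
    start.\<close>
  have X1: "sh ?X 1 v 0 ?h = B v" if "v \<le> ?m" for v
    using that
  proof (induction v)
    case (Suc v)
    show ?case
    proof (cases v)
      case 0 then show ?thesis using AB0 by simp
    next
      case (Suc w)
      have "jdtface (sh ?X 1 v 0 ?h) (sh ?X 0 v 0 ?h) (sh ?X 1 (Suc v) 0 ?h) (sh ?X 0 (Suc v) 0 ?h)"
        using sh_jdt_pq[OF X, of 0 v 0 ?h] Suc by simp
      then have "jdtface (B v) (A v) (sh ?X 1 (Suc v) 0 ?h) (A (Suc v))"
        using Suc.IH Suc.prems shA \<open>Suc v \<le> ?m\<close> by simp
      then show ?thesis using jdtface_unique[OF _ f[of v]] Suc by simp
    qed
  qed (simp add: AB0)
  \<comment> \<open>Since \<open>B 1\<close> is empty, \<open>T'\<close> has no entry 1 and column 0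
    of its word is empty.\<close>
  have Y1: "sh ?Y 1 v 0 ?h = B v" if v: "v \<le> ?m" for v
  proof (cases v)
    case 0 then show ?thesis using AB0 by simp
  next
    case (Suc w)
    have "T' d \<noteq> Some 1" for d
      using chain_filling_eq_Some(1)[OF AB0(2) leB, of ?m d 0] AB0(3) unfolding T'_def by simp
    then have "\<not> ?Y 0 y" for y unfolding reading_def by simp
    then show ?thesis using sh_col_empty_lower[OF Y, of 0 v 0 ?h] shB[OF v] Suc by simp
  qed
  have eq: "sh ?X m (m + q) 0 ?h = sh ?Y m (m + q) 0 ?h"
    by (rule sh_triangle_unique[OF X Y, where k = 1 and m = ?m]) (use X1 Y1 m(1) q in auto)
  have "T d = Some (Suc (m + i)) \<longleftrightarrow> S d = Some (Suc i)" for d i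
  proof -
    have "T d = Some (Suc (m + i)) \<longleftrightarrow> i < r \<and> d \<in> A (m + Suc i) \<and> d \<notin> A (m + i)"
      using chain_filling_eq_Some(1)[OF AB0(1) leA, of ?m d "m + i"] unfolding T_def by simp
    also have "\<dots> \<longleftrightarrow> i < r \<and> S d = Some (Suc i)"
      unfolding Am cells_le_eq_Some using disj(1) cells_le_dom[of S] by blast
    also have "\<dots> \<longleftrightarrow> S d = Some (Suc i)" using ran(1) by (auto dest: ranI)
    finally show ?thesis .
  qed
  then have "?X (m + i) y \<longleftrightarrow> reading n S i y" for i y unfolding reading_def by simp
  moreover have "T' d = Some (Suc (m + i)) \<longleftrightarrow> S' d = Some (Suc i)" for d i
  proof -
    have "T' d = Some (Suc (m + i)) \<longleftrightarrow> i < r \<and> d \<in> B (m + Suc i) \<and> d \<notin> B (m + i)"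
      using chain_filling_eq_Some(1)[OF AB0(2) leB, of ?m d "m + i"] unfolding T'_def by simp
    also have "\<dots> \<longleftrightarrow> i < r \<and> S' d = Some (Suc i)"
      unfolding Am cells_le_eq_Some using disj(2) cells_le_dom[of S'] by blast
    also have "\<dots> \<longleftrightarrow> S' d = Some (Suc i)" using ran(2) by (auto dest: ranI)
    finally show ?thesis .
  qed
  then have "?Y (m + i) y \<longleftrightarrow> reading n S' i y" for i y unfolding reading_def by simp
  ultimately show ?thesis unfolding reading_shape_def
    using eq sh_shift[of ?X m "reading n S" q 0 ?h] sh_shift[of ?Y m "reading n S'" q 0 ?h] by simp
qed

lemma slide_state_start:
  assumes S: "skew_tableau r n S" and L: "dset L" and R: "dset R" "R \<subseteq> L" and dom: "dom S = L - R"
    and c: "c \<in> R" "dset (R - {c})"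
  shows "slide_state (R - {c}) c S 0"
proof -
  have "insert c ((R - {c}) \<union> cells_le S v) = R \<union> cells_le S v" for v using c by auto
  moreover have "entries_ok S" using S unfolding skew_tableau_def by blast
  moreover have "S c = None" "(R - {c}) \<inter> dom S = {}" using dom c by auto
  moreover have "dset ((R - {c}) \<union> cells_le S 0)" using cells_le_0[of S] c(2) \<open>entries_ok S\<close> by simp
  ultimately show ?thesis unfolding slide_state_def
    using skew_tableau_dset[OF S L R dom] by simp
qed

lemma slide_facesD:
  assumes "slide_faces P h S x0 S'"
  shows "entries_ok S'" "P \<inter> dom S' = {}" "dom S' \<subseteq> insert h (dom S)" "ran S' = ran S"
    "\<forall>v\<ge>x0. jdtface (P \<union> cells_le S' v) (insert h (P \<union> cells_le S v))
                    (P \<union> cells_le S' (Suc v)) (insert h (P \<union> cells_le S (Suc v)))"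
proof -
  note a = assms[unfolded slide_faces_def]
  show "entries_ok S'" using a by (elim conjE)
  show "P \<inter> dom S' = {}" using a by (elim conjE)
  show "dom S' \<subseteq> insert h (dom S)" using a by (elim conjE)
  show "ran S' = ran S" using a by (elim conjE)
  show "\<forall>v\<ge>x0. jdtface (P \<union> cells_le S' v) (insert h (P \<union> cells_le S v))
                    (P \<union> cells_le S' (Suc v)) (insert h (P \<union> cells_le S (Suc v)))" using a by (elim conjE)
qed

lemma slide_preserves:
  assumes S: "skew_tableau r n S" and L: "dset L" and R: "dset R" "R \<subseteq> L" and dom: "dom S = L - R"
    and c: "c \<in> R" "dset (R - {c})" and sl: "slide c S S'"
  shows "skew_tableau r n S'" "q \<le> r \<Longrightarrow> reading_shape n S' q = reading_shape n S q"
    "\<exists>L'. dset L' \<and> R - {c} \<subseteq> L' \<and> dom S' = L' - (R - {c})"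
proof -
  let ?P = "R - {c}"
  have box: "dom S \<subseteq> box n" and ran: "ran S \<subseteq> {..r}" and ok: "entries_ok S"
    using S unfolding skew_tableau_def by auto
  have f: "slide_faces ?P c S 0 S'" using slide_faces[OF sl slide_state_start[OF S L R dom c]] .
  note ok' = slide_facesD(1)[OF f] and P' = slide_facesD(2)[OF f] and dom' = slide_facesD(3)[OF f] and ran' = slide_facesD(4)[OF f]
  have jf: "jdtface (?P \<union> cells_le S' v) (insert c (?P \<union> cells_le S v))
      (?P \<union> cells_le S' (Suc v)) (insert c (?P \<union> cells_le S (Suc v)))" for v
    using slide_facesD(5)[OF f] by simp
  have d': "dset (?P \<union> cells_le S' v)" for v by (rule face_dset(1)[OF jf])
  \<comment> \<open>An inner corner may come from a presentation \<open>L - R\<close> that reaches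
    beyond the box; such a hole has no filled neighbour.\<close>
  have out: "S' = S" if "c \<notin> box n"
  proof -
    obtain i j where ij: "c = (i, j)" by fastforce
    then have "(i, Suc j) \<notin> box n" "(Suc i, j) \<notin> box n" using that by (auto simp: box_def)
    then have "S (i, Suc j) = None" "S (Suc i, j) = None" using box by blast+
    then show ?thesis using sl unfolding ij by (auto elim: slide.cases)
  qed
  then have box': "dom S' \<subseteq> box n" using dom' box by (cases "c \<in> box n") auto
  show "skew_tableau r n S'" by (rule skew_tableauI[OF ok' box' _ d' P']) (use ran ran' in simp)
  have "dom S' = cells_le S' r" using dom_cells_le ran ran' by simp
  then show "\<exists>L'. dset L' \<and> R - {c} \<subseteq> L' \<and> dom S' = L' - (R - {c})"
    using d'[of r] P' by (intro exI[of _ "?P \<union> cells_le S' r"]) auto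
  assume q: "q \<le> r"
  show "reading_shape n S' q = reading_shape n S q"
  proof (cases "c \<in> box n")
    case False then show ?thesis using out by simp
  next
    case True
    \<comment> \<open>The auxiliary standard filling of the inner shape must fit into the box of the
      reading word. Cutting \<open>L\<close> and \<open>R\<close> down to the box neither changes
      the domain of \<open>S\<close> nor the slide.\<close>
    let ?R = "R \<inter> box n" and ?L = "L \<inter> box n"
    have RL: "dset ?L" "dset ?R" "?R \<subseteq> ?L" "dom S = ?L - ?R" using L R dset_Int dset_box box dom by auto
    have "?R - {c} = (R - {c}) \<inter> box n" by auto
    then have c': "c \<in> ?R" "dset (?R - {c})" using c True dset_Int dset_box by auto
    have g: "slide_faces (?R - {c}) c S 0 S'" using slide_faces[OF sl slide_state_start[OF S RL c']] .
    have e: "insert c ((?R - {c}) \<union> cells_le S v) = ?R \<union> cells_le S v" for v using c' by auto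
    show ?thesis
    proof (rule slide_reading_shape[OF ok ok' box box' ran _ RL(2) _ c' _ _ _ q])
      show "ran S' \<subseteq> {..r}" using ran ran' by simp
      show "?R \<inter> dom S = {}" using RL(4) by auto
      show "(?R - {c}) \<inter> dom S' = {}" using P' by auto
      fix v show "jdtface ((?R - {c}) \<union> cells_le S' v) (?R \<union> cells_le S v)
                  ((?R - {c}) \<union> cells_le S' (Suc v)) (?R \<union> cells_le S (Suc v))"
        using slide_facesD(5)[OF g] unfolding e by simp
    qed simp
  qed
qed

section \<open>Rectification\<close>

lemma slide_exists:
  "entries_ok S \<Longrightarrow> dom S \<subseteq> box n \<Longrightarrow> \<exists>S'. slide (i, j) S S'"
proof (induction "2 * n - (i + j)" arbitrary: S i j rule: less_induct)
  case less
  have move: "\<exists>S'. slide (i', j') (S((i, j) := Some x, (i', j') := None)) S'"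
    if "S (i', j') = Some x" "adjacent (i, j) (i', j')" for i' j' x
  proof (rule less.hyps)
    have b: "(i', j') \<in> box n" using that less.prems by auto
    then show "2 * n - (i' + j') < 2 * n - (i + j)" using that(2) by (auto simp: adjacent_def box_def)
    have "x \<noteq> 0" using less.prems(1) that(1) unfolding entries_ok_def by metis
    have "S c = Some y \<Longrightarrow> S c' = Some y \<Longrightarrow> c = c'" for c c' y using less.prems(1) unfolding entries_ok_def by blast
    then show "entries_ok (S((i, j) := Some x, (i', j') := None))"
      using less.prems(1) that(1) \<open>x \<noteq> 0\<close> unfolding entries_ok_def by auto
    have "(i, j) \<in> box n" using b that(2) by (auto simp: adjacent_def box_def)
    then show "dom (S((i, j) := Some x, (i', j') := None)) \<subseteq> box n" using less.prems(2) by auto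
  qed
  have ne: "x \<noteq> y" if "S (i, Suc j) = Some x" "S (Suc i, j) = Some y" for x y
    using that less.prems(1) unfolding entries_ok_def by (metis n_not_Suc_n prod.inject)
  have right: ?case if "S (i, Suc j) = Some x" "\<forall>y. S (Suc i, j) = Some y \<longrightarrow> x < y" for x
  proof -
    have "adjacent (i, j) (i, Suc j)" by (simp add: adjacent_def)
    then show ?thesis using move[OF that(1)] slide.right[OF that] by blast
  qed
  have down: ?case if "S (Suc i, j) = Some y" "\<forall>x. S (i, Suc j) = Some x \<longrightarrow> y < x" for y
  proof -
    have "adjacent (i, j) (Suc i, j)" by (simp add: adjacent_def)
    then show ?thesis using move[OF that(1)] slide.down[OF that] by blast
  qed
  show ?case
  proof (cases "S (i, Suc j)")
    case None
    then show ?thesis using down slide.stop[of S i j] by (cases "S (Suc i, j)") auto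
  next
    case (Some x)
    show ?thesis
    proof (cases "S (Suc i, j)")
      case None then show ?thesis using right[OF Some] by simp
    next
      case s: (Some y)
      then have "x < y \<or> y < x" using ne[OF Some] by auto
      then show ?thesis using right[OF Some] down[OF s] Some s by auto
    qed
  qed
qed

lemma rectification_exists:
  assumes "skew_tableau r n S" "dset L" "dset R" "R \<subseteq> L" "dom S = L - R"
  shows "\<exists>U. jdt_step\<^sup>*\<^sup>* S U \<and> dset (dom U)"
  using assms
proof (induction "card R" arbitrary: S L R)
  case 0
  then have "R = {}" using dset_finite by auto
  then show ?case using 0 by auto
next
  case (Suc k)
  then have "R \<noteq> {}" by auto
  then obtain c where c: "c \<in> R" "dset (R - {c})" using corner_exists Suc.prems by blast
  obtain S' where S': "slide c S S'" using slide_exists[of S n "fst c" "snd c"] Suc.prems unfolding skew_tableau_def by auto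
  note p = slide_preserves[OF Suc.prems c S']
  obtain L' where L': "dset L'" "R - {c} \<subseteq> L'" "dom S' = L' - (R - {c})" using p(3) by blast
  have "k = card (R - {c})" using Suc.hyps(2) c(1) by simp
  then obtain U where U: "jdt_step\<^sup>*\<^sup>* S' U" "dset (dom U)" using Suc.hyps(1)[OF _ p(1) L'(1) c(2) L'(2,3)] by blast
  have "jdt_step S S'" unfolding jdt_step_def inner_corner_def is_ferrers_iff using Suc.prems c S' by blast
  then show ?case using U by (meson converse_rtranclp_into_rtranclp)
qed

lemma chain_filling_cong: "(\<And>i. i \<le> r \<Longrightarrow> Z i = Z' i) \<Longrightarrow> chain_filling r Z = chain_filling r Z'"
proof -
  assume e: "\<And>i. i \<le> r \<Longrightarrow> Z i = Z' i"
  have "(1 \<le> i \<and> i \<le> r \<and> c \<in> sym_diff (Z (i - 1)) (Z i)) = (1 \<le> i \<and> i \<le> r \<and> c \<in> sym_diff (Z' (i - 1)) (Z' i))" for c i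
    using e[of i] e[of "i - 1"] by (cases "i \<le> r") auto
  then show ?thesis unfolding chain_filling_def by presburger
qed

text \<open>Slides preserve the reading shapes, and a straight tableau is determined by them. So
  every straight result is the same filling, and independence of the order of the slides is a
  consequence rather than an ingredient.\<close>

lemma rectification_eq:
  assumes S: "skew_tableau r n S" and L: "dset L" "dset R" "R \<subseteq> L" "dom S = L - R"
    and Z: "\<And>q. q \<le> r \<Longrightarrow> reading_shape n S q = Z q"
  shows "rectification S = chain_filling r Z"
proof -
  have U: "U = chain_filling r Z" if "jdt_step\<^sup>*\<^sup>* S U" "dset (dom U)" for U
  proof -
    have "skew_tableau r n U \<and> (\<forall>q\<le>r. reading_shape n U q = Z q)"
      using that(1)
    proof (induction rule: rtranclp_induct)
      case base then show ?case using S Z by blast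
    next
      case (step S1 S2)
      then obtain c L R where "dset L" "dset R" "R \<subseteq> L" "dom S1 = L - R" "c \<in> R" "dset (R - {c})" "slide c S1 S2"
        unfolding jdt_step_def inner_corner_def is_ferrers_iff by blast
      then show ?case using slide_preserves[of r n S1 L R c S2] step.IH by simp
    qed
    then have sk: "skew_tableau r n U" and W: "\<And>q. q \<le> r \<Longrightarrow> reading_shape n U q = Z q" by blast+
    have ok: "entries_ok U" and box: "dom U \<subseteq> box n" and ran: "ran U \<subseteq> {..r}" using sk unfolding skew_tableau_def by auto
    have "dset (cells_le U v)" for v using skew_tableau_dset[OF sk that(2), of "{}" v] by simp
    then have "tableau U" using ok unfolding tableau_def by blast
    then have "cells_le U q = Z q" if "q \<le> r" for q
      using sh_reading_tableau[OF _ box, of "n * n" q] W[OF that] unfolding reading_shape_def by simp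
    moreover have "dom U \<subseteq> cells_le U r" using dom_cells_le[OF ran] by simp
    ultimately show ?thesis using chain_filling_cells_le[OF ok] chain_filling_cong by metis
  qed
  obtain U0 where "jdt_step\<^sup>*\<^sup>* S U0" "dset (dom U0)" using rectification_exists[OF S L] by blast
  then show ?thesis unfolding rectification_def is_ferrers_iff using U by (intro the_equality) blast+
qed

section \<open>Rotation of tableaux and of their reading words\<close>

lemma sh_height:
  assumes X: "pperm X" and h: "\<And>i y. X i y \<Longrightarrow> y < k" "s \<le> k" "k \<le> h"
  shows "sh X p q s h = sh X p q s k"
  using h(3)
proof (induction h rule: dec_induct)
  case (step h)
  have "\<not> X i h" for i using h(1)[of i h] step by auto
  then show ?case using sh_row_empty_upper[OF X, of s h p q] step h(2) by simp
qed simp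

lemma reading_less: "dom T \<subseteq> box n \<Longrightarrow> reading n T i y \<Longrightarrow> y < n * n"
  unfolding reading_def using pos_inv(3) by blast

lemma dset_projections:
  assumes "dset D"
  shows "fst ` D = {..<card (fst ` D)}" "snd ` D = {..<card (snd ` D)}"
proof -
  have fin: "finite (fst ` D)" "finite (snd ` D)" using dset_finite[OF assms] by auto
  have "i' \<in> fst ` D" if "i \<in> fst ` D" "i' \<le> i" for i i'
  proof -
    obtain j where "(i, j) \<in> D" using \<open>i \<in> fst ` D\<close> by force
    then have "(i', j) \<in> D" using dsetD[OF assms] that by blast
    then show ?thesis by force
  qed
  then have "k \<in> fst ` D \<longleftrightarrow> k < card (fst ` D)" for k by (intro downset_nat[OF fin(1)])
  then show "fst ` D = {..<card (fst ` D)}" by (intro set_eqI) (simp only: lessThan_iff)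
  have "j' \<in> snd ` D" if "j \<in> snd ` D" "j' \<le> j" for j j'
  proof -
    obtain i where "(i, j) \<in> D" using \<open>j \<in> snd ` D\<close> by force
    then have "(i, j') \<in> D" using dsetD[OF assms] that by blast
    then show ?thesis by force
  qed
  then have "k \<in> snd ` D \<longleftrightarrow> k < card (snd ` D)" for k by (intro downset_nat[OF fin(2)])
  then show "snd ` D = {..<card (snd ` D)}" by (intro set_eqI) (simp only: lessThan_iff)
qed

text \<open>The matrix \<open>X\<close> may differ from the reading word of \<open>T\<close>:
  agreement of the shapes of initial columns carries over to all windows of columns. Rotation of
  \<open>T\<close> rotates its word, which turns final columns into initial ones and leaves shapes
  untransposed.\<close>

lemma schuetzenberger_evacuation_eq:
  assumes T: "tableau T" and ran: "ran T \<subseteq> {..r}"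
    and X: "pperm X" and XT: "\<And>q. q \<le> r \<Longrightarrow> sh X 0 q s t = cells_le T q"
  shows "schuetzenberger_evacuation r T = chain_filling r (\<lambda>q. sh X (r - q) r s t)"
proof -
  define D where "D = dom T"
  have ok: "entries_ok T" using T unfolding tableau_def by blast
  have dD: "dset D" using T dom_cells_le[OF ran] unfolding D_def tableau_def by simp
  define a where "a = card (fst ` D)"
  define b where "b = card (snd ` D)"
  have ab: "i < a \<and> j < b" if "(i, j) \<in> D" for i j
    using that dset_projections[OF dD] unfolding a_def b_def by force
  define S where "S = rotate_complement r T"
  have S: "S (i, j) = (if i < a \<and> j < b then map_option (\<lambda>x. r + 1 - x) (T (a - 1 - i, b - 1 - j)) else None)" for i j
    unfolding S_def rotate_complement_def Let_def a_def b_def D_def by simp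
  have Tr: "1 \<le> x \<and> x \<le> r" if "T c = Some x" for c x
    using that ok ranI[of T c x] ran unfolding entries_ok_def by (cases x) auto
  have S_Some: "S (i, j) = Some x \<longleftrightarrow> i < a \<and> j < b \<and> x \<le> r \<and> 1 \<le> x \<and> T (a - 1 - i, b - 1 - j) = Some (r + 1 - x)" for i j x
  proof
    assume "S (i, j) = Some x"
    then obtain y where y: "i < a" "j < b" "T (a - 1 - i, b - 1 - j) = Some y" "x = r + 1 - y"
      unfolding S by (auto split: if_splits)
    then show "i < a \<and> j < b \<and> x \<le> r \<and> 1 \<le> x \<and> T (a - 1 - i, b - 1 - j) = Some (r + 1 - x)"
      using Tr[OF y(3)] by auto
  next
    assume "i < a \<and> j < b \<and> x \<le> r \<and> 1 \<le> x \<and> T (a - 1 - i, b - 1 - j) = Some (r + 1 - x)"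
    then show "S (i, j) = Some x" unfolding S by auto
  qed
  define n where "n = a + b + 1"
  define L where "L = {..<a} \<times> {..<b}"
  define R where "R = {(i, j). i < a \<and> j < b \<and> (a - 1 - i, b - 1 - j) \<notin> D}"
  have RS: "R \<union> cells_le S v = {(i, j). i < a \<and> j < b \<and> (a - 1 - i, b - 1 - j) \<notin> cells_le T (r - v)}" for v
  proof -
    have "(i, j) \<in> R \<union> cells_le S v \<longleftrightarrow> (a - 1 - i, b - 1 - j) \<notin> cells_le T (r - v)" if "i < a" "j < b" for i j
    proof (cases "T (a - 1 - i, b - 1 - j)")
      case None
      then show ?thesis using that unfolding R_def D_def cells_le_def by auto
    next
      case (Some x)
      have "S (i, j) = Some (r + 1 - x)" using that Some unfolding S by simp
      then have "(i, j) \<in> cells_le S v \<longleftrightarrow> r + 1 - x \<le> v" unfolding cells_le_def by simp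
      moreover have "(a - 1 - i, b - 1 - j) \<in> cells_le T (r - v) \<longleftrightarrow> x \<le> r - v" unfolding cells_le_def using Some by simp
      moreover have "(i, j) \<notin> R" using Some unfolding R_def D_def by auto
      ultimately show ?thesis using Tr[OF Some] by auto
    qed
    moreover have "i < a \<and> j < b" if "(i, j) \<in> R \<union> cells_le S v" for i j
      using that S_Some unfolding R_def cells_le_def by auto
    ultimately show ?thesis by blast
  qed
  have dR: "dset (R \<union> cells_le S v)" for v
  proof -
    have dT: "dset (cells_le T (r - v))" using T unfolding tableau_def by blast
    have "(i', j') \<in> R \<union> cells_le S v" if ij: "(i, j) \<in> R \<union> cells_le S v" "i' \<le> i" "j' \<le> j" for i j i' j'
    proof -
      have "(a - 1 - i', b - 1 - j') \<notin> cells_le T (r - v)"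
      proof
        assume "(a - 1 - i', b - 1 - j') \<in> cells_le T (r - v)"
        then have "(a - 1 - i, b - 1 - j) \<in> cells_le T (r - v)"
          by (rule dsetD[OF dT]) (use ij in auto)
        then show False using ij(1) unfolding RS by simp
      qed
      then show ?thesis using ij unfolding RS by simp
    qed
    moreover have "finite (R \<union> cells_le S v)"
      unfolding RS by (rule finite_subset[of _ "{..<a} \<times> {..<b}"]) auto
    ultimately show ?thesis unfolding dset_def by blast
  qed
  have okS: "entries_ok S" unfolding entries_ok_def
  proof (intro conjI allI impI)
    fix c c' x assume c: "S c = Some x" "S c' = Some x"
    obtain i j i' j' where ij: "c = (i, j)" "c' = (i', j')" by fastforce
    have 1: "i < a" "j < b" "i' < a" "j' < b" using c unfolding ij S_Some by auto
    have "(a - 1 - i, b - 1 - j) = (a - 1 - i', b - 1 - j')" using c ok unfolding ij S_Some entries_ok_def by blast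
    then show "c = c'" using 1 ij by auto
  next
    fix c show "S c \<noteq> Some 0" by (cases c) (simp add: S_Some)
  qed
  have ranS: "ran S \<subseteq> {..r}" unfolding ran_def using S_Some by auto
  have domS: "dom S = L - R"
  proof -
    have "(i, j) \<in> dom S \<longleftrightarrow> (i, j) \<in> L - R" for i j
      unfolding L_def R_def D_def domIff S by (auto simp: domIff)
    then show ?thesis by auto
  qed
  have boxL: "L \<subseteq> box n" unfolding L_def box_def n_def by auto
  have boxS: "dom S \<subseteq> box n" using domS boxL by blast
  have boxT: "dom T \<subseteq> box n" using ab unfolding D_def box_def n_def by fastforce
  have RD: "R \<inter> dom S = {}" using domS by blast
  have sk: "skew_tableau r n S" by (rule skew_tableauI[OF okS boxS ranS dR RD])
  have dL: "dset L" unfolding L_def dset_def by auto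
  have dR0: "dset R" using dR[of 0] cells_le_0[OF okS] by simp
  have RL: "R \<subseteq> L" unfolding R_def L_def by auto
  let ?X = "reading n T" and ?Y = "reading n S"
  have pX: "pperm ?X" and pY: "pperm ?Y" using pperm_reading ok okS boxT boxS by blast+
  \<comment> \<open>A cell and its rotation have positions with sum \<open>h - 1\<close>. The
    rectangle need not be centred in the box, so the word is rotated within \<open>h\<close> rows,
    of which those from \<open>n * n\<close> on are empty.\<close>
  define h where "h = (2 * n - 1 - b) * n + a"
  have h: "n * n \<le> h" unfolding h_def by (rule order_trans[OF mult_right_mono[of n "2 * n - 1 - b"] le_add1]) (auto simp: n_def)
  have posr: "pos n (i, j) + pos n (a - 1 - i, b - 1 - j) + 1 = h" if "i < a" "j < b" for i j
  proof -
    have "(n - Suc j) + (n - Suc (b - 1 - j)) = 2 * n - 1 - b" using that unfolding n_def by auto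
    then have "(n - Suc j) * n + (n - Suc (b - 1 - j)) * n = (2 * n - 1 - b) * n" by (metis add_mult_distrib)
    then show ?thesis using that unfolding pos_def h_def by simp
  qed
  have rot: "?Y i y \<longleftrightarrow> ?X (r - Suc i) (h - Suc y)" if "i < r" "y < h" for i y
  proof
    assume "?Y i y"
    then obtain k l where kl: "S (k, l) = Some (Suc i)" "pos n (k, l) = y" unfolding reading_def by auto
    then have "T (a - 1 - k, b - 1 - l) = Some (Suc (r - Suc i))" "k < a" "l < b" using that unfolding S_Some by (auto simp: Suc_diff_Suc)
    moreover have "pos n (a - 1 - k, b - 1 - l) = h - Suc y" using posr[of k l] calculation kl by simp
    ultimately show "?X (r - Suc i) (h - Suc y)" unfolding reading_def by blast
  next
    assume "?X (r - Suc i) (h - Suc y)"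
    then obtain k l where kl: "T (k, l) = Some (Suc (r - Suc i))" "pos n (k, l) = h - Suc y" unfolding reading_def by auto
    then have "k < a" "l < b" using ab unfolding D_def by blast+
    then have "k = a - 1 - (a - 1 - k)" "l = b - 1 - (b - 1 - l)" "a - 1 - k < a" "b - 1 - l < b" by auto
    then have "S (a - 1 - k, b - 1 - l) = Some (Suc i)"
      using kl(1) that unfolding S_Some by (auto simp: Suc_diff_Suc)
    moreover have "pos n (a - 1 - k, b - 1 - l) = y"
      using kl(2) posr[OF \<open>k < a\<close> \<open>l < b\<close>] that by linarith
    ultimately show "?Y i y" unfolding reading_def by blast
  qed
  have bound: "i < r \<and> y < h" if "?Y i y" for i y
  proof -
    have "i < r" using that S_Some unfolding reading_def by fastforce
    then show ?thesis using reading_less[OF boxS that] h by simp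
  qed
  have "reading_shape n S q = sh X (r - q) r s t" if q: "q \<le> r" for q
  proof -
    have "reading_shape n S q = sh ?Y 0 q 0 h"
      unfolding reading_shape_def by (rule sh_height[OF pY reading_less[OF boxS] _ h, symmetric]) simp_all
    also have "\<dots> = sh ?X (r - q) r 0 h"
    proof -
      have "sh ?Y (r - r) (r - (r - q)) (h - h) (h - 0) = sh ?X (r - q) r 0 h"
        by (rule sh_rotate[OF pX le_refl le_refl rot bound])
      then show ?thesis using q by simp
    qed
    also have "\<dots> = sh ?X (r - q) r 0 (n * n)"
      by (rule sh_height[OF pX reading_less[OF boxT] _ h]) simp_all
    also have "\<dots> = sh X (r - q) r s t"
    proof (rule sh_triangle_unique[OF pX X, where k = 0 and m = r])
      fix q assume "q \<le> r"
      then show "sh ?X 0 q 0 (n * n) = sh X 0 q s t" using XT[of q] sh_reading_tableau[OF T boxT le_refl, of q] by simp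
    qed simp_all
    finally show ?thesis .
  qed
  then show ?thesis unfolding schuetzenberger_evacuation_def S_def[symmetric]
    by (rule rectification_eq[OF sk dL dR0 RL domS])
qed

section \<open>Sorting rules\<close>

text \<open>In every local rule the vector to be sorted differs from the sorted one by at most one
  exchange of two entries.\<close>

lemma sort_desc_eq:
  fixes v w :: "nat \<Rightarrow> int"
  assumes mono: "\<And>i j. i \<le> j \<Longrightarrow> w j \<le> w i" and supp: "\<And>i. N \<le> i \<Longrightarrow> w i = 0"
    and perm: "v = w \<or> (\<exists>i<N. \<exists>j<N. v = w(i := w j, j := w i))"
  shows "sort_desc N v = w"
proof -
  have "mset (map v [0..<N]) = mset (map w [0..<N])"
    using perm
  proof
    assume "\<exists>i<N. \<exists>j<N. v = w(i := w j, j := w i)"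
    then obtain i j where ij: "i < N" "j < N" "v = w(i := w j, j := w i)" by blast
    let ?l = "map w [0..<N]"
    have "map v [0..<N] = ?l[i := ?l ! j, j := ?l ! i]"
      using ij by (intro nth_equalityI) (auto simp: nth_list_update)
    then show ?thesis using mset_swap[of j ?l i] ij by simp
  qed simp
  moreover have "sorted (rev (map w [0..<N]))"
    unfolding sorted_rev_iff_nth_mono using mono by simp
  ultimately have "sort (map v [0..<N]) = rev (map w [0..<N])"
    by (intro properties_for_sort) simp_all
  then show ?thesis unfolding sort_desc_def using supp by (intro ext) simp
qed

lemma rl_antimono: "dset D \<Longrightarrow> i \<le> j \<Longrightarrow> rl D j \<le> rl D i"
  using is_partition_rl unfolding is_partition_def by (simp add: antimonoD)

lemma rl_mono: assumes "dset D" "dset E" "D \<subseteq> E" shows "rl D i \<le> rl E i"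
proof (rule ccontr)
  assume "\<not> ?thesis"
  then have "(i, rl E i) \<in> D" using mem_dset[OF assms(1)] by simp
  then show False using assms(3) mem_dset[OF assms(2)] by blast
qed

definition height_le :: "nat \<Rightarrow> cell set \<Rightarrow> bool" where
  "height_le n D \<longleftrightarrow> (\<forall>(i, j)\<in>D. i < n)"

lemma height_le_rl: "height_le n D \<Longrightarrow> n \<le> i \<Longrightarrow> rl D i = 0"
proof -
  assume "height_le n D" "n \<le> i"
  then have "{j. (i, j) \<in> D} = {}" unfolding height_le_def by auto
  then show ?thesis unfolding rl_def by (metis card.empty)
qed

lemma height_le_subset: "height_le n D \<Longrightarrow> E \<subseteq> D \<Longrightarrow> height_le n E"
  unfolding height_le_def by blast

lemma face_rl:
  assumes "face False rel init A B C D"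
  obtains (union) "\<And>i. rl A i + rl D i = rl B i + rl C i"
  | (chain) i k where "rl B = (rl A)(i := Suc (rl A i))" "rl C = rl B" "rl D = (rl B)(k := Suc (rl B k))"
      "rel (i, rl A i) (k, rl B k)" "(k, rl B k) \<in> D" "(i, rl A i) \<in> B" "B = C"
proof -
  note d = face_dset[OF assms]
  show ?thesis
    using assms
  proof (cases rule: face_cases)
    case left then show ?thesis using union by simp
  next
    case right then show ?thesis using union by simp
  next
    case u: (union x y)
    obtain i j k l where xy: "x = (i, j)" "y = (k, l)" by fastforce
    have B: "rl B = (rl A)(i := Suc (rl A i))" using rl_insert(1)[OF d(1), of i j] d(2) u xy by simp
    have C: "rl C = (rl A)(k := Suc (rl A k))" "rl A k = l" using rl_insert[OF d(1), of k l] d(3) u xy by simp_all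
    have "rl D = (rl C)(i := Suc (rl C i))" using rl_insert(1)[OF d(3), of i j] d(4) u xy by simp
    moreover have "i \<noteq> k" using u(1) rl_insert(2)[OF d(1), of i j] d(2) u xy C(2) by auto
    ultimately show ?thesis using B C by (intro union) simp
  next
    case c: (chain x y)
    obtain i j k l where xy: "x = (i, j)" "y = (k, l)" by fastforce
    have "rl B = (rl A)(i := Suc (rl A i))" "rl A i = j" using rl_insert[OF d(1), of i j] d(2) c xy by simp_all
    moreover have "rl D = (rl B)(k := Suc (rl B k))" "rl B k = l" using rl_insert[OF d(2), of k l] d(4) c xy by simp_all
    ultimately show ?thesis using c xy by (intro chain[of i k]) simp_all
  qed
qed

lemma sort_colface_lower:
  assumes f: "colface False A B C D" and h: "height_le n D"
  shows "sort_desc n (\<lambda>i. int (rl B i) + int (rl C i) - int (rl D i)) = (\<lambda>i. int (rl A i))"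
proof (rule sort_desc_eq)
  note d = face_dset[OF f]
  show "\<And>i j. i \<le> j \<Longrightarrow> int (rl A j) \<le> int (rl A i)" using rl_antimono[OF d(1)] by simp
  have "height_le n A" using h le1_subset[OF d(5)] le1_subset[OF face_le1(1)[OF f]] height_le_subset by blast
  then show "\<And>i. n \<le> i \<Longrightarrow> int (rl A i) = 0" using height_le_rl by simp
  show "(\<lambda>i. int (rl B i) + int (rl C i) - int (rl D i)) = (\<lambda>i. int (rl A i)) \<or>
    (\<exists>i<n. \<exists>j<n. (\<lambda>i. int (rl B i) + int (rl C i) - int (rl D i)) = (\<lambda>i. int (rl A i))(i := int (rl A j), j := int (rl A i)))"
    using f
  proof (cases rule: face_rl)
    case union
    then have "int (rl B i) + int (rl C i) - int (rl D i) = int (rl A i)" for i using union[of i] by linarith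
    then show ?thesis by simp
  next
    case (chain i k)
    have "i < n" "k < n" using chain(5,6) h le1_subset[OF face_le1(1)[OF f]] unfolding height_le_def by blast+
    \<comment> \<open>With \<open>B = C\<close> the vector adds one to row \<open>i\<close> of
      \<open>A\<close> and subtracts one from row \<open>k\<close>. Consecutive columns mean
      \<open>rl B k = rl A i + 1\<close>, so this exchanges the two row lengths (and changes nothing
      if \<open>i = k\<close>).\<close>
    moreover have "(\<lambda>i. int (rl B i) + int (rl C i) - int (rl D i)) = (\<lambda>i. int (rl A i))(i := int (rl A k), k := int (rl A i))"
      using chain(4) unfolding chain(1,2,3) by (auto simp: fun_eq_iff)
    ultimately show ?thesis by blast
  qed
qed

text \<open>Without a cross, the second cell of a chain is never in the first column, so its row is
  already occupied and the bound \<open>n\<close> on the number of rows is kept.\<close>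

lemma height_le_colface_upper:
  assumes f: "colface False A B C D" and h: "height_le n B" "height_le n C"
  shows "height_le n D"
  using f
proof (cases rule: face_cases)
  case left then show ?thesis using h by simp
next
  case right then show ?thesis using h by simp
next
  case (union x y) then show ?thesis using h unfolding height_le_def by auto
next
  case (chain x y)
  have yD: "(fst y, snd y) \<in> D" using chain(5) by simp
  have "(fst y, snd x) \<in> D" by (rule dsetD[OF face_dset(4)[OF f] yD]) (use chain(6) in simp_all)
  moreover have "(fst y, snd x) \<noteq> y" using chain(6) by (metis n_not_Suc_n snd_conv)
  ultimately have "(fst y, snd x) \<in> B" unfolding chain(5) by blast
  then have "fst y < n" using h unfolding height_le_def by blast
  then show ?thesis using h chain unfolding height_le_def by auto
qed

lemma sort_colface_upper:
  assumes f: "colface False A B C D" and h: "height_le n B" "height_le n C"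
  shows "sort_desc n (\<lambda>i. int (rl B i) + int (rl C i) - int (rl A i)) = (\<lambda>i. int (rl D i))"
proof (rule sort_desc_eq)
  note d = face_dset[OF f]
  show "\<And>i j. i \<le> j \<Longrightarrow> int (rl D j) \<le> int (rl D i)" using rl_antimono[OF d(4)] by simp
  have hD: "height_le n D" by (rule height_le_colface_upper[OF f h])
  then show "\<And>i. n \<le> i \<Longrightarrow> int (rl D i) = 0" using height_le_rl by simp
  show "(\<lambda>i. int (rl B i) + int (rl C i) - int (rl A i)) = (\<lambda>i. int (rl D i)) \<or>
    (\<exists>i<n. \<exists>j<n. (\<lambda>i. int (rl B i) + int (rl C i) - int (rl A i)) = (\<lambda>i. int (rl D i))(i := int (rl D j), j := int (rl D i)))"
    using f
  proof (cases rule: face_rl)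
    case union
    then have "int (rl B i) + int (rl C i) - int (rl A i) = int (rl D i)" for i using union[of i] by linarith
    then show ?thesis by simp
  next
    case (chain i k)
    have "i < n" "k < n" using chain(5,6) hD h(1) unfolding height_le_def by blast+
    moreover have "(\<lambda>i. int (rl B i) + int (rl C i) - int (rl A i)) = (\<lambda>i. int (rl D i))(i := int (rl D k), k := int (rl D i))"
      using chain(4) unfolding chain(1,2,3) by (auto simp: fun_eq_iff)
    ultimately show ?thesis by blast
  qed
qed

lemma sort_jdtface:
  assumes f: "jdtface A B C D" and h: "height_le n D"
  shows "sort_desc n (\<lambda>i. int (rl A i) + int (rl D i) - int (rl B i)) = (\<lambda>i. int (rl C i))"
proof (rule sort_desc_eq)
  note d = face_dset[OF f]
  show "\<And>i j. i \<le> j \<Longrightarrow> int (rl C j) \<le> int (rl C i)" using rl_antimono[OF d(3)] by simp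
  have "height_le n C" using h le1_subset[OF face_le1(2)[OF f]] height_le_subset by blast
  then show "\<And>i. n \<le> i \<Longrightarrow> int (rl C i) = 0" using height_le_rl by simp
  show "(\<lambda>i. int (rl A i) + int (rl D i) - int (rl B i)) = (\<lambda>i. int (rl C i)) \<or>
    (\<exists>i<n. \<exists>j<n. (\<lambda>i. int (rl A i) + int (rl D i) - int (rl B i)) = (\<lambda>i. int (rl C i))(i := int (rl C j), j := int (rl C i)))"
    using f
  proof (cases rule: face_rl)
    case union
    then have "int (rl A i) + int (rl D i) - int (rl B i) = int (rl C i)" for i using union[of i] by linarith
    then show ?thesis by simp
  next
    case (chain i k)
    have "i < n" "k < n" using chain(5,6) h le1_subset[OF face_le1(1)[OF f]] unfolding height_le_def by blast+
    \<comment> \<open>Adjacent cells lie either in the same row, where nothing has to be sorted, or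
      in the same column, where rows \<open>i\<close> and \<open>k\<close> have equal length in
      \<open>A\<close> and the wrong one of them is increased.\<close>
    moreover have "(\<lambda>i. int (rl A i) + int (rl D i) - int (rl B i)) = (\<lambda>i. int (rl C i))(i := int (rl C k), k := int (rl C i))"
      using chain(4) unfolding chain(1,2,3) adjacent_def by (auto simp: fun_eq_iff)
    ultimately show ?thesis by blast
  qed
qed

section \<open>Sundaram's backward rule\<close>

lemma conjugate_rl: "dset D \<Longrightarrow> conjugate (rl D) = rl (tr D)"
  unfolding conjugate_def rl_def[of "tr D"] by (simp add: mem_dset)

lemma rl_inject: "dset D \<Longrightarrow> dset E \<Longrightarrow> rl D = rl E \<longleftrightarrow> D = E"
  by (metis ferrers_rl)

lemma rowface_unique: "rowface c A B C D \<Longrightarrow> rowface c A B C D' \<Longrightarrow> D = D'"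
  using colface_unique[OF rowface_tr rowface_tr] tr_inject by metis

text \<open>Conjugation turns the square into a \<open>colface\<close>, whose smallest corner is
  found by sorting.\<close>

lemma rowface_backward:
  assumes f: "rowface x A B C D"
  shows "backward_rule (rl B) (rl D) (rl C) = rl A" "has_cross (rl B) (rl D) (rl C) \<longleftrightarrow> x"
proof -
  note d = face_dset[OF f]
  have "backward_rule (rl B) (rl D) (rl C) = rl A \<and> (has_cross (rl B) (rl D) (rl C) \<longleftrightarrow> x)"
  proof (cases x)
    case True
    then obtain y where y: "B = A" "C = A" "y \<notin> A" "D = insert y A" "fst y = 0" using f by (auto simp: face_def)
    obtain j where "y = (0, j)" using y(5) by (cases y) auto
    then have "rl D = (rl A)(0 := rl A 0 + 1)" using rl_insert(1)[OF d(1), of 0 j] d(4) y by simp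
    then have "has_cross (rl B) (rl D) (rl C)" unfolding has_cross_def using y by simp
    then show ?thesis unfolding backward_rule_def using True y(1) by simp
  next
    case F: False
    then have f': "rowface False A B C D" using f by simp
    \<comment> \<open>The pattern of a cross would put the second cell of a chain into row 0, but
      \<open>rowface\<close> puts it below another row.\<close>
    have nc: "\<not> has_cross (rl B) (rl D) (rl C)"
    proof
      assume "has_cross (rl B) (rl D) (rl C)"
      then have BC: "B = C" "rl D 0 = Suc (rl B 0)" using rl_inject[OF d(2,3)] unfolding has_cross_def by auto
      show False
        using f'
      proof (cases rule: face_cases)
        case left then show False using BC by simp
      next
        case right then show False using BC by simp
      next
        case (union x y)
        then have "x \<in> B" "x \<notin> C" by auto
        then show False using BC by simp
      next
        case (chain x y)
        obtain k l where y: "y = (k, l)" by fastforce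
        have D: "D = insert (k, l) B" "(k, l) \<notin> B" "k \<noteq> 0" using chain(4,5,6) y by simp_all
        have "rl D = (rl B)(k := Suc (rl B k))"
          unfolding D(1) by (rule rl_insert(1)[OF d(2) _ D(2)]) (use d(4) D(1) in simp)
        then show False using BC D(3) by simp
      qed
    qed
    have t: "colface False (tr A) (tr B) (tr C) (tr D)" by (rule rowface_tr[OF f'])
    \<comment> \<open>The first row of \<open>D\<close> bounds the number of rows of its transpose,
      so sorting \<open>rl D 0\<close> entries loses nothing.\<close>
    have "height_le (rl D 0) (tr D)"
      unfolding height_le_def
    proof clarify
      fix i j assume "(i, j) \<in> tr D"
      then have "(0, i) \<in> D" using dsetD[OF d(4), of j i 0 i] by simp
      then show "i < rl D 0" by (simp add: mem_dset[OF d(4)])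
    qed
    from sort_colface_lower[OF t this]
    have "backward_rule (rl B) (rl D) (rl C) = conjugate (\<lambda>j. rl (tr A) j)"
      unfolding backward_rule_def using nc d by (simp add: conjugate_rl)
    also have "\<dots> = rl A" using conjugate_rl[of "tr A"] d(1) by simp
    finally show ?thesis using nc F by simp
  qed
  then show "backward_rule (rl B) (rl D) (rl C) = rl A" "has_cross (rl B) (rl D) (rl C) \<longleftrightarrow> x" by blast+
qed

text \<open>Together with \<open>rowface_backward\<close> this shows that the backward rule always
  completes a square, so the labels it computes are diagrams again.\<close>

lemma rowface_exists:
  assumes B: "dset B" and C: "dset C" and D: "dset D" and le: "le1 B D" "le1 C D"
  shows "\<exists>x A. rowface x A B C D"
proof -
  consider "B = D" | "C = D" | "B \<noteq> D" "C \<noteq> D" "B \<noteq> C" | "B \<noteq> D" "B = C" by blast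
  then show ?thesis
  proof cases
    case 1 then show ?thesis using face_trivial(2)[OF C D le(2)] by blast
  next
    case 2 then show ?thesis using face_trivial(1)[OF B D le(1)] by blast
  next
    case 3
    obtain x where x: "x \<notin> B" "D = insert x B" using le(1) 3(1) unfolding le1_def by blast
    obtain y where y: "y \<notin> C" "D = insert y C" using le(2) 3(2) unfolding le1_def by blast
    have xy: "x \<noteq> y"
    proof
      assume "x = y"
      then have "insert x B = insert x C" using x(2) y(2) by simp
      then have "B = C" using x(1) y(1) \<open>x = y\<close> by (simp add: insert_ident)
      then show False using 3(3) by simp
    qed
    have xy': "x \<in> C" "y \<in> B" using x y xy by auto
    let ?A = "B \<inter> C"
    have "c \<in> B \<longleftrightarrow> c \<in> insert y ?A" "c \<in> C \<longleftrightarrow> c \<in> insert x ?A" for c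
      using x y xy' by auto
    then have "B = insert y ?A" "C = insert x ?A" by blast+
    then have e: "B = insert y ?A" "C = insert x ?A" "D = insert y (insert x ?A)" using y(2) by blast+
    have "x \<notin> ?A" "y \<notin> ?A" using x y by auto
    then have "rowface False ?A B C D"
      by (intro face_unionI[OF dset_Int[OF B C] B C _ _ _ e]) (use xy in auto)
    then show ?thesis by blast
  next
    case 4
    then obtain k l where kl: "(k, l) \<notin> B" "D = insert (k, l) B" using le by (auto simp: le1_def)
    show ?thesis
    proof (cases k)
      case 0
      have "rowface True B B B (insert (k, l) B)" by (rule face_cross) (use 0 kl B D in auto)
      then show ?thesis using 4 kl by blast
    next
      case (Suc m)
      have l: "rl B k = l" using rl_insert(2)[OF B, of k l] D kl by simp
      have "(m, l) \<in> B" using insert_cell_dset(1)[OF B, of k l m l] D kl Suc by simp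
      then have lm: "l < rl B m" by (simp add: mem_dset[OF B])
      \<comment> \<open>The last cell of the row above is removable: row \<open>k\<close> is
        shorter, since a cell could be added to it.\<close>
      define x where "x = (m, rl B m - 1)"
      have xB: "x \<in> B" unfolding x_def using lm by (simp add: mem_dset[OF B])
      have "dset (B - {x})"
      proof (rule dset_remove_corner[of x])
        show "dset (insert x (B - {x}))" using B xB by (simp add: insert_absorb)
        fix c assume "adjacent x c"
        then have "c = (m, rl B m) \<or> c = (k, rl B m - 1)" unfolding x_def adjacent_def using lm Suc by auto
        then have "c \<notin> B" using l lm by (auto simp: mem_dset[OF B])
        then show "c \<notin> B - {x}" by simp
      qed simp
      then have "rowface False (B - {x}) B B D"
        by (intro face_chainI[of _ _ _ x "(k, l)"]) (use B D xB kl Suc x_def in auto)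
      then show ?thesis using 4 by blast
    qed
  qed
qed

section \<open>The local rule of evacuation\<close>

lemma dominant_eq:
  assumes "sort_desc n v = (\<lambda>i. int (rl D i))" "\<And>i. 0 \<le> v i"
  shows "dominant n v = rl D"
  using assms unfolding dominant_def by simp

lemma dominant_colface_lower:
  assumes f: "colface False A B C D" and h: "height_le n D"
  shows "dominant n (\<lambda>i. int (rl B i) + int (rl C i) - int (rl D i)) = rl A"
proof (rule dominant_eq[OF sort_colface_lower[OF f h]])
  fix i show "0 \<le> int (rl B i) + int (rl C i) - int (rl D i)"
    using f
  proof (cases rule: face_rl)
    case union then show ?thesis using union[of i] by linarith
  next
    case (chain i' k)
    \<comment> \<open>Row \<open>k\<close>, the one that loses a cell, is nonempty by the column
      rule, so no entry is negative.\<close>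
    have "rl B k = Suc (rl A i')" using chain(4) by simp
    then show ?thesis unfolding chain(3) chain(2) by (cases "i = k") simp_all
  qed
qed

lemma dominant_colface_upper:
  assumes f: "colface False A B C D" and h: "height_le n B" "height_le n C"
  shows "dominant n (\<lambda>i. int (rl B i) + int (rl C i) - int (rl A i)) = rl D"
proof (rule dominant_eq[OF sort_colface_upper[OF f h]])
  note d = face_dset[OF f]
  fix i show "0 \<le> int (rl B i) + int (rl C i) - int (rl A i)"
    using rl_mono[OF d(1,2) le1_subset[OF d(5)], of i] by simp
qed

lemma dominant_jdtface:
  assumes f: "jdtface A B C D" and h: "height_le n D"
  shows "dominant n (\<lambda>i. int (rl A i) + int (rl D i) - int (rl B i)) = rl C"
proof (rule dominant_eq[OF sort_jdtface[OF f h]])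
  fix i show "0 \<le> int (rl A i) + int (rl D i) - int (rl B i)"
    using rl_mono[OF face_dset(2,4)[OF f] le1_subset[OF face_le1(1)[OF f]], of i] by simp
qed

text \<open>The case in which the absolute value matters: a new part \<open>1\<close> appears as \<open>-1\<close>.\<close>

lemma dominant_colface_cross:
  assumes f: "colface True A B C D" and h: "height_le n D"
  shows "dominant n (\<lambda>i. int (rl A i) + int (rl A i) - int (rl D i)) = rl D"
proof -
  note d = face_dset[OF f]
  obtain i where y: "(i, 0) \<notin> A" "D = insert (i, 0) A" using f by (auto simp: face_def)
  have r: "rl D = (rl A)(i := Suc (rl A i))" "rl A i = 0" using rl_insert[OF d(1), of i 0] d(4) y by auto
  have "(\<lambda>k. \<bar>int (rl A k) + int (rl A k) - int (rl D k)\<bar>) = (\<lambda>k. int (rl D k))"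
    using r by (auto simp: fun_eq_iff)
  moreover have "sort_desc n (\<lambda>k. int (rl D k)) = (\<lambda>k. int (rl D k))"
    by (rule sort_desc_eq) (use rl_antimono[OF d(4)] height_le_rl[OF h] in simp_all)
  ultimately show ?thesis unfolding dominant_def by simp
qed

section \<open>Extension of an oscillating tableau to empty shape\<close>

lemma growth_label_cong:
  assumes "a \<le> b" "\<And>i. i \<le> b \<Longrightarrow> \<omega> i = \<omega>' i"
  shows "growth_label \<omega> a b = growth_label \<omega>' a b"
  using assms
proof (induction "b - a" arbitrary: a b rule: less_induct)
  case less
  show ?case
  proof (cases "b \<le> Suc a")
    case True
    then show ?thesis unfolding growth_label.simps[of _ a b] using less.prems by auto
  next
    case False
    then have "growth_label \<omega> a (b - 1) = growth_label \<omega>' a (b - 1)"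
      "growth_label \<omega> (Suc a) (b - 1) = growth_label \<omega>' (Suc a) (b - 1)"
      "growth_label \<omega> (Suc a) b = growth_label \<omega>' (Suc a) b"
      using less.prems by (intro less.hyps; simp)+
    then show ?thesis unfolding growth_label.simps[of _ a b] using False by simp
  qed
qed

lemma descending_chain_exists:
  assumes "dset D"
  shows "\<exists>m \<delta>. \<delta> 0 = D \<and> \<delta> m = {} \<and> (\<forall>i. dset (\<delta> i) \<and> \<delta> i \<subseteq> D) \<and>
    (\<forall>i<m. \<exists>c. c \<notin> \<delta> (Suc i) \<and> \<delta> i = insert c (\<delta> (Suc i)))"
  using assms
proof (induction "card D" arbitrary: D)
  case 0
  then have "D = {}" using dset_finite by auto
  then show ?case by (intro exI[of _ 0] exI[of _ "\<lambda>i. {}"]) simp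
next
  case (Suc k)
  then have "D \<noteq> {}" by auto
  then obtain c where c: "c \<in> D" "dset (D - {c})" using corner_exists Suc by blast
  have "k = card (D - {c})" using Suc.hyps(2) c(1) by simp
  from Suc.hyps(1)[OF this c(2)] obtain m \<delta> where m: "\<delta> 0 = D - {c}" "\<delta> m = {}" "\<And>i. dset (\<delta> i) \<and> \<delta> i \<subseteq> D - {c}"
    "\<And>i. i < m \<Longrightarrow> \<exists>c. c \<notin> \<delta> (Suc i) \<and> \<delta> i = insert c (\<delta> (Suc i))"
    by blast
  define \<epsilon> where "\<epsilon> i = (case i of 0 \<Rightarrow> D | Suc j \<Rightarrow> \<delta> j)" for i
  have "\<exists>c. c \<notin> \<epsilon> (Suc i) \<and> \<epsilon> i = insert c (\<epsilon> (Suc i))" if "i < Suc m" for i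
  proof (cases i)
    case 0
    then show ?thesis using m(1) c(1) by (intro exI[of _ c]) (auto simp: \<epsilon>_def)
  next
    case (Suc j) then show ?thesis using m(4)[of j] that by (simp add: \<epsilon>_def)
  qed
  moreover have "dset (\<epsilon> i) \<and> \<epsilon> i \<subseteq> D" for i using m(3) Suc.prems unfolding \<epsilon>_def by (cases i) auto
  moreover have "\<epsilon> 0 = D" "\<epsilon> (Suc m) = {}" using m(2) by (simp_all add: \<epsilon>_def)
  ultimately show ?case by blast
qed

section \<open>Chords of an oscillating tableau\<close>

lemma sh_mono_p:
  assumes X: "pperm X" shows "sh X (Suc p) q s t \<subseteq> sh X p q s t"
proof (cases "p < q \<and> s \<le> t")
  case True
  then show ?thesis using le1_subset[OF face_dset(5)[OF sh_row_pt[OF X, of p q s t]]] by blast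
qed auto

lemma sh_mono_t:
  assumes X: "pperm X" shows "sh X p q s t \<subseteq> sh X p q s (Suc t)"
proof (cases "p \<le> q \<and> s \<le> t")
  case True
  then show ?thesis using le1_subset[OF face_dset(5)[OF sh_col_qt[OF X, of p q s t]]] by blast
qed auto

lemma sh_le1_q:
  assumes X: "pperm X" and "p \<le> q" "s \<le> t" shows "le1 (sh X p q s t) (sh X p (Suc q) s t)"
  using face_dset(6)[OF sh_col_qt[OF X assms(2,3)]] .

context
  fixes N :: nat and \<Omega> :: "nat \<Rightarrow> cell set"
  assumes dO: "\<And>i. dset (\<Omega> i)"
    and O0: "\<Omega> 0 = {}" and ON: "\<Omega> N = {}"
    and Ostep: "\<And>i. i < N \<Longrightarrow> \<Omega> i \<noteq> \<Omega> (Suc i) \<and> (le1 (\<Omega> i) (\<Omega> (Suc i)) \<or> le1 (\<Omega> (Suc i)) (\<Omega> i))"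
begin

section \<open>The growth diagram and its crosses\<close>

abbreviation "gl \<equiv> growth_label (\<lambda>i. rl (\<Omega> i))"

definition \<Gamma> :: "nat \<Rightarrow> nat \<Rightarrow> cell set" where "\<Gamma> a b = ferrers (gl a b)"

text \<open>The cell in column \<open>i + 1\<close> and row \<open>j + 1\<close>.\<close>

definition cross :: "nat \<Rightarrow> nat \<Rightarrow> bool" where
  "cross i j \<longleftrightarrow> has_cross (gl i j) (gl (Suc i) j) (gl (Suc i) (Suc j))"

lemma gl_eq: "gl a b = rl (\<Gamma> a b)" unfolding \<Gamma>_def by simp

lemma Gamma_diag: "\<Gamma> a a = \<Omega> a"
  unfolding \<Gamma>_def growth_label.simps[of _ a a] by (simp add: ferrers_rl dO)

lemma Gamma_next:
  assumes "a < N"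
  shows "\<Gamma> a (Suc a) = (if \<Omega> a \<subseteq> \<Omega> (Suc a) then \<Omega> a else \<Omega> (Suc a))"
  unfolding \<Gamma>_def growth_label.simps[of _ a "Suc a"] smaller_def by (simp add: ferrers_rl dO)

lemma Gamma_next_le1:
  assumes "a < N"
  shows "le1 (\<Gamma> a (Suc a)) (\<Omega> a)" "le1 (\<Gamma> a (Suc a)) (\<Omega> (Suc a))"
    "\<Gamma> a (Suc a) = \<Omega> a \<or> \<Gamma> a (Suc a) = \<Omega> (Suc a)"
proof -
  have "le1 (\<Gamma> a (Suc a)) (\<Omega> a) \<and> le1 (\<Gamma> a (Suc a)) (\<Omega> (Suc a))"
  proof (cases "le1 (\<Omega> a) (\<Omega> (Suc a))")
    case True
    then show ?thesis using le1_subset[OF True] unfolding Gamma_next[OF assms] by simp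
  next
    case False
    then have le: "le1 (\<Omega> (Suc a)) (\<Omega> a)" and ne: "\<Omega> a \<noteq> \<Omega> (Suc a)" using Ostep[OF assms] by blast+
    then have "\<not> \<Omega> a \<subseteq> \<Omega> (Suc a)" using le1_subset[OF le] subset_antisym by blast
    then show ?thesis using le unfolding Gamma_next[OF assms] by simp
  qed
  then show "le1 (\<Gamma> a (Suc a)) (\<Omega> a)" "le1 (\<Gamma> a (Suc a)) (\<Omega> (Suc a))" by blast+
  show "\<Gamma> a (Suc a) = \<Omega> a \<or> \<Gamma> a (Suc a) = \<Omega> (Suc a)" unfolding Gamma_next[OF assms] by simp
qed

text \<open>Induction on the distance from the diagonal: the square over three known labels exists
  by \<open>rowface_exists\<close>, and \<open>rowface_backward\<close> identifies its fourth corner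
  with the computed label.\<close>

lemma Gamma_props:
  assumes "a \<le> b" "b < N"
  shows "dset (\<Gamma> a (Suc b)) \<and> le1 (\<Gamma> a (Suc b)) (\<Gamma> a b) \<and> le1 (\<Gamma> a (Suc b)) (\<Gamma> (Suc a) (Suc b)) \<and>
    (a < b \<longrightarrow> rowface (cross a b) (\<Gamma> a (Suc b)) (\<Gamma> a b) (\<Gamma> (Suc a) (Suc b)) (\<Gamma> (Suc a) b))"
  using assms
proof (induction "b - a" arbitrary: a b rule: less_induct)
  case less
  show ?case
  proof (cases "a = b")
    case True
    then show ?thesis using Gamma_next_le1[of a] dO less.prems Gamma_diag by (auto simp: Gamma_next)
  next
    case False
    then have ab: "a < b" using less.prems by simp
    then obtain b' where b': "b = Suc b'" by (cases b) auto
    let ?K = "\<Gamma> a b" and ?M = "\<Gamma> (Suc a) b" and ?N = "\<Gamma> (Suc a) (Suc b)"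
    have 1: "dset ?K" "le1 ?K ?M" using less.hyps[of b' a] less.prems ab b' by auto
    have 2: "dset ?N" "le1 ?N ?M" using less.hyps[of b "Suc a"] less.prems ab by auto
    have 3: "dset ?M"
    proof (cases "b = Suc a")
      case True then show ?thesis using Gamma_diag dO by simp
    next
      case False
      then show ?thesis using less.hyps[of b' "Suc a"] less.prems ab b' by auto
    qed
    obtain x A where f: "rowface x A ?K ?N ?M" using rowface_exists[OF 1(1) 2(1) 3 1(2) 2(2)] by blast
    note bw = rowface_backward[OF f]
    have "gl a (Suc b) = backward_rule (gl a b) (gl (Suc a) b) (gl (Suc a) (Suc b))"
      using ab by (subst growth_label.simps) simp
    then have "gl a (Suc b) = rl A" using bw(1) by (simp add: gl_eq)
    then have A: "\<Gamma> a (Suc b) = A" unfolding \<Gamma>_def using ferrers_rl[OF face_dset(1)[OF f]] by simp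
    moreover have "cross a b = x" unfolding cross_def using bw(2) by (simp add: gl_eq)
    ultimately show ?thesis using f face_dset[OF f] by simp
  qed
qed

lemma Gamma_face:
  "i < j \<Longrightarrow> j < N \<Longrightarrow> rowface (cross i j) (\<Gamma> i (Suc j)) (\<Gamma> i j) (\<Gamma> (Suc i) (Suc j)) (\<Gamma> (Suc i) j)"
  using Gamma_props[of i j] by simp

lemma Gamma_left: "b \<le> N \<Longrightarrow> \<Gamma> 0 b = {}"
proof (induction b)
  case 0 then show ?case using Gamma_diag O0 by simp
next
  case (Suc b) then show ?case using Gamma_props[of 0 b] le1_subset[of "\<Gamma> 0 (Suc b)" "\<Gamma> 0 b"] by auto
qed

lemma Gamma_bottom: "a \<le> N \<Longrightarrow> \<Gamma> a N = {}"
proof (induction a rule: inc_induct)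
  case base then show ?case using Gamma_diag ON by simp
next
  case (step a)
  obtain b where b: "N = Suc b" using step by (cases N) auto
  then show ?case using Gamma_props[of a b] step le1_subset[of "\<Gamma> a N" "\<Gamma> (Suc a) N"] by auto
qed

lemma cross_edges:
  assumes "cross i j" "i < j" "j < N"
  shows "\<Gamma> i j \<noteq> \<Gamma> (Suc i) j" "\<Gamma> i (Suc j) = \<Gamma> (Suc i) (Suc j)"
    "\<Gamma> i (Suc j) = \<Gamma> i j" "\<Gamma> (Suc i) (Suc j) \<noteq> \<Gamma> (Suc i) j"
proof -
  have "rowface True (\<Gamma> i (Suc j)) (\<Gamma> i j) (\<Gamma> (Suc i) (Suc j)) (\<Gamma> (Suc i) j)"
    using Gamma_face[OF assms(2,3)] assms(1) by simp
  then obtain y where y: "\<Gamma> i j = \<Gamma> i (Suc j)" "\<Gamma> (Suc i) (Suc j) = \<Gamma> i (Suc j)"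
    "y \<notin> \<Gamma> i (Suc j)" "\<Gamma> (Suc i) j = insert y (\<Gamma> i (Suc j))" unfolding face_def by auto
  have "\<Gamma> (Suc i) j \<noteq> \<Gamma> i (Suc j)" using y(3,4) by blast
  then show "\<Gamma> i j \<noteq> \<Gamma> (Suc i) j" "\<Gamma> i (Suc j) = \<Gamma> (Suc i) (Suc j)"
    "\<Gamma> i (Suc j) = \<Gamma> i j" "\<Gamma> (Suc i) (Suc j) \<noteq> \<Gamma> (Suc i) j" using y(1,2) by simp_all
qed

text \<open>A cross needs a nontrivial upper edge and leaves a trivial lower edge. So it ends the
  line coming down from the diagonal, and no second cross can follow below it.\<close>

lemma column_edge_trivial:
  assumes "\<Gamma> i j = \<Gamma> (Suc i) j" "i < j"
  shows "j \<le> k \<Longrightarrow> k \<le> N \<Longrightarrow> \<Gamma> i k = \<Gamma> (Suc i) k"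
proof (induction k rule: dec_induct)
  case base then show ?case using assms by simp
next
  case (step k)
  then have eq: "\<Gamma> i k = \<Gamma> (Suc i) k" and ik: "i < k" "k < N" using assms by auto
  then have nc: "\<not> cross i k" using cross_edges(1) by blast
  have "rowface False (\<Gamma> i (Suc k)) (\<Gamma> i k) (\<Gamma> (Suc i) (Suc k)) (\<Gamma> (Suc i) k)"
    using Gamma_face[OF ik] nc by simp
  from face_degenerate(2)[OF this] show ?case using eq by simp
qed

text \<open>A nontrivial vertical edge excludes a cross to its right, so the line leaving a cross
  runs on to the diagonal and meets no second cross.\<close>

lemma row_edge_nontrivial:
  assumes "\<Gamma> i (Suc j) \<noteq> \<Gamma> i j" "j < N"
  shows "i \<le> k \<Longrightarrow> k \<le> j \<Longrightarrow> \<Gamma> k (Suc j) \<noteq> \<Gamma> k j"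
proof (induction k rule: dec_induct)
  case base then show ?case using assms by simp
next
  case (step k)
  then have ne: "\<Gamma> k (Suc j) \<noteq> \<Gamma> k j" and kj: "k < j" by auto
  then have nc: "\<not> cross k j" using cross_edges(3) assms(2) by blast
  have "rowface False (\<Gamma> k (Suc j)) (\<Gamma> k j) (\<Gamma> (Suc k) (Suc j)) (\<Gamma> (Suc k) j)"
    using Gamma_face[OF kj assms(2)] nc by simp
  from face_degenerate(1)[OF this] show ?case using ne by simp
qed

lemma cross_same_column:
  assumes "cross i j" "cross i k" "i < j" "j < N" "i < k" "k < N" shows "j = k"
proof -
  have "\<not> j < k" if "cross i j" "cross i k" "i < j" "j < N" "i < k" "k < N" for j k
    using column_edge_trivial[OF cross_edges(2)[OF that(1,3,4)], of k] cross_edges(1)[OF that(2,5,6)] that by auto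
  from this[of j k] this[of k j] assms show ?thesis by auto
qed

lemma cross_same_row:
  assumes "cross i k" "cross j k" "i < k" "j < k" "k < N" shows "i = j"
proof -
  have "\<not> i < j" if "cross i k" "cross j k" "i < k" "j < k" for i j
    using row_edge_nontrivial[OF cross_edges(4)[OF that(1,3) assms(5)] assms(5), of j]
      cross_edges(3)[OF that(2,4) assms(5)] that by auto
  from this[of i j] this[of j i] assms show ?thesis by auto
qed

text \<open>The lines of both crosses reach the diagonal at step \<open>j\<close> of \<Omega>. The
  first makes this step the removal of a cell, the second an addition.\<close>

lemma cross_chain:
  assumes "cross i j" "i < j" "j < k" "k < N" shows "\<not> cross j k"
proof
  assume c: "cross j k"
  have "\<Gamma> j (Suc j) \<noteq> \<Gamma> j j"
    using row_edge_nontrivial[OF cross_edges(4)[OF assms(1,2)], of j] assms by simp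
  moreover have "\<Gamma> j (Suc j) \<noteq> \<Gamma> (Suc j) (Suc j)"
    using column_edge_trivial[of j "Suc j" k] cross_edges(1)[OF c] assms by auto
  ultimately show False using Gamma_next_le1(3)[of j] assms by (simp add: Gamma_diag)
qed

text \<open>The matching as a partial permutation matrix whose rows are \<open>N\<close> points followed by a second copy of
  them: every chord \<open>{i, j}\<close> with \<open>i < j\<close> gives the crosses \<open>(i, j)\<close> and \<open>(j, N + i)\<close>. A window
  \<open>[p, q) \<times> [s, N + t)\<close> with \<open>t \<le> p \<le> q \<le> s\<close> then contains the chords between two arcs of a circle.\<close>

definition chords :: "nat \<Rightarrow> nat \<Rightarrow> bool" where
  "chords i y \<longleftrightarrow> (i < y \<and> y < N \<and> cross i y) \<or> (i < N \<and> (\<exists>j<i. y = N + j \<and> cross j i))"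

lemma chords_upper: "y < N \<Longrightarrow> chords i y \<longleftrightarrow> i < y \<and> cross i y"
  unfolding chords_def by auto

lemma chords_lower: "chords i (N + j) \<longleftrightarrow> j < i \<and> i < N \<and> cross j i"
  unfolding chords_def by auto

lemma pperm_chords: "pperm chords"
  unfolding pperm_def
proof (intro conjI allI impI)
  fix i i' y assume a: "chords i y" "chords i' y"
  show "i = i'"
  proof (cases "y < N")
    case True
    then show ?thesis using a cross_same_row unfolding chords_upper[OF True] by blast
  next
    case False
    then obtain j where "y = N + j" using le_Suc_ex not_less by blast
    then show ?thesis using a cross_same_column unfolding \<open>y = N + j\<close> chords_lower by blast
  qed
next
  fix i y y' assume a: "chords i y" "chords i y'"
  consider "i < y \<and> y < N \<and> cross i y" "i < y' \<and> y' < N \<and> cross i y'"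
    | k where "k < i" "cross k i" "i < N" "\<exists>z. i < z \<and> z < N \<and> cross i z"
    | k k' where "i < N" "k < i" "k' < i" "cross k i" "cross k' i" "y = N + k" "y' = N + k'"
    using a unfolding chords_def by blast
  then show "y = y'"
  proof cases
    case 1 then show ?thesis using cross_same_column by blast
  next
    case 2 then show ?thesis using cross_chain by blast
  next
    case 3 then show ?thesis using cross_same_row[of k i k'] by simp
  qed
qed

text \<open>Read forwards from the empty left and bottom sides, Sundaram's diagram obeys
  \<open>rowface\<close> with the crosses of \<open>chords\<close>. The windows do the same when
  \<open>q\<close> and \<open>s\<close> move, and the largest corner of such a square is
  unique.\<close>

lemma sh_Gamma: "a \<le> b \<Longrightarrow> b \<le> N \<Longrightarrow> sh chords 0 a b N = \<Gamma> a b"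
proof (induction a arbitrary: b)
  case 0 then show ?case using Gamma_left by simp
next
  case (Suc a)
  from \<open>b \<le> N\<close> \<open>Suc a \<le> b\<close> show ?case
  proof (induction b rule: inc_induct)
    case base then show ?case using Gamma_bottom by simp
  next
    case (step b)
    have "rowface (cross a b) (sh chords 0 a (Suc b) N) (sh chords 0 a b N)
        (sh chords 0 (Suc a) (Suc b) N) (sh chords 0 (Suc a) b N)"
      using sh_row_qs[OF pperm_chords, of b N 0 a] chords_upper[of b a] step by simp
    moreover have "sh chords 0 a (Suc b) N = \<Gamma> a (Suc b)" "sh chords 0 a b N = \<Gamma> a b"
      "sh chords 0 (Suc a) (Suc b) N = \<Gamma> (Suc a) (Suc b)"
      using Suc.IH step by simp_all
    ultimately have "rowface (cross a b) (\<Gamma> a (Suc b)) (\<Gamma> a b) (\<Gamma> (Suc a) (Suc b)) (sh chords 0 (Suc a) b N)" by simp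
    then show ?case using rowface_unique[OF _ Gamma_face[of a b]] step by simp
  qed
qed

text \<open>Point \<open>k\<close> passes from the columns to the rows and point \<open>j\<close>
  from the rows to the columns. A point whose chord ends among the columns is effective only as a
  row, and any other one only as a column. Hence each move shifts a single side of the window,
  unless \<open>k\<close> and \<open>j\<close> are joined by a chord.\<close>

lemma chords_step:
  assumes kj: "k < j" "j < N"
    and h: "height_le n (sh chords k j j (N + k))" "height_le n (sh chords k (Suc j) (Suc j) (N + k))"
      "height_le n (sh chords (Suc k) j j (Suc (N + k)))"
  shows "dominant n (\<lambda>i. int (rl (sh chords (Suc k) j j (Suc (N + k))) i)
            + int (rl (sh chords k (Suc j) (Suc j) (N + k)) i) - int (rl (sh chords k j j (N + k)) i))
         = rl (sh chords (Suc k) (Suc j) (Suc j) (Suc (N + k)))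
    \<and> height_le n (sh chords (Suc k) (Suc j) (Suc j) (Suc (N + k)))"
proof -
  let ?t = "N + k"
  let ?F = "sh chords"
  define \<alpha> where "\<alpha> = ?F k j j ?t"
  define \<beta> where "\<beta> = ?F k (Suc j) (Suc j) ?t"
  define \<gamma> where "\<gamma> = ?F (Suc k) j j (Suc ?t)"
  define \<delta> where "\<delta> = ?F (Suc k) (Suc j) (Suc j) (Suc ?t)"
  have jt: "j < ?t" "Suc j \<le> ?t" using kj by auto
  have one_col: "y = y'" if "chords i y" "chords i y'" for i y y' using pperm_chords that unfolding pperm_def by blast
  have one_row: "i = i'" if "chords i y" "chords i' y" for i i' y using pperm_chords that unfolding pperm_def by blast
  have h\<alpha>: "height_le n \<alpha>" and h\<beta>: "height_le n \<beta>" and h\<gamma>: "height_le n \<gamma>"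
    using h unfolding \<alpha>_def \<beta>_def \<gamma>_def by blast+
  have "dominant n (\<lambda>i. int (rl \<gamma> i) + int (rl \<beta> i) - int (rl \<alpha> i)) = rl \<delta> \<and> height_le n \<delta>"
  proof (cases "cross k j")
    case True
    have kx: "chords k j" using True kj by (simp add: chords_upper)
    have jx: "chords j ?t" using True kj by (simp add: chords_lower)
    \<comment> \<open>The chord from \<open>k\<close> to \<open>j\<close> connects the arcs in
      \<alpha> and \<delta>, as the crosses \<open>(k, j)\<close> and \<open>(j, N + k)\<close>, but
      lies inside one arc in \<beta> and \<gamma>. All other chords together have the shape
      \<open>?E\<close>, so \<alpha> and \<delta> both arise from \<open>?E\<close> by a cross and
      agree.\<close>
    let ?E = "?F (Suc k) j (Suc j) ?t"
    have nk: "\<not> chords k y" if "Suc j \<le> y" for y using one_col[OF kx, of y] that by auto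
    have nj: "\<not> chords j y" if "y < ?t" for y using one_col[OF jx, of y] that by auto
    have rj: "\<not> chords i j" if "Suc k \<le> i" for i using one_row[OF kx, of i] that by auto
    have rt: "\<not> chords i ?t" if "i < j" for i using one_row[OF jx, of i] that by auto
    have "\<beta> = ?F (Suc k) (Suc j) (Suc j) ?t"
      unfolding \<beta>_def by (rule sh_col_empty_lower[OF pperm_chords]) (use kj nk in auto)
    also have "\<dots> = ?E" by (rule sh_col_empty_upper[OF pperm_chords]) (use kj nj in auto)
    finally have b: "\<beta> = ?E" .
    have "\<gamma> = ?F (Suc k) j (Suc j) (Suc ?t)"
      unfolding \<gamma>_def by (rule sh_row_empty_lower[OF pperm_chords]) (use jt rj in auto)
    also have "\<dots> = ?E" by (rule sh_row_empty_upper[OF pperm_chords]) (use jt rt in auto)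
    finally have g: "\<gamma> = ?E" .
    have fa: "colface True ?E (?F k j (Suc j) ?t) (?F (Suc k) j j ?t) \<alpha>"
      using sh_col_ps[OF pperm_chords jt(1) kj(1)] kx unfolding \<alpha>_def by simp
    have fd: "colface True ?E (?F (Suc k) j (Suc j) (Suc ?t)) (?F (Suc k) (Suc j) (Suc j) ?t) \<delta>"
      using sh_col_qt[OF pperm_chords, of "Suc k" j "Suc j" ?t] kj jt jx unfolding \<delta>_def by simp
    have "colface True ?E ?E ?E \<alpha>" "colface True ?E ?E ?E \<delta>" using fa fd by (auto simp: face_def)
    then have "\<alpha> = \<delta>" by (rule colface_unique)
    have "dominant n (\<lambda>i. int (rl ?E i) + int (rl ?E i) - int (rl \<alpha> i)) = rl \<alpha>"
      by (rule dominant_colface_cross[OF fa h\<alpha>])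
    then show ?thesis unfolding b g \<open>\<alpha> = \<delta>\<close>[symmetric] using h\<alpha> by simp
  next
    case nc: False
    define xC where "xC \<longleftrightarrow> (\<exists>i. k < i \<and> i < j \<and> cross k i)"
    define yC where "yC \<longleftrightarrow> (\<exists>i. k < i \<and> i < j \<and> cross i j)"
    have nk: "\<not> chords k y" if xC "j \<le> y" for y
    proof -
      obtain i where "chords k i" "i < j" using \<open>xC\<close> kj unfolding xC_def by (auto simp: chords_upper)
      then show ?thesis using one_col[of k i y] that by auto
    qed
    have nt: "\<not> chords i ?t" if "\<not> xC" "i \<le> j" for i
      using that nc kj unfolding xC_def chords_lower by (cases "i = j") auto
    have nj: "\<not> chords j y" if yC "y < Suc ?t" for y
    proof -
      obtain i where "chords j (N + i)" "k < i" using \<open>yC\<close> kj unfolding yC_def by (auto simp: chords_lower)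
      then show ?thesis using one_col[of j "N + i" y] that by auto
    qed
    have nr: "\<not> chords i j" if "\<not> yC" "k \<le> i" for i
      using that nc kj unfolding yC_def chords_upper[OF kj(2)] by (cases "i = k") auto
    have colk: "?F k q s ?t = ?F (Suc k) q s ?t" if xC "k < q" "j \<le> s" for q s
      by (rule sh_col_empty_lower[OF pperm_chords]) (use that nk in auto)
    have rowt: "?F p q s (Suc ?t) = ?F p q s ?t" if "\<not> xC" "q \<le> Suc j" "s \<le> ?t" for p q s
      by (rule sh_row_empty_upper[OF pperm_chords]) (use that nt in auto)
    have colj: "?F p (Suc j) s t' = ?F p j s t'" if yC "t' \<le> Suc ?t" "p \<le> j" for p s t'
      by (rule sh_col_empty_upper[OF pperm_chords]) (use that nj in auto)
    have rowj: "?F p q j t' = ?F p q (Suc j) t'" if "\<not> yC" "k \<le> p" "j < t'" for p q t'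
      by (rule sh_row_empty_lower[OF pperm_chords]) (use that nr in auto)
    \<comment> \<open>The sides that effectively move are \<open>s\<close> and \<open>t\<close>,
      \<open>q\<close> and \<open>t\<close>, \<open>p\<close> and \<open>s\<close>, and
      \<open>p\<close> and \<open>q\<close>, respectively.\<close>
    consider (CC) xC yC | (CD) xC "\<not> yC" | (DC) "\<not> xC" yC | (DD) "\<not> xC" "\<not> yC" by blast
    then show ?thesis
    proof cases
      case CC
      have "\<alpha> = ?F (Suc k) j j ?t" unfolding \<alpha>_def using colk CC kj by simp
      moreover have "\<beta> = ?F (Suc k) j (Suc j) ?t"
        unfolding \<beta>_def using colk[OF CC(1), of "Suc j" "Suc j"] colj[OF CC(2), of ?t "Suc k" "Suc j"] kj by simp
      moreover have "\<delta> = ?F (Suc k) j (Suc j) (Suc ?t)" unfolding \<delta>_def using colj CC kj by simp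
      ultimately have f: "jdtface \<beta> \<alpha> \<delta> \<gamma>" unfolding \<gamma>_def using sh_jdt_st[OF pperm_chords jt(1)] by simp
      have "height_le n \<delta>" using height_le_subset[OF h\<gamma> le1_subset[OF face_le1(2)[OF f]]] .
      then show ?thesis using dominant_jdtface[OF f h\<gamma>] by (simp add: add.commute)
    next
      case CD
      have "\<alpha> = ?F (Suc k) j (Suc j) ?t"
        unfolding \<alpha>_def using colk[OF CD(1), of j j] rowj[OF CD(2), of "Suc k" ?t j] kj jt by simp
      moreover have "\<beta> = ?F (Suc k) (Suc j) (Suc j) ?t" unfolding \<beta>_def using colk CD kj by simp
      moreover have "\<gamma> = ?F (Suc k) j (Suc j) (Suc ?t)" unfolding \<gamma>_def using rowj CD jt by simp
      moreover have "\<not> chords j ?t" using nc by (simp add: chords_lower)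
      ultimately have f: "colface False \<alpha> \<gamma> \<beta> \<delta>"
        unfolding \<delta>_def using sh_col_qt[OF pperm_chords, of "Suc k" j "Suc j" ?t] kj jt by simp
      show ?thesis using dominant_colface_upper[OF f h\<gamma> h\<beta>] height_le_colface_upper[OF f h\<gamma> h\<beta>] by simp
    next
      case DC
      have "\<beta> = ?F k j (Suc j) ?t" unfolding \<beta>_def using colj DC kj by simp
      moreover have "\<gamma> = ?F (Suc k) j j ?t" unfolding \<gamma>_def using rowt DC jt by simp
      moreover have "\<delta> = ?F (Suc k) j (Suc j) ?t"
        unfolding \<delta>_def using rowt[OF DC(1), of "Suc j" "Suc j" "Suc k"] colj[OF DC(2), of ?t "Suc k" "Suc j"] kj jt by simp
      moreover have "\<not> chords k j" using nc kj by (simp add: chords_upper)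
      ultimately have f: "colface False \<delta> \<beta> \<gamma> \<alpha>"
        unfolding \<alpha>_def using sh_col_ps[OF pperm_chords jt(1) kj(1)] by simp
      have "height_le n \<delta>" using height_le_subset[OF h\<beta> le1_subset[OF face_dset(5)[OF f]]] .
      then show ?thesis using dominant_colface_lower[OF f h\<alpha>] by (simp add: add.commute)
    next
      case DD
      have "\<alpha> = ?F k j (Suc j) ?t" unfolding \<alpha>_def using rowj DD jt by simp
      moreover have "\<gamma> = ?F (Suc k) j (Suc j) ?t"
        unfolding \<gamma>_def using rowt[OF DD(1), of j j "Suc k"] rowj[OF DD(2), of "Suc k" ?t j] jt by simp
      moreover have "\<delta> = ?F (Suc k) (Suc j) (Suc j) ?t" unfolding \<delta>_def using rowt DD jt by simp
      ultimately have f: "jdtface \<gamma> \<alpha> \<delta> \<beta>" unfolding \<beta>_def using sh_jdt_pq[OF pperm_chords kj(1)] by simp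
      have "height_le n \<delta>" using height_le_subset[OF h\<beta> le1_subset[OF face_le1(2)[OF f]]] .
      then show ?thesis using dominant_jdtface[OF f h\<beta>] by simp
    qed
  qed
  then show ?thesis unfolding \<alpha>_def \<beta>_def \<gamma>_def \<delta>_def .
qed

text \<open>The bound on the height takes part in the induction because \<open>dominant n\<close>
  sees only the first \<open>n\<close> rows.\<close>

lemma evac_label_chords:
  assumes \<omega>: "\<And>j. j \<le> r \<Longrightarrow> \<omega> j = rl (\<Omega> j)" and r: "r \<le> N" and h: "\<And>j. j \<le> r \<Longrightarrow> height_le n (\<Omega> j)"
  shows "k \<le> j \<Longrightarrow> j \<le> r \<Longrightarrow> evac_label n \<omega> k j = rl (sh chords k j j (N + k)) \<and> height_le n (sh chords k j j (N + k))"
proof (induction k arbitrary: j)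
  case 0
  then show ?case using \<omega> h sh_Gamma[of j j] r by (simp add: Gamma_diag)
next
  case (Suc k)
  have "rl {} = empty_partition" unfolding rl_def empty_partition_def by simp
  then have base: "evac_label n \<omega> (Suc k) (Suc k) = rl (sh chords (Suc k) (Suc k) (Suc k) (N + Suc k))" by simp
  from \<open>Suc k \<le> j\<close> \<open>j \<le> r\<close> show ?case
  proof (induction j rule: dec_induct)
    case base
    then show ?case using \<open>evac_label n \<omega> (Suc k) (Suc k) = _\<close> by (simp add: height_le_def)
  next
    case (step j)
    have 1: "evac_label n \<omega> k j = rl (sh chords k j j (N + k))" "height_le n (sh chords k j j (N + k))"
      "evac_label n \<omega> k (Suc j) = rl (sh chords k (Suc j) (Suc j) (N + k))" "height_le n (sh chords k (Suc j) (Suc j) (N + k))"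
      using Suc.IH[of j] Suc.IH[of "Suc j"] step by simp_all
    have 2: "evac_label n \<omega> (Suc k) j = rl (sh chords (Suc k) j j (Suc (N + k)))" "height_le n (sh chords (Suc k) j j (Suc (N + k)))"
      using step by simp_all
    show ?case using chords_step[of k j n] step r 1 2 by simp
  qed
qed

text \<open>In the reversed indices a cell of the growth diagram moves the sides \<open>p\<close>
  and \<open>t\<close>, which gives a \<open>rowface\<close>. Its cross is the second copy
  \<open>(p, N + t)\<close> of the chord with ends \<open>t < p\<close>; this is the source of the
  reversal of the matching.\<close>

lemma evacuation_growth:
  assumes \<omega>: "\<And>j. j \<le> r \<Longrightarrow> \<omega> j = rl (\<Omega> j)" and r: "r \<le> N" and h: "\<And>j. j \<le> r \<Longrightarrow> height_le n (\<Omega> j)"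
  shows "a \<le> b \<Longrightarrow> b \<le> r \<Longrightarrow> growth_label (evacuation n r \<omega>) a b = rl (sh chords (r - a) r r (N + (r - b)))"
    and "a < b \<Longrightarrow> b < r \<Longrightarrow> has_cross (growth_label (evacuation n r \<omega>) a b)
      (growth_label (evacuation n r \<omega>) (Suc a) b) (growth_label (evacuation n r \<omega>) (Suc a) (Suc b))
      \<longleftrightarrow> cross (r - Suc b) (r - Suc a)"
proof -
  let ?g = "growth_label (evacuation n r \<omega>)"
  let ?H = "\<lambda>a b. sh chords (r - a) r r (N + (r - b))"
  have ev: "evacuation n r \<omega> a = rl (?H a a)" if "a \<le> r" for a
    unfolding evacuation_def using evac_label_chords[OF \<omega> r h, of "r - a" r] that by simp
  have f: "rowface (cross (r - Suc b) (r - Suc a)) (?H a (Suc b)) (?H a b) (?H (Suc a) (Suc b)) (?H (Suc a) b)"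
    if ab: "a < b" "b < r" for a b
  proof -
    define p t where "p = r - Suc a" and "t = r - Suc b"
    have e: "r - a = Suc p" "r - b = Suc t" "r - Suc a = p" "r - Suc b = t" using ab unfolding p_def t_def by auto
    have pt: "p < r" "r \<le> N + t" "t < p" "p < N" using ab r unfolding p_def t_def by auto
    have "chords p (N + t) = cross t p" using pt by (simp add: chords_lower)
    then show ?thesis using face_commuteI[OF sh_row_pt[OF pperm_chords pt(1,2)]] unfolding e by simp
  qed
  show g: "?g a b = rl (?H a b)" if "a \<le> b" "b \<le> r" for a b
    using that
  proof (induction "b - a" arbitrary: a b rule: less_induct)
    case less
    consider "a = b" | "b = Suc a" | b' where "b = Suc b'" "a < b'" using less.prems
      by (metis Suc_lessI le_less less_imp_Suc_add less_Suc_eq)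
    then show ?case
    proof cases
      case 1
      then show ?thesis using ev less.prems by (subst growth_label.simps) simp
    next
      case 2
      define k where "k = r - b"
      have k: "r - a = Suc k" "k < r" using 2 less.prems unfolding k_def by auto
      have "?g a b = smaller (rl (sh chords (Suc k) r r (N + Suc k))) (rl (sh chords k r r (N + k)))"
        using 2 ev[of a] ev[of b] less.prems k by (subst growth_label.simps) (simp add: k_def)
      also have "\<dots> = rl (sh chords (Suc k) r r (N + k))"
      proof -
        let ?A = "sh chords (Suc k) r r (N + Suc k)" and ?B = "sh chords k r r (N + k)" and ?C = "sh chords (Suc k) r r (N + k)"
        have A: "?C \<subseteq> ?A" using sh_mono_t[OF pperm_chords, of "Suc k" r r "N + k"] by simp
        have B: "?C \<subseteq> ?B" by (rule sh_mono_p[OF pperm_chords])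
        have s: "smaller (rl ?A) (rl ?B) = (if ?A \<subseteq> ?B then rl ?A else rl ?B)"
          unfolding smaller_def by (simp add: ferrers_rl sh_dset[OF pperm_chords])
        show ?thesis
        \<comment> \<open>Point \<open>k\<close> belongs to neither arc of \<open>?C\<close>. If its
          chord ends in the columns after \<open>k\<close>, counting it as a column has no effect
          and \<open>?B\<close> equals \<open>?C\<close>; otherwise counting it as a row has none
          and \<open>?A\<close> equals \<open>?C\<close>.\<close>
        proof (cases "\<exists>i. k < i \<and> i < r \<and> cross k i")
          case True
          then obtain i where i: "k < i" "i < r" "chords k i" using r by (auto simp: chords_upper)
          have "\<not> chords k y" if "r \<le> y" for y using pperm_chords i that unfolding pperm_def by (metis not_le)
          then have "?B = ?C" by (intro sh_col_empty_lower[OF pperm_chords]) (use k in auto)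
          then show ?thesis using s A by (metis subset_antisym)
        next
          case False
          have "\<not> chords i (N + k)" if "i < r" for i using False that unfolding chords_lower by auto
          then have "?A = ?C" using sh_row_empty_upper[OF pperm_chords, of r "N + k" "Suc k" r] r by simp
          then show ?thesis using s B by simp
        qed
      qed
      finally show ?thesis using k by (simp add: k_def)
    next
      case 3
      have IH: "?g a b' = rl (?H a b')" "?g (Suc a) b' = rl (?H (Suc a) b')" "?g (Suc a) b = rl (?H (Suc a) b)"
        using less 3 by simp_all
      have "?g a b = backward_rule (?g a b') (?g (Suc a) b') (?g (Suc a) b)"
        using 3 by (subst growth_label.simps) simp
      also have "\<dots> = rl (?H a b)"
        unfolding IH using rowface_backward(1)[OF f[of a b']] 3 less.prems by simp
      finally show ?thesis .
    qed
  qed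
  show "has_cross (?g a b) (?g (Suc a) b) (?g (Suc a) (Suc b)) \<longleftrightarrow> cross (r - Suc b) (r - Suc a)" if "a < b" "b < r"
    using rowface_backward(2)[OF f[OF that]] g[of a b] g[of "Suc a" b] g[of "Suc a" "Suc b"] that by simp
qed

end

section \<open>Sundaram's map and evacuation\<close>

lemma sundaram_tableau_eq: "sundaram_tableau r \<omega> = chain_filling r (\<lambda>i. ferrers (growth_label \<omega> i r))"
  unfolding sundaram_tableau_def chain_filling_def ..

lemma sundaram_matching_eq:
  assumes "\<And>a b. a < b \<Longrightarrow> b < r \<Longrightarrow> has_cross (growth_label \<omega> a b) (growth_label \<omega> (Suc a) b)
      (growth_label \<omega> (Suc a) (Suc b)) \<longleftrightarrow> C a b"
  shows "sundaram_matching r \<omega> = {{Suc a, Suc b} |a b. a < b \<and> b < r \<and> C a b}"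
proof (intro equalityI subsetI)
  fix P assume "P \<in> sundaram_matching r \<omega>"
  then obtain i j where ij: "P = {i, j}" "1 \<le> i" "i < j" "j \<le> r"
    "has_cross (growth_label \<omega> (i - 1) (j - 1)) (growth_label \<omega> i (j - 1)) (growth_label \<omega> i j)"
    unfolding sundaram_matching_def by blast
  define a b where "a = i - 1" and "b = j - 1"
  have e: "i = Suc a" "j = Suc b" "a < b" "b < r" using ij(2-4) unfolding a_def b_def by auto
  have "has_cross (growth_label \<omega> a b) (growth_label \<omega> (Suc a) b) (growth_label \<omega> (Suc a) (Suc b))"
    using ij(5) unfolding e(1,2) by simp
  then show "P \<in> {{Suc a, Suc b} |a b. a < b \<and> b < r \<and> C a b}"
    using assms[OF e(3,4)] ij(1) e by blast
next
  fix P assume "P \<in> {{Suc a, Suc b} |a b. a < b \<and> b < r \<and> C a b}"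
  then obtain a b where ab: "P = {Suc a, Suc b}" "a < b" "b < r" "C a b" by blast
  show "P \<in> sundaram_matching r \<omega>"
    unfolding sundaram_matching_def
    by (rule CollectI, rule exI[of _ "Suc a"], rule exI[of _ "Suc b"]) (use ab assms[OF ab(2,3)] in simp)
qed

theorem theorem3p2:
  fixes n r :: nat and \<omega> :: "nat \<Rightarrow> parts"
  assumes "n \<ge> 1" and "oscillating_tableau n r \<omega>"
  shows "sundaram_matching r (evacuation n r \<omega>) = reversal r (sundaram_matching r \<omega>)
    \<and> sundaram_tableau r (evacuation n r \<omega>)
        = schuetzenberger_evacuation r (sundaram_tableau r \<omega>)"
proof -
  have \<omega>0: "\<omega> 0 = empty_partition" and \<omega>p: "\<And>i. i \<le> r \<Longrightarrow> is_partition (\<omega> i) \<and> num_parts (\<omega> i) \<le> n"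
    and \<omega>s: "\<And>i. i < r \<Longrightarrow> \<exists>c. (c \<notin> ferrers (\<omega> i) \<and> ferrers (\<omega> (Suc i)) = insert c (ferrers (\<omega> i))) \<or>
                (c \<notin> ferrers (\<omega> (Suc i)) \<and> ferrers (\<omega> i) = insert c (ferrers (\<omega> (Suc i))))"
    using assms(2) unfolding oscillating_tableau_def by blast+
  have d\<omega>: "dset (ferrers (\<omega> i))" if "i \<le> r" for i using \<omega>p that dset_ferrers by blast
  obtain m \<delta> where \<delta>: "\<delta> 0 = ferrers (\<omega> r)" "\<delta> m = {}" "\<And>i. dset (\<delta> i)"
    "\<And>i. i < m \<Longrightarrow> \<exists>c. c \<notin> \<delta> (Suc i) \<and> \<delta> i = insert c (\<delta> (Suc i))"
    using descending_chain_exists[OF d\<omega>[OF le_refl]] by blast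
  define N where "N = r + m"
  define \<Omega> where "\<Omega> i = (if i \<le> r then ferrers (\<omega> i) else \<delta> (i - r))" for i
  have rN: "r \<le> N" unfolding N_def by simp
  have dO: "dset (\<Omega> i)" for i using d\<omega> \<delta>(3) unfolding \<Omega>_def by simp
  have O0: "\<Omega> 0 = {}" unfolding \<Omega>_def \<omega>0 empty_partition_def ferrers_def by simp
  \<comment> \<open>The two pieces overlap at index \<open>r\<close>, where both give the diagram of
    \<open>\<omega> r\<close>.\<close>
  have Om: "\<Omega> (r + i) = \<delta> i" for i unfolding \<Omega>_def using \<delta>(1) by (cases i) auto
  have ON: "\<Omega> N = {}" using Om[of m] \<delta>(2) unfolding N_def by simp
  have Ostep: "\<Omega> i \<noteq> \<Omega> (Suc i) \<and> (le1 (\<Omega> i) (\<Omega> (Suc i)) \<or> le1 (\<Omega> (Suc i)) (\<Omega> i))" if i: "i < N" for i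
  proof -
    have "\<exists>c. (c \<notin> \<Omega> i \<and> \<Omega> (Suc i) = insert c (\<Omega> i)) \<or> (c \<notin> \<Omega> (Suc i) \<and> \<Omega> i = insert c (\<Omega> (Suc i)))"
    proof (cases "i < r")
      case True
      then show ?thesis using \<omega>s[OF True] unfolding \<Omega>_def by simp
    next
      case False
      then obtain k where k: "i = r + k" using le_Suc_ex not_less by blast
      then have "k < m" using i unfolding N_def by simp
      from \<delta>(4)[OF this] show ?thesis using Om[of k] Om[of "Suc k"] unfolding k by auto
    qed
    then obtain c where "(c \<notin> \<Omega> i \<and> \<Omega> (Suc i) = insert c (\<Omega> i)) \<or> (c \<notin> \<Omega> (Suc i) \<and> \<Omega> i = insert c (\<Omega> (Suc i)))" by blast
    then show ?thesis unfolding le1_def by blast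
  qed
  have \<omega>O: "\<omega> j = rl (\<Omega> j)" if "j \<le> r" for j unfolding \<Omega>_def using that by simp
  \<comment> \<open>The parts are decreasing, so a cell in row \<open>i\<close> forces
    \<open>i + 1\<close> nonzero parts.\<close>
  have hO: "height_le n (\<Omega> j)" if j: "j \<le> r" for j
    unfolding height_le_def
  proof clarify
    fix i k assume "(i, k) \<in> \<Omega> j"
    then have "k < \<omega> j i" using j by (simp add: \<Omega>_def mem_ferrers)
    have "antimono (\<omega> j)" "finite {i. \<omega> j i \<noteq> 0}" using \<omega>p[OF j] unfolding is_partition_def by auto
    moreover have "{..i} \<subseteq> {i. \<omega> j i \<noteq> 0}"
    proof
      fix i' assume "i' \<in> {..i}"
      then have "\<omega> j i \<le> \<omega> j i'" using \<open>antimono (\<omega> j)\<close> by (simp add: antimonoD)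
      then show "i' \<in> {i. \<omega> j i \<noteq> 0}" using \<open>k < \<omega> j i\<close> by simp
    qed
    ultimately have "card {..i} \<le> num_parts (\<omega> j)" unfolding num_parts_def by (intro card_mono)
    then show "i < n" using \<omega>p[OF j] by simp
  qed
  note ctx = dO O0 ON Ostep
  let ?X = "chords N \<Omega>" and ?C = "cross \<Omega>"
  have X: "pperm ?X" by (rule pperm_chords[OF ctx])
  have gl: "growth_label \<omega> a b = growth_label (\<lambda>i. rl (\<Omega> i)) a b" if "a \<le> b" "b \<le> r" for a b
    by (rule growth_label_cong) (use that \<omega>O in auto)
  have cr: "has_cross (growth_label \<omega> a b) (growth_label \<omega> (Suc a) b) (growth_label \<omega> (Suc a) (Suc b)) \<longleftrightarrow> ?C a b"
    if "a < b" "b < r" for a b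
    using that cross_def[OF ctx, of a b] by (simp add: gl)
  note ev = evacuation_growth[OF ctx \<omega>O rN hO]
  have mat: "sundaram_matching r \<omega> = {{Suc a, Suc b} |a b. a < b \<and> b < r \<and> ?C a b}"
    by (rule sundaram_matching_eq) (rule cr)
  have mat_ev: "sundaram_matching r (evacuation n r \<omega>)
      = {{Suc a, Suc b} |a b. a < b \<and> b < r \<and> ?C (r - Suc b) (r - Suc a)}"
    by (rule sundaram_matching_eq) (rule ev(2))
  have "sundaram_matching r (evacuation n r \<omega>) = reversal r (sundaram_matching r \<omega>)"
  proof
    show "sundaram_matching r (evacuation n r \<omega>) \<subseteq> reversal r (sundaram_matching r \<omega>)"
    proof
      fix P assume "P \<in> sundaram_matching r (evacuation n r \<omega>)"
      then obtain a b where ab: "P = {Suc a, Suc b}" "a < b" "b < r" "?C (r - Suc b) (r - Suc a)" unfolding mat_ev by blast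
      have "r - Suc b < r - Suc a" "r - Suc a < r" using ab(2,3) by auto
      then have "{Suc (r - Suc b), Suc (r - Suc a)} \<in> sundaram_matching r \<omega>" unfolding mat using ab(4) by blast
      moreover have "r + 1 - Suc (r - Suc b) = Suc b" "r + 1 - Suc (r - Suc a) = Suc a" using ab(2,3) by auto
      then have "P = (\<lambda>i. r + 1 - i) ` {Suc (r - Suc b), Suc (r - Suc a)}"
        unfolding ab(1) image_insert image_empty by (simp only: insert_commute)
      ultimately show "P \<in> reversal r (sundaram_matching r \<omega>)" unfolding reversal_def by blast
    qed
    show "reversal r (sundaram_matching r \<omega>) \<subseteq> sundaram_matching r (evacuation n r \<omega>)"
    proof
      fix P assume "P \<in> reversal r (sundaram_matching r \<omega>)"
      then obtain a b where ab: "P = (\<lambda>i. r + 1 - i) ` {Suc a, Suc b}" "a < b" "b < r" "?C a b"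
        unfolding mat reversal_def by blast
      have "r + 1 - Suc a = Suc (r - Suc a)" "r + 1 - Suc b = Suc (r - Suc b)" using ab(2,3) by auto
      then have "P = {Suc (r - Suc b), Suc (r - Suc a)}"
        unfolding ab(1) image_insert image_empty by (simp only: insert_commute)
      moreover have "r - Suc b < r - Suc a" "r - Suc a < r" "?C (r - Suc (r - Suc a)) (r - Suc (r - Suc b))"
        using ab by simp_all
      ultimately show "P \<in> sundaram_matching r (evacuation n r \<omega>)" unfolding mat_ev by blast
    qed
  qed
  moreover have "sundaram_tableau r (evacuation n r \<omega>) = schuetzenberger_evacuation r (sundaram_tableau r \<omega>)"
  proof -
    let ?Z = "\<lambda>q. sh ?X 0 q r N"
    have Z: "sundaram_tableau r \<omega> = chain_filling r ?Z"
      unfolding sundaram_tableau_eq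
    proof (rule chain_filling_cong)
      fix q assume "q \<le> r"
      then show "ferrers (growth_label \<omega> q r) = ?Z q"
        using sh_Gamma[OF ctx, of q r] rN gl[of q r] \<Gamma>_def[OF ctx, of q r] by simp
    qed
    have Z0: "?Z 0 = {}" by simp
    have leZ: "le1 (?Z q) (?Z (Suc q))" for q by (rule sh_le1_q[OF X _ rN]) simp
    have T: "tableau (chain_filling r ?Z)" by (rule tableau_chain_filling[OF Z0 leZ]) (rule sh_dset[OF X])
    have "x \<le> r" if "chain_filling r ?Z c = Some x" for c x
      using that chain_filling_eq_Some(1)[OF Z0 leZ, of r c "x - 1"] by (cases x) auto
    then have ran: "ran (chain_filling r ?Z) \<subseteq> {..r}" unfolding ran_def by blast
    \<comment> \<open>Both tableaux come from one matrix with the rows fixed to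
      \<open>[r, N)\<close>: the original one from initial windows of columns, the evacuated one
      from final windows, by \<open>evacuation_growth\<close> with \<open>b = r\<close>.\<close>
    have "schuetzenberger_evacuation r (chain_filling r ?Z) = chain_filling r (\<lambda>q. sh ?X (r - q) r r N)"
      by (rule schuetzenberger_evacuation_eq[OF T ran X]) (rule cells_le_chain_filling[OF Z0 leZ, symmetric])
    also have "\<dots> = sundaram_tableau r (evacuation n r \<omega>)"
      unfolding sundaram_tableau_eq
    proof (rule chain_filling_cong)
      fix q assume "q \<le> r"
      then show "sh ?X (r - q) r r N = ferrers (growth_label (evacuation n r \<omega>) q r)"
        using ev(1)[of q r] by (simp add: ferrers_rl sh_dset[OF X])
    qed
    finally show ?thesis unfolding Z by simp
  qed
  ultimately show ?thesis by blast
qed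

end
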